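(* Fix $c>0$ and a sign $\sigma\in\{+1,-1\}$. For all $N$ large enough that $\tau_N:=1-\frac{c^2}{(2N)^{1/3}}\in(0,1)$, let $$Q(\zeta)=Q_N(\zeta):=\frac{1}{1-\tau_N^2}\bigl(|\zeta|^2-\tau_N\operatorname{Re}\zeta^2\bigr),\qquad\zeta\in\mathbb{C},$$ let $p=p_N=\sigma\sqrt2(1+\tau_N)$, let $\boldsymbol\zeta=\{\zeta_j\}_{j=1}^N$ be the planar symplectic ensemble with potential $Q$, and let $R_{N,k}$ be the $k$-point correlation function of the rescaled process $z_j=\sigma\gamma_N^{-1}(\zeta_j-p)$, where $\gamma_N=\sqrt{2(1-\tau_N^2)/N}$. Then for every $k\ge1$, as $N\to\infty$, $R_{N,k}$ converges locally uniformly on $\mathbb{C}^k$ to $$R_k(z_1,\dots,z_k)=\prod_{j=1}^k(\bar z_j-z_j)\,\mathrm{Pf}\Bigl[e^{-|z_j|^2-|z_l|^2}\begin{pmatrix}\kappa(z_j,z_l)&\kappa(z_j,\bar z_l)\\ \kappa(\bar z_j,z_l)&\kappa(\bar z_j,\bar z_l)\end{pmatrix}\Bigr]_{j,l=1}^k,$$ where $$\kappa(z,w)=\sqrt\pi\,e^{z^2+w^2}\int_{-\infty}^0W(f_w,f_z)(u)\,du,\qquad f_z(u)=2c\int_0^u e^{c^3(z-t)+\frac{c^6}{12}}\,\mathrm{Ai}\Bigl(2c(z-t)+\frac{c^4}{4}\Bigr)dt.$$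
   Context: Planar symplectic ensemble with potential $Q$ (satisfying $Q(\zeta)=Q(\bar\zeta)$): the random configuration $\boldsymbol\zeta=(\zeta_1,\dots,\zeta_N)\in\mathbb{C}^N$ with law $$d\mathbf{P}_N(\boldsymbol\zeta)=\frac1{Z_N}\prod_{j>k=1}^N|\zeta_j-\zeta_k|^2|\zeta_j-\bar\zeta_k|^2\prod_{j=1}^N|\zeta_j-\bar\zeta_j|^2e^{-NQ(\zeta_j)}\,dA(\zeta_j),\qquad dA(\zeta)=\tfrac1\pi d^2\zeta,$$ where $Z_N$ is the normalising constant and $d^2\zeta$ is Lebesgue measure on $\mathbb{C}$. Writing $\mathbf{P}_N(\zeta_1,\dots,\zeta_N)$ for the density of this law with respect to $\prod_j dA(\zeta_j)$, the $k$-point correlation function is $$\mathbf{R}_{N,k}(\zeta_1,\dots,\zeta_k)=\frac{N!}{(N-k)!}\int_{\mathbb{C}^{N-k}}\mathbf{P}_N(\zeta_1,\dots,\zeta_N)\prod_{j=k+1}^N dA(\zeta_j).$$ For the rescaled process, $R_{N,k}(z_1,\dots,z_k)=\gamma_N^{2k}\mathbf{R}_{N,k}(\zeta_1,\dots,\zeta_k)$ with $\zeta_j=p+\sigma\gamma_Nz_j$. The factor $\sigma=e^{i\theta}$ is the outward normal direction at the edge point $p$ of the limiting support. The scale is $\gamma_N=1/\sqrt{N\delta}$ with $\delta=\partial\bar\partial Q(p)/2=\frac{1}{2(1-\tau_N^2)}$. $\mathrm{Ai}$ is the Airy function. $W(f,g)=fg'-gf'$ is the Wronskian (derivatives in $u$).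 For a skew-symmetric $2n\times2n$ matrix $A=(a_{j,k})$, $\mathrm{Pf}(A)=\frac{1}{2^nn!}\sum_{\sigma\in S_{2n}}\mathrm{sgn}(\sigma)\prod_{j=1}^na_{\sigma(2j-1),\sigma(2j)}$ (here $\sigma$ is a summation variable running over permutations of $2n$ letters); it is applied to the $2k\times2k$ matrix made of the indicated $2\times2$ blocks. *)

theory Defs
  imports "HOL-Analysis.Analysis" "HOL-Combinatorics.Permutations"
begin

text \<open>
  Points of \<open>\<complex>\<^sup>n\<close> are functions on the index set \<open>{..<n}\<close>; indices start at \<open>0\<close>.
\<close>

subsection \<open>Planar symplectic ensembles\<close>

text \<open>The normalised area measure \<open>dA = d\<^sup>2\<zeta> / \<pi>\<close>.\<close>

definition area_measure :: "complex measure" where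
  "area_measure = density lborel (\<lambda>_. ennreal (1 / pi))"

definition symplectic_weight :: "(complex \<Rightarrow> real) \<Rightarrow> nat \<Rightarrow> (nat \<Rightarrow> complex) \<Rightarrow> real" where
  "symplectic_weight Q N \<zeta> =
     (\<Prod>j<N. \<Prod>k<j. (cmod (\<zeta> j - \<zeta> k))\<^sup>2 * (cmod (\<zeta> j - cnj (\<zeta> k)))\<^sup>2) *
     (\<Prod>j<N. (cmod (\<zeta> j - cnj (\<zeta> j)))\<^sup>2 * exp (- real N * Q (\<zeta> j)))"

definition partition_function :: "(complex \<Rightarrow> real) \<Rightarrow> nat \<Rightarrow> real" where
  "partition_function Q N =
     (\<integral>\<zeta>. symplectic_weight Q N \<zeta> \<partial>(Pi\<^sub>M {..<N} (\<lambda>_. area_measure)))"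

text \<open>Density of the law of the ensemble with respect to the product of the area measures.\<close>

definition symplectic_density :: "(complex \<Rightarrow> real) \<Rightarrow> nat \<Rightarrow> (nat \<Rightarrow> complex) \<Rightarrow> real" where
  "symplectic_density Q N \<zeta> = symplectic_weight Q N \<zeta> / partition_function Q N"

text \<open>
  The \<open>k\<close>-point correlation function; it is meaningful for \<open>k \<le> N\<close>.
  The function \<open>merge\<close> glues the \<open>k\<close> given points to the \<open>N - k\<close> points integrated out.
\<close>

definition correlation ::
    "(complex \<Rightarrow> real) \<Rightarrow> nat \<Rightarrow> nat \<Rightarrow> (nat \<Rightarrow> complex) \<Rightarrow> real" where
  "correlation Q N k \<zeta> = fact N / fact (N - k) *
     (\<integral>\<eta>. symplectic_density Q N (merge {..<k} {k..<N} (\<zeta>, \<eta>))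
        \<partial>(Pi\<^sub>M {k..<N} (\<lambda>_. area_measure)))"

text \<open>
  Correlation function of the rescaled process \<open>z\<^sub>j\<close> given by \<open>\<zeta>\<^sub>j = p + \<sigma> \<gamma> z\<^sub>j\<close>,
  where \<open>\<sigma>\<close> is unimodular and \<open>\<gamma> > 0\<close>.
\<close>

definition rescaled_correlation ::
    "(complex \<Rightarrow> real) \<Rightarrow> complex \<Rightarrow> complex \<Rightarrow> real \<Rightarrow> nat \<Rightarrow> nat \<Rightarrow> (nat \<Rightarrow> complex) \<Rightarrow> real" where
  "rescaled_correlation Q p \<sigma> \<gamma> N k z =
     \<gamma> ^ (2 * k) * correlation Q N k (\<lambda>j. p + \<sigma> * complex_of_real \<gamma> * z j)"

definition elliptic_potential :: "real \<Rightarrow> complex \<Rightarrow> real" where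
  "elliptic_potential \<tau> \<zeta> = 1 / (1 - \<tau>\<^sup>2) * ((cmod \<zeta>)\<^sup>2 - \<tau> * Re (\<zeta>\<^sup>2))"


subsection \<open>The limiting correlation functions\<close>

text \<open>
  The Airy function on the complex plane, by its contour integral
  \<open>Ai(z) = 1/(2\<pi>i) \<integral> exp(t\<^sup>3/3 - z t) dt\<close> along the vertical line \<open>t = 1 + i s\<close>, \<open>s \<in> \<real>\<close>. The
  integrand has modulus \<open>O(exp(- s\<^sup>2 + C \<bar>s\<bar>))\<close> there, so the integral converges absolutely for
  every complex \<open>z\<close>; the line may be bent to the usual contour from \<open>\<infinity> exp(-\<pi>i/3)\<close> to
  \<open>\<infinity> exp(\<pi>i/3)\<close>. On the real axis it equals \<open>1/\<pi> \<integral>\<^sub>0\<^sup>\<infinity> cos(t\<^sup>3/3 + x t) dt\<close>.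
\<close>

definition Airy_Ai :: "complex \<Rightarrow> complex" where
  "Airy_Ai z = 1 / (2 * of_real pi) *
     (CLBINT s. exp ((1 + \<i> * of_real s) ^ 3 / 3 - z * (1 + \<i> * of_real s)))"

definition wronskian :: "(real \<Rightarrow> complex) \<Rightarrow> (real \<Rightarrow> complex) \<Rightarrow> real \<Rightarrow> complex" where
  "wronskian f g u =
     f u * vector_derivative g (at u) - g u * vector_derivative f (at u)"

text \<open>The Pfaffian of the skew-symmetric matrix \<open>(A i j)\<close>, \<open>i, j < 2 n\<close>.\<close>

definition pfaffian :: "nat \<Rightarrow> (nat \<Rightarrow> nat \<Rightarrow> complex) \<Rightarrow> complex" where
  "pfaffian n A = 1 / (2 ^ n * fact n) *
     (\<Sum>s | s permutes {..<2 * n}. of_int (sign s) * (\<Prod>j<n. A (s (2 * j)) (s (2 * j + 1))))"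

definition edge_f :: "real \<Rightarrow> complex \<Rightarrow> real \<Rightarrow> complex" where
  "edge_f c z u = 2 * of_real c *
     (CLBINT t=0..u. exp (of_real (c ^ 3) * (z - of_real t) + of_real (c ^ 6 / 12)) *
        Airy_Ai (2 * of_real c * (z - of_real t) + of_real (c ^ 4 / 4)))"

definition edge_kappa :: "real \<Rightarrow> complex \<Rightarrow> complex \<Rightarrow> complex" where
  "edge_kappa c z w = of_real (sqrt pi) * exp (z\<^sup>2 + w\<^sup>2) *
     (CLBINT u=-\<infinity>..0. wronskian (edge_f c w) (edge_f c z) u)"

text \<open>
  Row \<open>2 j\<close> of the block matrix belongs to \<open>z\<^sub>j\<close>, row \<open>2 j + 1\<close> to its conjugate; likewise for
  columns.
\<close>

definition conj_pair :: "(nat \<Rightarrow> complex) \<Rightarrow> nat \<Rightarrow> complex" where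
  "conj_pair z a = (if even a then z (a div 2) else cnj (z (a div 2)))"

definition edge_correlation :: "real \<Rightarrow> nat \<Rightarrow> (nat \<Rightarrow> complex) \<Rightarrow> complex" where
  "edge_correlation c k z = (\<Prod>j<k. cnj (z j) - z j) *
     pfaffian k (\<lambda>a b.
       of_real (exp (- (cmod (z (a div 2)))\<^sup>2 - (cmod (z (b div 2)))\<^sup>2)) *
       edge_kappa c (conj_pair z a) (conj_pair z b))"


subsection \<open>Locally uniform convergence\<close>

definition locally_uniform_limit ::
    "'a topology \<Rightarrow> ('b \<Rightarrow> 'a \<Rightarrow> 'c::metric_space) \<Rightarrow> ('a \<Rightarrow> 'c) \<Rightarrow> 'b filter \<Rightarrow> bool" where
  "locally_uniform_limit T f l F \<longleftrightarrow>
     (\<forall>x\<in>topspace T. \<exists>U. openin T U \<and> x \<in> U \<and> uniform_limit U f l F)"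

text \<open>The space \<open>\<complex>\<^sup>k\<close> with its usual topology.\<close>

abbreviation complex_space :: "nat \<Rightarrow> (nat \<Rightarrow> complex) topology" where
  "complex_space k \<equiv> product_topology (\<lambda>_. euclidean) {..<k}"

end

(*
  The law of the ensemble is a Vandermonde determinant in the points and their conjugates, so by
  de Bruijn integration against monic skew-orthogonal polynomials its correlation functions are
  Pfaffians of the prekernel sum_k (q_{2k+1}(z) q_{2k}(w) - q_{2k}(z) q_{2k+1}(w)) / (2 rho_k). For the
  elliptic potential these polynomials are q_{2k+1} = H_{2k+1} and q_{2k} = a combination of
  H_0, H_2, ..., H_{2k}, with H_n rescaled Hermite polynomials, so the prekernel is a double sum of
  products H_{2k+1}(z) H_{2l}(w) over l <= k < N.

  Counted from the top degree 2N in units of m = (2N)^(1/3), the Hermite polynomial of degree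
  2N - x m at the edge is, after division by its Gaussian and its normalisation, a Gaussian-cubic
  integral over a vertical line which converges to an Airy function of z + x / (2c) by dominated
  convergence. The double sum is thus a Riemann sum for the double integral over 0 <= x <= y, whose
  antisymmetrisation in z and w is the Wronskian integral defining kappa; Stirling's formula gives
  the constant. Everything holds along convergent sequences of points, that is, locally uniformly.
*)

theory Submission
  imports Defs "HOL-Probability.Probability" "HOL-Computational_Algebra.Polynomial"
begin

section \<open>Pfaffian structure of the ensemble\<close>

text \<open>The cubic comes from a nearly degenerate saddle. At the edge the Hermite integrand is
  \<open>exp (N * (2 * ln u + (u - p)\<^sup>2 / (2 * \<tau>)))\<close>; for
  \<open>p = sqrt 2 * (1 + \<tau>)\<close> the inner bracket is critical at
  \<open>u = sqrt 2\<close>, with second derivative \<open>(1 - \<tau>) / \<tau>\<close> of order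
  \<open>1 / m\<close>. Under \<open>u = sqrt 2 * (1 + t / m)\<close> and
  \<open>2 * N = m ^ 3\<close> the quadratic and cubic terms are both of order one; completing the
  cube then produces the shifts by powers of \<open>c\<close>. The obstacle is domination: of about
  \<open>N\<^sup>2 / 2\<close> terms of the double sum only about \<open>m\<^sup>2\<close> matter.
  On the line \<open>Re t = 1\<close> every lost degree costs a factor
  \<open>1 / (1 + 1 / m)\<close>, which becomes an exponential majorant of the Riemann sum
  independent of \<open>N\<close>, and the integrand itself stays below a fixed Gaussian. The weight
  is not holomorphic, but it is \<open>exp (-2 * (cmod z)\<^sup>2)\<close> times one holomorphic
  factor at \<open>z\<close> and one at \<open>cnj z\<close>. These are distributed over the rows of
  the Pfaffian, so that each Hermite polynomial is normalised separately. The kernel carries the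
  scale to the third power: two powers from the rescaling, one from the difference of a point and
  its conjugate.\<close>

definition alternating_sum :: "nat \<Rightarrow> ((nat \<Rightarrow> nat) \<Rightarrow> complex) \<Rightarrow> complex" where
  "alternating_sum n F = (\<Sum>s | s permutes {..<n}. of_int (sign s) * F s)"

lemma alternating_sum_cong:
  assumes "\<And>s. s permutes {..<n} \<Longrightarrow> F s = G s"
  shows "alternating_sum n F = alternating_sum n G"
  unfolding alternating_sum_def by (intro sum.cong) (auto simp: assms)

lemma sign_permutes_compose:
  fixes n :: nat
  assumes "p permutes {..<n}" "q permutes {..<n}"
  shows "sign (p \<circ> q) = sign p * sign q"
  using assms by (meson finite_lessThan permutation_permutes sign_compose)

lemma alternating_sum_left:
  assumes "p permutes {..<n}"
  shows "alternating_sum n F = of_int (sign p) * alternating_sum n (\<lambda>s. F (p \<circ> s))"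
proof -
  have "alternating_sum n F = (\<Sum>s | s permutes {..<n}. of_int (sign (p \<circ> s)) * F (p \<circ> s))"
    unfolding alternating_sum_def using setum_permutations_compose_left[OF assms]
    by auto
  also have "\<dots> = of_int (sign p) * alternating_sum n (\<lambda>s. F (p \<circ> s))"
    unfolding alternating_sum_def sum_distrib_left
    by (intro sum.cong) (auto simp: sign_permutes_compose[OF assms])
  finally show ?thesis .
qed

lemma alternating_sum_right:
  assumes "p permutes {..<n}"
  shows "alternating_sum n F = of_int (sign p) * alternating_sum n (\<lambda>s. F (s \<circ> p))"
proof -
  have "alternating_sum n F = (\<Sum>s | s permutes {..<n}. of_int (sign (s \<circ> p)) * F (s \<circ> p))"
    unfolding alternating_sum_def using sum_permutations_compose_right[OF assms]
    by auto
  also have "\<dots> = of_int (sign p) * alternating_sum n (\<lambda>s. F (s \<circ> p))"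
    unfolding alternating_sum_def sum_distrib_left
    by (intro sum.cong) (auto simp: sign_permutes_compose[OF _ assms])
  finally show ?thesis .
qed

lemma alternating_sum_inv:
  "alternating_sum n F = alternating_sum n (\<lambda>s. F (inv s))"
proof -
  have "alternating_sum n F = (\<Sum>s | s permutes {..<n}. of_int (sign (inv s)) * F (inv s))"
    unfolding alternating_sum_def using sum_permutations_inverse by auto
  also have "\<dots> = alternating_sum n (\<lambda>s. F (inv s))"
    unfolding alternating_sum_def
    by (intro sum.cong) (auto simp: sign_inverse permutation_permutes intro!: sign_inverse)
  finally show ?thesis .
qed


text \<open>Composition with the transposition reverses every sign and keeps every value of
  \<open>F\<close>, so the sum is its own negative. For repeated points this is the vanishing of a
  determinant with two equal columns.\<close>

lemma alternating_sum_eq_0: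
  assumes "a < n" "b < n" "a \<noteq> b" "\<And>s. s permutes {..<n} \<Longrightarrow> F (s \<circ> Transposition.transpose a b) = F s"
  shows "alternating_sum n F = 0"
proof -
  have t: "Transposition.transpose a b permutes {..<n}"
    using assms by (intro permutes_swap_id) auto
  have "alternating_sum n F = - alternating_sum n (\<lambda>s. F (s \<circ> Transposition.transpose a b))"
    using alternating_sum_right[OF t, of F] assms(3) by (simp add: sign_swap_id)
  also have "alternating_sum n (\<lambda>s. F (s \<circ> Transposition.transpose a b)) = alternating_sum n F"
    by (rule alternating_sum_cong) (rule assms)
  finally show ?thesis by simp
qed

lemma prod_transpose_args:
  fixes g :: "nat \<Rightarrow> 'a \<Rightarrow> 'b :: comm_monoid_mult"
  assumes "a < n" "b < n" "x a = x b"
  shows "(\<Prod>i<n. g ((s \<circ> Transposition.transpose a b) i) (x i)) = (\<Prod>i<n. g (s i) (x i))"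
proof -
  have t: "Transposition.transpose a b permutes {..<n}"
    using assms by (intro permutes_swap_id) auto
  have "(\<Prod>i<n. g ((s \<circ> Transposition.transpose a b) i) (x i)) = (\<Prod>i<n. g (s (Transposition.transpose a b i)) (x (Transposition.transpose a b i)))"
    by (rule prod.cong) (auto simp: Transposition.transpose_def assms)
  also have "\<dots> = (\<Prod>i<n. g (s i) (x i))"
    using permutes_imp_bij[OF t] by (rule prod.reindex_bij_betw)
  finally show ?thesis .
qed

lemma permutes_Suc_fixing:
  fixes n :: nat
  shows "{s. s permutes {..<Suc n} \<and> s n = n} = {s. s permutes {..<n}}"
proof (intro set_eqI iffI; clarsimp)
  fix s assume "s permutes {..<Suc n}" "s n = n"
  then show "s permutes {..<n}"
    by (metis DiffE lessThan_Suc insertE permutes_superset lessThan_iff)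
next
  fix s assume "s permutes {..<n}"
  then show "s permutes {..<Suc n} \<and> s n = n"
    using permutes_subset[of s "{..<n}" "{..<Suc n}"] permutes_not_in[of s "{..<n}" n] by simp
qed

text \<open>Induction on the number of points: in its last variable the sum is a polynomial of
  degree at most \<open>n\<close> that vanishes at the other \<open>n\<close> points and has the
  smaller Vandermonde product as its coefficient of order \<open>n\<close>. Allowing any monic
  sequence lets the skew-orthogonal polynomials enter directly, without column operations.\<close>

lemma alternating_sum_vandermonde:
  fixes q :: "nat \<Rightarrow> complex poly"
  assumes deg: "\<And>i. degree (q i) = i" and monic: "\<And>i. lead_coeff (q i) = 1"
  shows "alternating_sum n (\<lambda>s. \<Prod>a<n. poly (q (s a)) (x a)) = (\<Prod>b<n. \<Prod>a<b. x b - x a)"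
proof (induction n)
  case 0
  have "{s::nat \<Rightarrow> nat. s permutes {..<0}} = {id}" by auto
  then show ?case unfolding alternating_sum_def by simp
next
  case (Suc n)
  let ?V = "\<Prod>b<n. \<Prod>a<b. x b - x a"
  show ?case
  \<comment> \<open>The main argument counts roots and therefore wants distinct points; if two
    points coincide, both sides are zero.\<close>
  proof (cases "inj_on x {..<Suc n}")
    case False
    then obtain a b where ab: "a < Suc n" "b < Suc n" "a < b" "x a = x b"
      unfolding inj_on_def by (metis lessThan_iff nat_neq_iff)
    have "(\<Prod>b<Suc n. \<Prod>a<b. x b - x a) = 0"
    proof (rule prod_zero)
      show "\<exists>b\<in>{..<Suc n}. (\<Prod>a<b. x b - x a) = 0"
        using ab by (intro bexI[of _ b] prod_zero bexI[of _ a]) simp_all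
    qed simp
    moreover have "alternating_sum (Suc n) (\<lambda>s. \<Prod>a<Suc n. poly (q (s a)) (x a)) = 0"
      using ab by (intro alternating_sum_eq_0[of a _ b] prod_transpose_args[where g = "\<lambda>i. poly (q i)"]) simp_all
    ultimately show ?thesis by simp
  next
    case inj: True
    define c where "c s = of_int (sign s) * (\<Prod>a<n. poly (q (s a)) (x a))" for s
    define P where "P = (\<Sum>s | s permutes {..<Suc n}. smult (c s) (q (s n)))"
    have fin: "finite {s::nat\<Rightarrow>nat. s permutes {..<Suc n}}"
      by (rule finite_permutations) simp
    have polyP: "poly P y = alternating_sum (Suc n) (\<lambda>s. \<Prod>a<Suc n. poly (q (s a)) ((x(n := y)) a))" for y
      unfolding P_def alternating_sum_def poly_sum poly_smult c_def
      by (intro sum.cong refl) (simp add: mult.assoc)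
    have root: "poly P (x b) = 0" if "b < n" for b
      unfolding polyP
      using that by (intro alternating_sum_eq_0[of b _ n] prod_transpose_args[where g = "\<lambda>i. poly (q i)"]) simp_all
    have sn: "s n \<le> n" if "s permutes {..<Suc n}" for s
      using permutes_in_image[OF that, of n] by auto
    have "degree P \<le> n"
      unfolding P_def using sn
      by (intro degree_sum_le fin) (auto intro!: order.trans[OF degree_smult_le] simp: deg)
    have coeffP: "coeff P n = ?V"
    proof -
      have "coeff P n = (\<Sum>s | s permutes {..<Suc n}. c s * coeff (q (s n)) n)"
        unfolding P_def by (simp add: coeff_sum)
      also have "\<dots> = (\<Sum>s | s permutes {..<Suc n}. if s n = n then c s else 0)"
      proof (intro sum.cong refl)
        fix s assume "s \<in> {s. s permutes {..<Suc n}}"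
        then show "c s * coeff (q (s n)) n = (if s n = n then c s else 0)"
          using sn[of s] monic[of n] by (auto simp: deg coeff_eq_0)
      qed
      also have "\<dots> = sum c {s \<in> {s. s permutes {..<Suc n}}. s n = n}"
        by (rule sum.inter_filter[OF fin, symmetric])
      also have "{s \<in> {s. s permutes {..<Suc n}}. s n = n} = {s. s permutes {..<n}}"
        using permutes_Suc_fixing[of n] by simp
      also have "sum c {s. s permutes {..<n}} = alternating_sum n (\<lambda>s. \<Prod>a<n. poly (q (s a)) (x a))"
        unfolding alternating_sum_def c_def ..
      finally show ?thesis by (simp add: Suc.IH)
    qed
    \<comment> \<open>\<open>R\<close> measures the deviation of \<open>P\<close> from its expected
      factorisation. Its coefficient of order \<open>n\<close> cancels, so it has degree below
      \<open>n\<close> unless it is zero, yet it has \<open>n\<close> distinct roots.\<close>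
    define R where "R = P - smult ?V (\<Prod>a<n. [:- x a, 1:])"
    have deg_prod: "degree (\<Prod>a<n. [:- x a, 1:]) = n"
      by (subst degree_prod_eq_sum_degree) auto
    have "coeff (\<Prod>a<n. [:- x a, 1:]) n = 1"
      using lead_coeff_prod[of "\<lambda>a. [:- x a, 1:]" "{..<n}"] by (simp add: deg_prod)
    then have R_n: "coeff R n = 0"
      by (simp add: R_def coeffP)
    have R_deg: "degree R \<le> n"
      unfolding R_def using \<open>degree P \<le> n\<close> deg_prod
      by (intro degree_diff_le order.trans[OF degree_smult_le]) auto
    have "R = 0"
    proof (rule ccontr)
      assume "R \<noteq> 0"
      then have "degree R < n"
        using R_n R_deg by (metis le_neq_implies_less leading_coeff_0_iff)
      moreover have "x ` {..<n} \<subseteq> {z. poly R z = 0}"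
        using root by (auto simp: R_def poly_prod)
      then have "card (x ` {..<n}) \<le> card {z. poly R z = 0}"
        using \<open>R \<noteq> 0\<close> by (intro card_mono poly_roots_finite)
      moreover have "card (x ` {..<n}) = n"
        using inj by (subst card_image) (auto intro: inj_on_subset)
      moreover have "card {z. poly R z = 0} \<le> degree R"
        using \<open>R \<noteq> 0\<close> by (rule card_poly_roots_bound)
      ultimately show False by simp
    qed
    then have "poly P (x n) = ?V * (\<Prod>a<n. x n - x a)"
      by (simp add: R_def poly_prod)
    then show ?thesis by (simp add: polyP)
  qed
qed


section \<open>Paired rows, skew blocks and the removal of one particle\<close>

lemma alternating_sum_0: "alternating_sum 0 F = F id"
proof -
  have "{s::nat \<Rightarrow> nat. s permutes {..<0}} = {id}" by auto
  then show ?thesis unfolding alternating_sum_def by simp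
qed

lemma alternating_sum_cmult: "alternating_sum n (\<lambda>s. c * F s) = c * alternating_sum n F"
  unfolding alternating_sum_def by (simp add: sum_distrib_left mult_ac)

lemma alternating_sum_sum: "alternating_sum n (\<lambda>s. \<Sum>i\<in>I. F i s) = (\<Sum>i\<in>I. alternating_sum n (F i))"
  unfolding alternating_sum_def by (simp add: sum_distrib_left) (rule sum.swap)

text \<open>Lifts a map of particles to the rows \<open>2 j\<close> and \<open>2 j + 1\<close> belonging to particle \<open>j\<close>.\<close>

definition pair_map :: "(nat \<Rightarrow> nat) \<Rightarrow> nat \<Rightarrow> nat" where
  "pair_map m a = 2 * m (a div 2) + a mod 2"

lemma pair_map_simps [simp]:
  "pair_map m (2 * j) = 2 * m j" "pair_map m (Suc (2 * j)) = Suc (2 * m j)"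
  "pair_map m a div 2 = m (a div 2)" "even (pair_map m a) \<longleftrightarrow> even a"
  by (auto simp: pair_map_def)

lemma pair_map_comp: "pair_map (m \<circ> p) = pair_map m \<circ> pair_map p"
  by (rule ext) (simp add: pair_map_def)

lemma pair_map_id: "pair_map id = id"
  by (rule ext) (simp add: pair_map_def)

lemma pair_map_transpose:
  "pair_map (Transposition.transpose i j) =
     Transposition.transpose (2 * i) (2 * j) \<circ> Transposition.transpose (Suc (2 * i)) (Suc (2 * j))"
proof
  fix a :: nat
  obtain b where "a = 2 * b \<or> a = Suc (2 * b)" by (metis even_two_times_div_two odd_two_times_div_two_succ Suc_eq_plus1)
  then show "pair_map (Transposition.transpose i j) a =
     (Transposition.transpose (2 * i) (2 * j) \<circ> Transposition.transpose (Suc (2 * i)) (Suc (2 * j))) a"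
    by (auto simp: Transposition.transpose_def) presburger+
qed

text \<open>Each transposition of particles lifts to two transpositions of rows, hence to an even
  permutation. Relabelling particles therefore never costs a sign.\<close>

lemma pair_map_permutes_sign:
  assumes "p permutes {..<n}"
  shows "pair_map p permutes {..<2 * n} \<and> sign (pair_map p) = 1"
  using assms finite_lessThan
proof (induction p rule: permutes_induct)
  case id
  show ?case by (simp only: pair_map_id permutes_id sign_id)
next
  case (swap i j p)
  have "Transposition.transpose (2 * i) (2 * j) permutes {..<2 * n}"
    "Transposition.transpose (Suc (2 * i)) (Suc (2 * j)) permutes {..<2 * n}"
    using swap by (intro permutes_swap_id; simp; linarith)+
  then have t: "pair_map (Transposition.transpose i j) permutes {..<2 * n}"
    unfolding pair_map_transpose by (rule permutes_compose[rotated])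
  have s: "sign (pair_map (Transposition.transpose i j)) = 1"
    unfolding pair_map_transpose using swap(3)
    by (subst sign_compose) (auto simp: permutation_swap_id sign_swap_id)
  show ?case
    unfolding pair_map_comp using t s swap.IH
    by (metis permutes_compose sign_permutes_compose mult_1)
qed

definition skew_unit :: "nat \<Rightarrow> nat \<Rightarrow> nat \<Rightarrow> complex" where
  "skew_unit i a b = (if a = 2 * i \<and> b = Suc (2 * i) then 1 else if a = Suc (2 * i) \<and> b = 2 * i then -1 else 0)"

text \<open>This is the Gram matrix of a skew-orthogonal sequence with skew norms
  \<open>\<rho>\<close>; one entry of it is what remains of a particle that has been integrated
  out.\<close>

definition skew_block :: "(nat \<Rightarrow> complex) \<Rightarrow> nat \<Rightarrow> nat \<Rightarrow> complex" where
  "skew_block \<rho> a b = (if a div 2 = b div 2 then \<rho> (a div 2) * (of_bool (even a \<and> odd b) - of_bool (odd a \<and> even b)) else 0)"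

lemma skew_block_eq_sum:
  assumes "a < 2 * n"
  shows "skew_block \<rho> a b = (\<Sum>i<n. \<rho> i * skew_unit i a b)"
proof -
  have "(\<Sum>i<n. \<rho> i * skew_unit i a b) = (\<Sum>i\<in>{a div 2}. \<rho> i * skew_unit i a b)"
    using assms by (intro sum.mono_neutral_right) (auto simp: skew_unit_def)
  also have "\<dots> = skew_block \<rho> a b"
    unfolding skew_unit_def skew_block_def
    by (cases "even a"; cases "even b")
       (auto elim!: evenE oddE simp: Suc_double_not_eq_double double_not_eq_Suc_double)
  finally show ?thesis ..
qed

lemma skew_block_pair_map:
  assumes "inj_on m {..<n}" "a < 2 * n" "b < 2 * n"
  shows "skew_block \<rho> (pair_map m a) (pair_map m b) = skew_block (\<rho> \<circ> m) a b"
proof -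
  have "m (a div 2) = m (b div 2) \<longleftrightarrow> a div 2 = b div 2"
    using assms by (intro inj_on_eq_iff) auto
  then show ?thesis unfolding skew_block_def by simp
qed

lemma skew_unit_pair_map:
  assumes "bij p" 
  shows "skew_unit (p i) (pair_map p a) (pair_map p b) = skew_unit i a b"
proof -
  have "p x = p y \<longleftrightarrow> x = y" for x y using assms by (simp add: bij_def inj_eq)
  then show ?thesis
    unfolding skew_unit_def
    by (cases "even a"; cases "even b") (auto elim!: evenE oddE simp: pair_map_def Suc_double_not_eq_double double_not_eq_Suc_double)
qed

text \<open>
  In a permutation which contributes, the last two rows are matched with each other, and the two
  matchings contribute equally.
\<close>

lemma alternating_sum_skew_unit_last:
  assumes F: "\<And>s t. (\<And>a. a < 2 * n \<Longrightarrow> s a = t a) \<Longrightarrow> F s = F t"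
  shows "alternating_sum (2 * Suc n) (\<lambda>s. F s * skew_unit n (s (2 * n)) (s (Suc (2 * n)))) =
         2 * alternating_sum (2 * n) F"
proof -
  let ?P = "\<lambda>n. {s. s permutes {..<2 * n}}" and ?t = "Transposition.transpose (2 * n) (Suc (2 * n))"
  let ?G = "\<lambda>s. of_int (sign s) * (F s * skew_unit n (s (2 * n)) (s (Suc (2 * n))))"
  have t: "?t permutes {..<2 * Suc n}" by (intro permutes_swap_id) auto
  have fin: "finite (?P (Suc n))" by (rule finite_permutations) simp
  have sub: "?P n \<subseteq> ?P (Suc n)" by (auto intro: permutes_subset)
  have fix1: "s (2 * n) = 2 * n" "s (Suc (2 * n)) = Suc (2 * n)" if "s \<in> ?P n" for s
    using that permutes_not_in[of s "{..<2 * n}"] by auto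
  have P_iff: "s \<in> ?P n" if "s \<in> ?P (Suc n)" "s (2 * n) = 2 * n" "s (Suc (2 * n)) = Suc (2 * n)" for s
  proof -
    have "s permutes {..<2 * n}"
    proof (rule permutes_superset)
      show "s permutes {..<2 * Suc n}" using that by simp
      fix x assume "x \<in> {..<2 * Suc n} - {..<2 * n}"
      then have "x = 2 * n \<or> x = Suc (2 * n)" by auto
      then show "s x = x" using that by auto
    qed
    then show ?thesis by simp
  qed
  have inj: "inj_on (\<lambda>s. s \<circ> ?t) (?P n)"
    by (rule inj_onI) (metis comp_assoc comp_id transpose_comp_involutory)
  have "sum ?G (?P (Suc n)) = sum ?G (?P n \<union> (\<lambda>s. s \<circ> ?t) ` ?P n)"
  proof (rule sum.mono_neutral_right[OF fin])
    show "?P n \<union> (\<lambda>s. s \<circ> ?t) ` ?P n \<subseteq> ?P (Suc n)"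
      using sub t by (auto intro!: permutes_compose)
    show "\<forall>s\<in>?P (Suc n) - (?P n \<union> (\<lambda>s. s \<circ> ?t) ` ?P n). ?G s = 0"
    proof
      fix s assume s: "s \<in> ?P (Suc n) - (?P n \<union> (\<lambda>s. s \<circ> ?t) ` ?P n)"
      have "\<not> (s (2 * n) = 2 * n \<and> s (Suc (2 * n)) = Suc (2 * n))"
        using P_iff s by blast
      moreover have "\<not> (s (2 * n) = Suc (2 * n) \<and> s (Suc (2 * n)) = 2 * n)"
      proof
        assume *: "s (2 * n) = Suc (2 * n) \<and> s (Suc (2 * n)) = 2 * n"
        then have "s \<circ> ?t \<in> ?P n"
          using s t by (intro P_iff) (auto intro!: permutes_compose)
        moreover have "s = (s \<circ> ?t) \<circ> ?t" by (simp add: comp_assoc)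
        ultimately show False using s by blast
      qed
      ultimately show "?G s = 0" by (auto simp: skew_unit_def)
    qed
  qed
  also have "\<dots> = sum ?G (?P n) + sum ?G ((\<lambda>s. s \<circ> ?t) ` ?P n)"
  proof (rule sum.union_disjoint)
    show "?P n \<inter> (\<lambda>s. s \<circ> ?t) ` ?P n = {}"
      using fix1 by (auto simp: fun_eq_iff) (metis n_not_Suc_n fix1 mem_Collect_eq comp_apply transpose_apply_first)
  qed (use fin sub finite_subset in auto)
  also have "sum ?G (?P n) = alternating_sum (2 * n) F"
    unfolding alternating_sum_def by (intro sum.cong refl) (simp add: fix1 skew_unit_def)
  also have "sum ?G ((\<lambda>s. s \<circ> ?t) ` ?P n) = (\<Sum>s\<in>?P n. ?G (s \<circ> ?t))"
    using inj by (simp add: sum.reindex)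
  also have "\<dots> = alternating_sum (2 * n) F"
    unfolding alternating_sum_def
  proof (intro sum.cong refl)
    fix s assume s: "s \<in> ?P n"
    have "sign (s \<circ> ?t) = - sign s"
      using s sub t by (subst sign_permutes_compose[of _ "2 * Suc n"]) (auto simp: sign_swap_id)
    moreover have "F (s \<circ> ?t) = F s" by (rule F) (simp add: Transposition.transpose_def)
    ultimately show "?G (s \<circ> ?t) = of_int (sign s) * F s"
      using fix1[OF s] by (simp add: skew_unit_def)
  qed
  finally show ?thesis unfolding alternating_sum_def by simp
qed


text \<open>The map \<open>m\<close> selects the \<open>k\<close> pairs of polynomials, of indices
  \<open>2 * m j\<close> and \<open>2 * m j + 1\<close>, that are left to the \<open>k\<close>
  remaining particles. The permutation distributes these \<open>2 * k\<close> polynomials over the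
  rows of the particles.\<close>

definition paired_sum :: "nat \<Rightarrow> (nat \<Rightarrow> nat \<Rightarrow> nat \<Rightarrow> complex) \<Rightarrow> (nat \<Rightarrow> nat) \<Rightarrow> complex" where
  "paired_sum k G m = alternating_sum (2 * k)
     (\<lambda>t. \<Prod>j<k. G j (pair_map m (t (2 * j))) (pair_map m (t (Suc (2 * j)))))"

text \<open>The values outside the domain are fixed by \<open>PiE\<close>: this makes the set finite
  and makes restriction the inverse of extension by one value.\<close>

definition inj_maps :: "nat \<Rightarrow> nat \<Rightarrow> (nat \<Rightarrow> nat) set" where
  "inj_maps k N = {m \<in> {..<k} \<rightarrow>\<^sub>E {..<N}. inj_on m {..<k}}"

lemma finite_inj_maps: "finite (inj_maps k N)"
  unfolding inj_maps_def
  by (rule finite_subset[OF _ finite_PiE[of "{..<k}" "\<lambda>_. {..<N}"]]) auto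

lemma permutes_double_less:
  assumes "t permutes {..<2 * k}" "j < k"
  shows "t (2 * j) < 2 * k" "t (Suc (2 * j)) < 2 * k"
  using permutes_in_image[OF assms(1)] assms(2) by auto

lemma paired_sum_cong:
  assumes "\<And>j. j < k \<Longrightarrow> m j = m' j"
  shows "paired_sum k G m = paired_sum k G m'"
  unfolding paired_sum_def
proof (intro alternating_sum_cong prod.cong refl)
  fix s j assume s: "s permutes {..<2 * k}" and j: "j \<in> {..<k}"
  have "pair_map m a = pair_map m' a" if "a < 2 * k" for a
    using that assms[of "a div 2"] by (simp add: pair_map_def)
  then show "G j (pair_map m (s (2 * j))) (pair_map m (s (Suc (2 * j)))) =
      G j (pair_map m' (s (2 * j))) (pair_map m' (s (Suc (2 * j))))"
    using permutes_double_less[OF s, of j] j by simp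
qed

lemma paired_sum_permute:
  assumes "p permutes {..<k}"
  shows "paired_sum k G (m \<circ> p) = paired_sum k G m"
  unfolding paired_sum_def pair_map_comp
  using pair_map_permutes_sign[OF assms] by (subst (2) alternating_sum_left[of "pair_map p"]) auto

lemma bij_betw_inj_maps_extend:
  "bij_betw (\<lambda>(m, l). m(k := l)) (SIGMA m:inj_maps k N. {..<N} - m ` {..<k}) (inj_maps (Suc k) N)"
proof (rule bij_betw_byWitness[where f' = "\<lambda>m. (restrict m {..<k}, m k)"])
  show "\<forall>a\<in>SIGMA m:inj_maps k N. {..<N} - m ` {..<k}.
      (restrict ((case a of (m, l) \<Rightarrow> m(k := l))) {..<k}, (case a of (m, l) \<Rightarrow> m(k := l)) k) = a"
    by (auto simp: inj_maps_def fun_eq_iff restrict_def PiE_def extensional_def)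
  show "\<forall>m\<in>inj_maps (Suc k) N. (case (restrict m {..<k}, m k) of (m, l) \<Rightarrow> m(k := l)) = m"
    by (auto simp: inj_maps_def fun_eq_iff restrict_def PiE_def extensional_def)
  show "(\<lambda>(m, l). m(k := l)) ` (SIGMA m:inj_maps k N. {..<N} - m ` {..<k}) \<subseteq> inj_maps (Suc k) N"
    by (auto simp: inj_maps_def PiE_def extensional_def Pi_def inj_on_def less_Suc_eq)
  show "(\<lambda>m. (restrict m {..<k}, m k)) ` inj_maps (Suc k) N \<subseteq> (SIGMA m:inj_maps k N. {..<N} - m ` {..<k})"
  proof (rule image_subsetI)
    fix m assume m: "m \<in> inj_maps (Suc k) N"
    then have inj: "inj_on m {..<Suc k}" and lt: "\<And>i. i < Suc k \<Longrightarrow> m i < N"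
      by (auto simp: inj_maps_def PiE_iff)
    have "restrict m {..<k} \<in> inj_maps k N"
      using lt inj_on_subset[OF inj, of "{..<k}"] by (auto simp: inj_maps_def PiE_iff inj_on_restrict_eq)
    moreover have "m k \<notin> m ` {..<k}"
      using inj by (auto dest!: inj_onD)
    ultimately show "(restrict m {..<k}, m k) \<in> (SIGMA m:inj_maps k N. {..<N} - m ` {..<k})"
      using lt by simp
  qed
qed

text \<open>Once \<open>k\<close> values are taken, \<open>N - k\<close> values remain for the next
  slot, so each shorter injection is the restriction of that many longer ones.\<close>

lemma sum_inj_maps_restrict:
  fixes F :: "(nat \<Rightarrow> nat) \<Rightarrow> complex"
  shows "(\<Sum>m\<in>inj_maps (Suc k) N. F (restrict m {..<k})) = of_nat (N - k) * (\<Sum>m\<in>inj_maps k N. F m)"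
proof -
  have "(\<Sum>m\<in>inj_maps (Suc k) N. F (restrict m {..<k})) =
      (\<Sum>(m, l)\<in>(SIGMA m:inj_maps k N. {..<N} - m ` {..<k}). F (restrict (m(k := l)) {..<k}))"
    by (subst sum.reindex_bij_betw[OF bij_betw_inj_maps_extend, symmetric]) (simp add: case_prod_unfold)
  also have "\<dots> = (\<Sum>m\<in>inj_maps k N. \<Sum>l\<in>{..<N} - m ` {..<k}. F (restrict (m(k := l)) {..<k}))"
    by (subst sum.Sigma) (auto simp: finite_inj_maps)
  also have "\<dots> = (\<Sum>m\<in>inj_maps k N. of_nat (N - k) * F m)"
  proof (intro sum.cong refl)
    fix m assume m: "m \<in> inj_maps k N"
    have "restrict (m(k := l)) {..<k} = m" for l
      using m by (auto simp: inj_maps_def fun_eq_iff restrict_def PiE_def extensional_def)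
    moreover have "card ({..<N} - m ` {..<k}) = N - k"
      using m by (subst card_Diff_subset) (auto simp: inj_maps_def card_image)
    ultimately show "(\<Sum>l\<in>{..<N} - m ` {..<k}. F (restrict (m(k := l)) {..<k})) = of_nat (N - k) * F m"
      by simp
  qed
  finally show ?thesis by (simp add: sum_distrib_left)
qed

lemma card_inj_maps: "k \<le> N \<Longrightarrow> card (inj_maps k N) * fact (N - k) = (fact N :: nat)"
proof (induction k)
  case 0
  have "inj_maps 0 N = {\<lambda>_. undefined}" by (auto simp: inj_maps_def)
  then show ?case by simp
next
  case (Suc k)
  have "of_nat (card (inj_maps (Suc k) N)) = (of_nat ((N - k) * card (inj_maps k N)) :: complex)"
    using sum_inj_maps_restrict[of "\<lambda>_. 1" k N] by simp
  then have "card (inj_maps (Suc k) N) = (N - k) * card (inj_maps k N)"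
    using of_nat_eq_iff by blast
  moreover have "fact (N - k) = (N - k) * fact (N - Suc k)"
    using Suc.prems by (metis Suc_diff_Suc Suc_le_lessD fact_Suc of_nat_id)
  ultimately show ?case using Suc by (simp add: mult_ac)
qed

lemma inj_maps_transpose:
  assumes "i < k" "l < k"
  shows "bij_betw (\<lambda>m. m \<circ> Transposition.transpose i l) (inj_maps k N) (inj_maps k N)"
proof -
  let ?t = "Transposition.transpose i l"
  have t: "?t permutes {..<k}" using assms by (intro permutes_swap_id) auto
  have "m \<circ> ?t \<in> inj_maps k N" if "m \<in> inj_maps k N" for m
  proof -
    have "inj_on (m \<circ> ?t) {..<k}"
      using that permutes_inj_on[OF t] permutes_image[OF t] by (intro comp_inj_on) (auto simp: inj_maps_def)
    moreover have "?t x < k \<longleftrightarrow> x < k" for x using permutes_in_image[OF t, of x] by simp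
    ultimately show ?thesis
      using that by (auto simp: inj_maps_def PiE_iff extensional_def)
  qed
  then show ?thesis
    by (intro bij_betw_byWitness[where f' = "\<lambda>m. m \<circ> ?t"]) (auto simp: comp_assoc)
qed

text \<open>The skew block of the last particle forces its two rows to be one of the
  \<open>Suc k\<close> pairs, in one of two orders that contribute equally. Moving this pair to the
  last slot shows that all \<open>Suc k\<close> choices give the same total, and its skew norm
  cancels one factor \<open>1 / \<rho>\<close>. What is left does not see the last value of
  \<open>m\<close>, which can be restored in \<open>N - k\<close> ways. The constant is the product
  of these three counts.\<close>

lemma sum_paired_sum_skew_block:
  fixes \<rho> :: "nat \<Rightarrow> complex"
  assumes \<rho>: "\<And>i. i < N \<Longrightarrow> \<rho> i \<noteq> 0" and G: "G k = skew_block \<rho>"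
  shows "(\<Sum>m\<in>inj_maps (Suc k) N. (\<Prod>j<Suc k. 1 / \<rho> (m j)) * paired_sum (Suc k) G m) =
    2 * of_nat (Suc k) * of_nat (N - k) * (\<Sum>m\<in>inj_maps k N. (\<Prod>j<k. 1 / \<rho> (m j)) * paired_sum k G m)"
proof -
  define F where "F m t = (\<Prod>j<k. G j (pair_map m (t (2 * j))) (pair_map m (t (Suc (2 * j)))))" for m t
  define D where "D m i = alternating_sum (2 * Suc k) (\<lambda>t. F m t * skew_unit i (t (2 * k)) (t (Suc (2 * k))))" for m i
  define H where "H m = 2 * ((\<Prod>j<k. 1 / \<rho> (m j)) * paired_sum k G m)" for m
  let ?t = "\<lambda>i. Transposition.transpose i k"
  have t: "?t i permutes {..<Suc k}" if "i < Suc k" for i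
    using that by (intro permutes_swap_id) auto
  have expand: "paired_sum (Suc k) G m = (\<Sum>i<Suc k. \<rho> (m i) * D m i)" if m: "m \<in> inj_maps (Suc k) N" for m
  proof -
    have "paired_sum (Suc k) G m =
      alternating_sum (2 * Suc k) (\<lambda>t. \<Sum>i<Suc k. \<rho> (m i) * (F m t * skew_unit i (t (2 * k)) (t (Suc (2 * k)))))"
      unfolding paired_sum_def
    proof (rule alternating_sum_cong)
      fix s assume s: "s permutes {..<2 * Suc k}"
      have lt: "s (2 * k) < 2 * Suc k" "s (Suc (2 * k)) < 2 * Suc k"
        using permutes_double_less[OF s, of k] by auto
      have inj: "inj_on m {..<Suc k}" using m by (simp add: inj_maps_def)
      have "G k (pair_map m (s (2 * k))) (pair_map m (s (Suc (2 * k)))) =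
        skew_block (\<rho> \<circ> m) (s (2 * k)) (s (Suc (2 * k)))"
        unfolding G by (rule skew_block_pair_map[OF inj lt])
      also have "\<dots> = (\<Sum>i<Suc k. (\<rho> \<circ> m) i * skew_unit i (s (2 * k)) (s (Suc (2 * k))))"
        by (rule skew_block_eq_sum[OF lt(1)])
      finally have "F m s * G k (pair_map m (s (2 * k))) (pair_map m (s (Suc (2 * k)))) =
        (\<Sum>i<Suc k. \<rho> (m i) * (F m s * skew_unit i (s (2 * k)) (s (Suc (2 * k)))))"
        by (simp only: sum_distrib_left comp_apply mult.left_commute)
      then show "(\<Prod>j<Suc k. G j (pair_map m (s (2 * j))) (pair_map m (s (Suc (2 * j))))) =
        (\<Sum>i<Suc k. \<rho> (m i) * (F m s * skew_unit i (s (2 * k)) (s (Suc (2 * k)))))"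
        unfolding prod.lessThan_Suc F_def by simp
    qed
    also have "\<dots> = (\<Sum>i<Suc k. \<rho> (m i) * D m i)"
      unfolding alternating_sum_sum alternating_sum_cmult D_def ..
    finally show ?thesis .
  qed
  \<comment> \<open>Left composition with the lifted transposition moves pair \<open>i\<close> into
    the last slot; the lift is even, so no sign appears.\<close>
  have D_swap: "D m i = D (m \<circ> ?t i) k" if "i < Suc k" for m i
  proof -
    have "D m i = alternating_sum (2 * Suc k) (\<lambda>s. F m (pair_map (?t i) \<circ> s) *
        skew_unit i ((pair_map (?t i) \<circ> s) (2 * k)) ((pair_map (?t i) \<circ> s) (Suc (2 * k))))"
      unfolding D_def using pair_map_permutes_sign[OF t[OF that]]
      by (subst alternating_sum_left[of "pair_map (?t i)"]) auto
    also have "\<dots> = D (m \<circ> ?t i) k"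
      unfolding D_def
    proof (rule alternating_sum_cong)
      fix s
      have "F m (pair_map (?t i) \<circ> s) = F (m \<circ> ?t i) s"
        unfolding F_def pair_map_comp by simp
      moreover have "skew_unit (?t i k) (pair_map (?t i) (s (2 * k))) (pair_map (?t i) (s (Suc (2 * k)))) =
        skew_unit k (s (2 * k)) (s (Suc (2 * k)))"
        by (rule skew_unit_pair_map) simp
      ultimately show "F m (pair_map (?t i) \<circ> s) *
          skew_unit i ((pair_map (?t i) \<circ> s) (2 * k)) ((pair_map (?t i) \<circ> s) (Suc (2 * k))) =
          F (m \<circ> ?t i) s * skew_unit k (s (2 * k)) (s (Suc (2 * k)))"
        by simp
    qed
    finally show ?thesis .
  qed
  have D_last: "D m k = 2 * paired_sum k G m" for m
    unfolding D_def paired_sum_def F_def[symmetric]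
    by (rule alternating_sum_skew_unit_last) (auto simp: F_def intro!: prod.cong)
  have "(\<Sum>m\<in>inj_maps (Suc k) N. (\<Prod>j<Suc k. 1 / \<rho> (m j)) * paired_sum (Suc k) G m) =
    (\<Sum>m\<in>inj_maps (Suc k) N. \<Sum>i<Suc k. H (m \<circ> ?t i))"
  proof (intro sum.cong refl)
    fix m assume m: "m \<in> inj_maps (Suc k) N"
    have "(\<Prod>j<Suc k. 1 / \<rho> (m j)) * (\<rho> (m i) * D m i) = H (m \<circ> ?t i)" if i: "i < Suc k" for i
    proof -
      have "(\<Prod>j<Suc k. 1 / \<rho> (m j)) = (\<Prod>j<Suc k. 1 / \<rho> ((m \<circ> ?t i) j))"
        using prod.permute[OF t[OF i], of "\<lambda>j. 1 / \<rho> (m j)"] by (simp add: comp_def)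
      also have "\<dots> = (\<Prod>j<k. 1 / \<rho> ((m \<circ> ?t i) j)) / \<rho> (m i)"
        by simp
      finally have "(\<Prod>j<Suc k. 1 / \<rho> (m j)) * \<rho> (m i) = (\<Prod>j<k. 1 / \<rho> ((m \<circ> ?t i) j))"
        using \<rho>[of "m i"] m i by (simp add: inj_maps_def PiE_iff)
      then show ?thesis
        unfolding D_swap[OF i] D_last H_def by (simp only: mult_ac) (metis mult.assoc mult.commute)
    qed
    then show "(\<Prod>j<Suc k. 1 / \<rho> (m j)) * paired_sum (Suc k) G m = (\<Sum>i<Suc k. H (m \<circ> ?t i))"
      unfolding expand[OF m] sum_distrib_left by (intro sum.cong refl) simp
  qed
  also have "\<dots> = (\<Sum>i<Suc k. \<Sum>m\<in>inj_maps (Suc k) N. H (m \<circ> ?t i))"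
    by (rule sum.swap)
  also have "\<dots> = (\<Sum>i<Suc k. \<Sum>m\<in>inj_maps (Suc k) N. H m)"
    by (intro sum.cong refl sum.reindex_bij_betw inj_maps_transpose) auto
  \<comment> \<open>\<open>H\<close> involves only the first \<open>k\<close> values of
    \<open>m\<close>, so the value at the last slot becomes a free choice.\<close>
  also have "(\<Sum>m\<in>inj_maps (Suc k) N. H m) = (\<Sum>m\<in>inj_maps (Suc k) N. H (restrict m {..<k}))"
    unfolding H_def
    by (intro sum.cong refl arg_cong2[of _ _ _ _ "(*)"] prod.cong paired_sum_cong) auto
  also have "\<dots> = of_nat (N - k) * (\<Sum>m\<in>inj_maps k N. H m)"
    by (rule sum_inj_maps_restrict)
  finally show ?thesis
    unfolding H_def sum_distrib_left[symmetric] by (simp add: mult_ac del: of_nat_Suc)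
qed

text \<open>The removal of one particle is iterated between \<open>k\<close> and \<open>N\<close>.
  At \<open>N\<close> the injections are the permutations of all indices, and each of the
  \<open>N!\<close> summands is the same full alternating sum, because relabelling particles costs
  no sign.\<close>

lemma alternating_sum_skew_block:
  fixes \<rho> :: "nat \<Rightarrow> complex"
  assumes \<rho>: "\<And>i. i < N \<Longrightarrow> \<rho> i \<noteq> 0" and G: "\<And>j. k \<le> j \<Longrightarrow> G j = skew_block \<rho>" and "k \<le> N"
  shows "fact k * alternating_sum (2 * N) (\<lambda>s. \<Prod>j<N. G j (s (2 * j)) (s (Suc (2 * j)))) =
    (\<Prod>j<N. \<rho> j) * 2 ^ (N - k) * fact (N - k) *
    (\<Sum>m\<in>inj_maps k N. (\<Prod>j<k. 1 / \<rho> (m j)) * paired_sum k G m)"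
proof -
  define X where "X n = (\<Sum>m\<in>inj_maps n N. (\<Prod>j<n. 1 / \<rho> (m j)) * paired_sum n G m)" for n
  let ?A = "alternating_sum (2 * N) (\<lambda>s. \<Prod>j<N. G j (s (2 * j)) (s (Suc (2 * j))))"
  have X: "X n * fact (N - n) * fact k = 2 ^ (n - k) * fact n * fact (N - k) * X k" if "k \<le> n" "n \<le> N" for n
    using that
  proof (induction n rule: dec_induct)
    case (step n)
    have "fact (N - n) = (of_nat (N - n) * fact (N - Suc n) :: complex)"
      using step by (metis Suc_diff_Suc Suc_le_lessD fact_Suc)
    moreover have "X (Suc n) = 2 * of_nat (Suc n) * of_nat (N - n) * X n"
      unfolding X_def using step G by (intro sum_paired_sum_skew_block \<rho>) auto
    ultimately have "X (Suc n) * fact (N - Suc n) * fact k = 2 * of_nat (Suc n) * (X n * fact (N - n) * fact k)"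
      by (simp add: mult_ac del: of_nat_Suc)
    also have "X n * fact (N - n) * fact k = 2 ^ (n - k) * fact n * fact (N - k) * X k"
      using step by simp
    finally show ?case using step by (simp add: Suc_diff_le mult_ac)
  qed simp
  have "X N = (\<Sum>m\<in>inj_maps N N. (\<Prod>j<N. 1 / \<rho> j) * ?A)"
    unfolding X_def
  proof (intro sum.cong refl)
    fix m assume m: "m \<in> inj_maps N N"
    define p where "p = (\<lambda>i. if i < N then m i else i)"
    have "m ` {..<N} = {..<N}"
      using m by (intro card_subset_eq) (auto simp: inj_maps_def card_image)
    then have "bij_betw m {..<N} {..<N}"
      using m by (simp add: bij_betw_def inj_maps_def)
    then have "bij_betw p {..<N} {..<N}"
      by (subst bij_betw_cong[of _ _ m]) (simp_all add: p_def)
    then have p: "p permutes {..<N}"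
      by (rule bij_imp_permutes) (simp add: p_def)
    have "paired_sum N G m = paired_sum N G (id \<circ> p)"
      by (rule paired_sum_cong) (simp add: p_def)
    also have "\<dots> = ?A"
      unfolding paired_sum_permute[OF p] unfolding paired_sum_def by (simp add: pair_map_id)
    finally have "paired_sum N G m = ?A" .
    moreover have "(\<Prod>j<N. 1 / \<rho> (m j)) = (\<Prod>j<N. 1 / \<rho> (p j))"
      by (rule prod.cong) (auto simp: p_def)
    moreover have "\<dots> = (\<Prod>j<N. 1 / \<rho> j)"
      using prod.permute[OF p, of "\<lambda>j. 1 / \<rho> j"] by (simp add: comp_def)
    ultimately show "(\<Prod>j<N. 1 / \<rho> (m j)) * paired_sum N G m = (\<Prod>j<N. 1 / \<rho> j) * ?A" by simp
  qed
  also have "\<dots> = fact N * (\<Prod>j<N. 1 / \<rho> j) * ?A"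
  proof -
    have "card (inj_maps N N) = fact N" using card_inj_maps[of N N] by simp
    then show ?thesis by simp
  qed
  finally have XN: "X N = fact N * (\<Prod>j<N. 1 / \<rho> j) * ?A" .
  define P where "P = (\<Prod>j<N. 1 / \<rho> j)"
  define A where "A = ?A"
  have "fact N * (P * (fact k * A)) = X N * fact (N - N) * fact k"
    unfolding XN P_def[symmetric] A_def[symmetric] by simp
  also have "\<dots> = fact N * (2 ^ (N - k) * fact (N - k) * X k)"
    using X[of N] \<open>k \<le> N\<close> by simp
  finally have "P * (fact k * A) = 2 ^ (N - k) * fact (N - k) * X k"
    by (simp only: mult_cancel_left fact_nonzero simp_thms)
  moreover have "(\<Prod>j<N. \<rho> j) * P = 1"
    unfolding P_def using \<rho> by (simp add: prod.distrib[symmetric])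
  ultimately show ?thesis
    unfolding X_def[symmetric] A_def[symmetric] by (metis mult.assoc mult_1)
qed


section \<open>Expansion of the Pfaffian of the prekernel\<close>

lemma prod_lessThan_double:
  fixes g :: "nat \<Rightarrow> 'a :: comm_monoid_mult"
  shows "(\<Prod>a<2 * k. g a) = (\<Prod>j<k. g (2 * j) * g (Suc (2 * j)))"
  by (induction k) (simp_all add: mult_ac)

text \<open>Exchanging the two rows of one pair is a transposition, so the subtracted term
  contributes as much as the first one. The auxiliary \<open>h r\<close> antisymmetrises only the
  factors with index below \<open>r\<close>; the induction on \<open>r\<close> doubles the sum once
  per factor.\<close>

lemma alternating_sum_antisymmetrize:
  fixes f :: "nat \<Rightarrow> nat \<Rightarrow> nat \<Rightarrow> complex"
  shows "alternating_sum (2 * k) (\<lambda>s. \<Prod>j<k. f j (s (2 * j)) (s (Suc (2 * j))) - f j (s (Suc (2 * j))) (s (2 * j))) =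
    2 ^ k * alternating_sum (2 * k) (\<lambda>s. \<Prod>j<k. f j (s (2 * j)) (s (Suc (2 * j))))"
proof -
  define h where "h r j s = (if j < r then f j (s (2 * j)) (s (Suc (2 * j))) - f j (s (Suc (2 * j))) (s (2 * j))
     else f j (s (2 * j)) (s (Suc (2 * j))))" for r j :: nat and s :: "nat \<Rightarrow> nat"
  have "alternating_sum (2 * k) (\<lambda>s. \<Prod>j<k. h r j s) =
     2 ^ r * alternating_sum (2 * k) (\<lambda>s. \<Prod>j<k. f j (s (2 * j)) (s (Suc (2 * j))))" if "r \<le> k" for r
    using that
  proof (induction r)
    case 0
    then show ?case by (simp add: h_def)
  next
    case (Suc r)
    let ?t = "Transposition.transpose (2 * r) (Suc (2 * r))"
    let ?R = "\<lambda>s. \<Prod>j\<in>{..<k} - {r}. h r j s"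
    have t: "?t permutes {..<2 * k}" using Suc.prems by (intro permutes_swap_id) auto
    have split: "(\<Prod>j<k. g j) = g r * (\<Prod>j\<in>{..<k} - {r}. g j)" for g :: "nat \<Rightarrow> complex"
      using Suc.prems by (subst prod.remove[of _ r]) auto
    have R: "(\<Prod>j\<in>{..<k} - {r}. h (Suc r) j s) = ?R s" for s
      by (intro prod.cong) (auto simp: h_def)
    have Rt: "?R (s \<circ> ?t) = ?R s" for s
    proof (intro prod.cong refl)
      fix j assume "j \<in> {..<k} - {r}"
      then have "?t (2 * j) = 2 * j" "?t (Suc (2 * j)) = Suc (2 * j)"
        by (simp_all add: Transposition.transpose_def double_not_eq_Suc_double Suc_double_not_eq_double)
      then show "h r j (s \<circ> ?t) = h r j s" by (simp add: h_def)
    qed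
    have "alternating_sum (2 * k) (\<lambda>s. \<Prod>j<k. h (Suc r) j s) =
       alternating_sum (2 * k) (\<lambda>s. f r (s (2 * r)) (s (Suc (2 * r))) * ?R s) -
       alternating_sum (2 * k) (\<lambda>s. f r (s (Suc (2 * r))) (s (2 * r)) * ?R s)"
      unfolding alternating_sum_def split R sum_subtractf[symmetric]
      by (intro sum.cong refl) (simp add: h_def algebra_simps)
    also have "alternating_sum (2 * k) (\<lambda>s. f r (s (Suc (2 * r))) (s (2 * r)) * ?R s) =
       - alternating_sum (2 * k) (\<lambda>s. f r (s (2 * r)) (s (Suc (2 * r))) * ?R s)"
      by (subst alternating_sum_right[OF t]) (simp add: Rt[unfolded comp_def] sign_swap_id comp_def)
    also have "alternating_sum (2 * k) (\<lambda>s. f r (s (2 * r)) (s (Suc (2 * r))) * ?R s) =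
       alternating_sum (2 * k) (\<lambda>s. \<Prod>j<k. h r j s)"
      unfolding split by (simp add: h_def)
    finally show ?case using Suc by simp
  qed
  from this[of k] show ?thesis by (simp add: h_def)
qed

text \<open>Rows \<open>2 * i\<close> and \<open>2 * j\<close> become indistinguishable under
  \<open>pair_map m\<close>, so exchanging them changes nothing but the sign.\<close>

lemma paired_sum_not_inj:
  assumes "i < k" "j < k" "i \<noteq> j" "m i = m j"
  shows "alternating_sum (2 * k) (\<lambda>s. F (\<lambda>a. pair_map m (s a))) = 0"
proof -
  let ?t = "Transposition.transpose (2 * i) (2 * j)"
  have t: "?t permutes {..<2 * k}" using assms by (intro permutes_swap_id) auto
  have "pair_map m (?t a) = pair_map m a" for a
    using assms by (simp add: Transposition.transpose_def)
  then have "alternating_sum (2 * k) (\<lambda>s. F (\<lambda>a. pair_map m (s a))) =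
      - alternating_sum (2 * k) (\<lambda>s. F (\<lambda>a. pair_map m (s a)))"
    using alternating_sum_left[OF t, of "\<lambda>s. F (\<lambda>a. pair_map m (s a))"] assms(3)
    by (simp add: sign_swap_id)
  then show ?thesis by simp
qed

definition pair_kernel :: "nat \<Rightarrow> (nat \<Rightarrow> complex) \<Rightarrow> (nat \<Rightarrow> complex \<Rightarrow> complex) \<Rightarrow> complex \<Rightarrow> complex \<Rightarrow> complex" where
  "pair_kernel N \<rho> q z w =
     (\<Sum>i<N. (q (Suc (2 * i)) z * q (2 * i) w - q (2 * i) z * q (Suc (2 * i)) w) / (2 * \<rho> i))"

text \<open>Multiplying out the \<open>k\<close> sums assigns an index to every factor of a
  matching, that is, a map \<open>m\<close>; maps that are not injective drop out. The
  \<open>2 ^ k\<close> gained by undoing the antisymmetrisation cancels the \<open>2\<close> in the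
  denominators. The sign \<open>(-1) ^ k\<close> remains because the kernel gives its positive sign
  to the odd polynomial in the first row, while the paired sum starts with the even one.\<close>

lemma pfaffian_pair_kernel:
  "pfaffian k (\<lambda>a b. pair_kernel N \<rho> q (x a) (x b)) = (-1) ^ k / (2 ^ k * fact k) *
    (\<Sum>m\<in>inj_maps k N. (\<Prod>j<k. 1 / \<rho> (m j)) *
       paired_sum k (\<lambda>j a b. q a (x (2 * j)) * q b (x (Suc (2 * j)))) m)"
proof -
  define f where "f i a b = - (q (2 * i) (x a) * q (Suc (2 * i)) (x b)) / (2 * \<rho> i)" for i a b
  let ?M = "{..<k} \<rightarrow>\<^sub>E {..<N}"
  define T where "T m = alternating_sum (2 * k) (\<lambda>s. \<Prod>a<2 * k. q (pair_map m (s a)) (x a))" for m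
  have "pfaffian k (\<lambda>a b. pair_kernel N \<rho> q (x a) (x b)) =
    1 / (2 ^ k * fact k) * alternating_sum (2 * k) (\<lambda>s. \<Prod>j<k. \<Sum>i<N. f i (s (2 * j)) (s (Suc (2 * j))) - f i (s (Suc (2 * j))) (s (2 * j)))"
    unfolding pfaffian_def alternating_sum_def pair_kernel_def f_def
    by (simp add: field_simps minus_divide_left[symmetric] diff_divide_distrib)
  also have "(\<lambda>s. \<Prod>j<k. \<Sum>i<N. f i (s (2 * j)) (s (Suc (2 * j))) - f i (s (Suc (2 * j))) (s (2 * j))) =
    (\<lambda>s. \<Sum>m\<in>?M. \<Prod>j<k. f (m j) (s (2 * j)) (s (Suc (2 * j))) - f (m j) (s (Suc (2 * j))) (s (2 * j)))"
    by (rule ext) (rule prod_sum_PiE, auto)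
  also have "alternating_sum (2 * k) \<dots> = (\<Sum>m\<in>?M. 2 ^ k *
      alternating_sum (2 * k) (\<lambda>s. \<Prod>j<k. f (m j) (s (2 * j)) (s (Suc (2 * j)))))"
    unfolding alternating_sum_sum by (rule sum.cong[OF refl]) (rule alternating_sum_antisymmetrize)
  also have "\<dots> = (\<Sum>m\<in>?M. (-1) ^ k * ((\<Prod>j<k. 1 / \<rho> (m j)) * T m))"
  proof (intro sum.cong refl)
    fix m
    have "(\<Prod>j<k. f (m j) (s (2 * j)) (s (Suc (2 * j)))) =
      (\<Prod>j<k. - (1 / 2)) * (\<Prod>j<k. 1 / \<rho> (m j)) * (\<Prod>a<2 * k. q (pair_map m a) (x (s a)))" for s
      unfolding prod_lessThan_double prod.distrib[symmetric]
      by (intro prod.cong refl) (simp add: f_def)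
    then have "alternating_sum (2 * k) (\<lambda>s. \<Prod>j<k. f (m j) (s (2 * j)) (s (Suc (2 * j)))) =
      (\<Prod>j<k. - (1 / 2)) * (\<Prod>j<k. 1 / \<rho> (m j)) *
        alternating_sum (2 * k) (\<lambda>s. \<Prod>a<2 * k. q (pair_map m a) (x (s a)))"
      by (simp only: alternating_sum_cmult)
    \<comment> \<open>On the left the permutation moves the points, in \<open>T\<close> it moves the
      polynomials. Passing to the inverse, which has the same sign, exchanges the two
      pictures.\<close>
    also have "alternating_sum (2 * k) (\<lambda>s. \<Prod>a<2 * k. q (pair_map m a) (x (s a))) = T m"
      unfolding T_def
    proof (subst alternating_sum_inv, rule alternating_sum_cong)
      fix s assume s: "s permutes {..<2 * k}"
      have "(\<Prod>a<2 * k. q (pair_map m a) (x (inv s a))) = (\<Prod>a<2 * k. q (pair_map m (s a)) (x (inv s (s a))))"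
        using prod.permute[OF s, of "\<lambda>a. q (pair_map m a) (x (inv s a))"] by (simp add: comp_def)
      then show "(\<Prod>a<2 * k. q (pair_map m a) (x (inv s a))) = (\<Prod>a<2 * k. q (pair_map m (s a)) (x a))"
        using permutes_inverses[OF s] by simp
    qed
    moreover have "2 ^ k * (\<Prod>j<k. - (1 / 2)) = (-1 :: complex) ^ k"
      by (simp add: power_mult_distrib[symmetric])
    ultimately show "2 ^ k * alternating_sum (2 * k) (\<lambda>s. \<Prod>j<k. f (m j) (s (2 * j)) (s (Suc (2 * j)))) =
       (-1) ^ k * ((\<Prod>j<k. 1 / \<rho> (m j)) * T m)"
      by (simp only: mult.assoc[symmetric])
  qed
  also have "\<dots> = (\<Sum>m\<in>inj_maps k N. (-1) ^ k * ((\<Prod>j<k. 1 / \<rho> (m j)) * T m))"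
  proof (rule sum.mono_neutral_right)
    show "\<forall>m\<in>?M - inj_maps k N. (-1) ^ k * ((\<Prod>j<k. 1 / \<rho> (m j)) * T m) = 0"
    proof
      fix m assume "m \<in> ?M - inj_maps k N"
      then obtain i j where "i < k" "j < k" "i \<noteq> j" "m i = m j"
        by (auto simp: inj_maps_def inj_on_def)
      then have "T m = 0"
        unfolding T_def by (rule paired_sum_not_inj[where F = "\<lambda>g. \<Prod>a<2 * k. q (g a) (x a)"])
      then show "(-1) ^ k * ((\<Prod>j<k. 1 / \<rho> (m j)) * T m) = 0" by simp
    qed
  qed (auto simp: inj_maps_def intro!: finite_PiE)
  also have "T = paired_sum k (\<lambda>j a b. q a (x (2 * j)) * q b (x (Suc (2 * j))))"
    by (rule ext) (simp only: T_def paired_sum_def prod_lessThan_double)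
  finally show ?thesis by (simp add: sum_distrib_left)
qed

section \<open>De Bruijn integration of the ensemble density\<close>

lemma sigma_finite_area_measure: "sigma_finite_measure area_measure"
  unfolding area_measure_def by (subst sigma_finite_measure.sigma_finite_iff_density_finite[OF sigma_finite_lborel]) auto

text \<open>The points are listed as each particle followed by its conjugate. For two different
  particles the four differences combine into two squared moduli; a single particle contributes only
  the difference of its conjugate and itself.\<close>

lemma vandermonde_conj_pair:
  "(\<Prod>b<2 * N. \<Prod>a<b. conj_pair \<zeta> b - conj_pair \<zeta> a) =
   (\<Prod>j<N. (cnj (\<zeta> j) - \<zeta> j) *
     of_real (\<Prod>k<j. (cmod (\<zeta> j - \<zeta> k))\<^sup>2 * (cmod (\<zeta> j - cnj (\<zeta> k)))\<^sup>2))"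
proof (subst prod_lessThan_double, intro prod.cong refl)
  fix j
  have "(\<Prod>a<2 * j. conj_pair \<zeta> (2 * j) - conj_pair \<zeta> a) * (\<Prod>a<2 * j. conj_pair \<zeta> (Suc (2 * j)) - conj_pair \<zeta> a) =
     (\<Prod>k<j. (\<zeta> j - \<zeta> k) * (\<zeta> j - cnj (\<zeta> k)) * ((cnj (\<zeta> j) - \<zeta> k) * (cnj (\<zeta> j) - cnj (\<zeta> k))))"
    unfolding prod_lessThan_double prod.distrib[symmetric] by (simp add: conj_pair_def)
  also have "\<dots> = (\<Prod>k<j. of_real ((cmod (\<zeta> j - \<zeta> k))\<^sup>2 * (cmod (\<zeta> j - cnj (\<zeta> k)))\<^sup>2))"
  proof (intro prod.cong refl)
    fix k
    show "(\<zeta> j - \<zeta> k) * (\<zeta> j - cnj (\<zeta> k)) * ((cnj (\<zeta> j) - \<zeta> k) * (cnj (\<zeta> j) - cnj (\<zeta> k))) =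
      complex_of_real ((cmod (\<zeta> j - \<zeta> k))\<^sup>2 * (cmod (\<zeta> j - cnj (\<zeta> k)))\<^sup>2)"
      unfolding of_real_mult complex_norm_square by (simp add: mult_ac)
  qed
  finally show "(\<Prod>a<2 * j. conj_pair \<zeta> (2 * j) - conj_pair \<zeta> a) *
      (\<Prod>a<Suc (2 * j). conj_pair \<zeta> (Suc (2 * j)) - conj_pair \<zeta> a) =
      (cnj (\<zeta> j) - \<zeta> j) *
       complex_of_real (\<Prod>k<j. (cmod (\<zeta> j - \<zeta> k))\<^sup>2 * (cmod (\<zeta> j - cnj (\<zeta> k)))\<^sup>2)"
    by (simp add: mult_ac) (simp add: conj_pair_def)
qed

text \<open>The squared modulus of \<open>z - cnj z\<close> in the density is
  \<open>(cnj z - z) * (z - cnj z)\<close>. The first factor belongs to the Vandermonde product; the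
  second is kept here.\<close>

definition pair_weight :: "(complex \<Rightarrow> real) \<Rightarrow> nat \<Rightarrow> complex \<Rightarrow> complex" where
  "pair_weight Q N z = (z - cnj z) * of_real (exp (- real N * Q z))"

lemma symplectic_weight_eq_alternating_sum:
  fixes q :: "nat \<Rightarrow> complex poly"
  assumes deg: "\<And>i. degree (q i) = i" and monic: "\<And>i. lead_coeff (q i) = 1"
  shows "complex_of_real (symplectic_weight Q N \<zeta>) = alternating_sum (2 * N)
    (\<lambda>s. \<Prod>j<N. poly (q (s (2 * j))) (\<zeta> j) * poly (q (s (Suc (2 * j)))) (cnj (\<zeta> j)) * pair_weight Q N (\<zeta> j))"
proof -
  have "complex_of_real (symplectic_weight Q N \<zeta>) =
     (\<Prod>b<2 * N. \<Prod>a<b. conj_pair \<zeta> b - conj_pair \<zeta> a) * (\<Prod>j<N. pair_weight Q N (\<zeta> j))"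
  proof -
    have "(complex_of_real (cmod (\<zeta> j - cnj (\<zeta> j))))\<^sup>2 = (cnj (\<zeta> j) - \<zeta> j) * (\<zeta> j - cnj (\<zeta> j))" for j
      by (subst complex_norm_square[unfolded of_real_power]) simp
    then show ?thesis
      unfolding vandermonde_conj_pair symplectic_weight_def pair_weight_def of_real_mult of_real_prod
        of_real_power prod.distrib[symmetric] by (intro prod.cong refl) (simp add: mult_ac)
  qed
  also have "(\<Prod>b<2 * N. \<Prod>a<b. conj_pair \<zeta> b - conj_pair \<zeta> a) =
     alternating_sum (2 * N) (\<lambda>s. \<Prod>a<2 * N. poly (q (s a)) (conj_pair \<zeta> a))"
    by (rule alternating_sum_vandermonde[OF assms, symmetric])
  also have "\<dots> * (\<Prod>j<N. pair_weight Q N (\<zeta> j)) = alternating_sum (2 * N)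
    (\<lambda>s. (\<Prod>j<N. pair_weight Q N (\<zeta> j)) * (\<Prod>a<2 * N. poly (q (s a)) (conj_pair \<zeta> a)))"
    unfolding alternating_sum_cmult by (rule mult.commute)
  also have "\<dots> = alternating_sum (2 * N)
    (\<lambda>s. \<Prod>j<N. poly (q (s (2 * j))) (\<zeta> j) * poly (q (s (Suc (2 * j)))) (cnj (\<zeta> j)) * pair_weight Q N (\<zeta> j))"
    unfolding prod_lessThan_double prod.distrib[symmetric] by (simp add: conj_pair_def mult_ac)
  finally show ?thesis .
qed

text \<open>De Bruijn's formula. After the Leibniz expansion every summand is a product of functions
  of single particles, so integrating a particle replaces its factor by an entry of the Gram matrix
  \<open>skew_block \<rho>\<close>. The points with index below \<open>k\<close> keep their values,
  and the block combinatorics collects the rest.\<close>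

lemma integral_symplectic_weight:
  fixes q :: "nat \<Rightarrow> complex poly"
  assumes deg: "\<And>i. degree (q i) = i" and monic: "\<And>i. lead_coeff (q i) = 1"
    and int: "\<And>a b. a < 2 * N \<Longrightarrow> b < 2 * N \<Longrightarrow>
      has_bochner_integral area_measure (\<lambda>z. poly (q a) z * poly (q b) (cnj z) * pair_weight Q N z) (skew_block \<rho> a b)"
    and \<rho>: "\<And>i. i < N \<Longrightarrow> \<rho> i \<noteq> 0" and "k \<le> N"
  shows "complex_of_real (\<integral>\<eta>. symplectic_weight Q N (merge {..<k} {k..<N} (\<zeta>, \<eta>)) \<partial>(Pi\<^sub>M {k..<N} (\<lambda>_. area_measure))) =
    (\<Prod>j<N. \<rho> j) * 2 ^ (N - k) * fact (N - k) / fact k * (\<Prod>j<k. pair_weight Q N (\<zeta> j)) *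
    (\<Sum>m\<in>inj_maps k N. (\<Prod>j<k. 1 / \<rho> (m j)) *
       paired_sum k (\<lambda>j a b. poly (q a) (\<zeta> j) * poly (q b) (cnj (\<zeta> j))) m)"
proof -
  interpret product_sigma_finite "\<lambda>_::nat. area_measure"
    by (intro product_sigma_finite.intro sigma_finite_area_measure)
  define W where "W a b z = poly (q a) z * poly (q b) (cnj z) * pair_weight Q N z" for a b z
  define G where "G j a b = (if j < k then W a b (\<zeta> j) else skew_block \<rho> a b)" for j a b
  let ?M = "Pi\<^sub>M {k..<N} (\<lambda>_. area_measure)"
  have split: "(\<Prod>j<N. g j) = (\<Prod>j<k. g j) * (\<Prod>j\<in>{k..<N}. g j)" for g :: "nat \<Rightarrow> complex"
    using \<open>k \<le> N\<close> by (metis ivl_disj_int_one(2) ivl_disj_un_one(2) finite_atLeastLessThan finite_lessThan prod.union_disjoint)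
  have pt: "complex_of_real (symplectic_weight Q N (merge {..<k} {k..<N} (\<zeta>, \<eta>))) = alternating_sum (2 * N)
      (\<lambda>s. (\<Prod>j<k. W (s (2 * j)) (s (Suc (2 * j))) (\<zeta> j)) * (\<Prod>j\<in>{k..<N}. W (s (2 * j)) (s (Suc (2 * j))) (\<eta> j)))" for \<eta>
    unfolding symplectic_weight_eq_alternating_sum[OF deg monic] split W_def
    by (intro alternating_sum_cong arg_cong2[of _ _ _ _ "(*)"] prod.cong refl) (simp_all add: merge_def)
  have int': "has_bochner_integral area_measure (W a b) (skew_block \<rho> a b)" if "a < 2 * N" "b < 2 * N" for a b
  proof -
    have "W a b = (\<lambda>z. poly (q a) z * poly (q b) (cnj z) * pair_weight Q N z)"
      by (rule ext) (simp add: W_def)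
    then show ?thesis using int[OF that] by simp
  qed
  have summand: "has_bochner_integral ?M (\<lambda>\<eta>. \<Prod>j\<in>{k..<N}. W (s (2 * j)) (s (Suc (2 * j))) (\<eta> j))
      (\<Prod>j\<in>{k..<N}. skew_block \<rho> (s (2 * j)) (s (Suc (2 * j))))" if s: "s permutes {..<2 * N}" for s
  proof -
    have i: "has_bochner_integral area_measure (W (s (2 * j)) (s (Suc (2 * j)))) (skew_block \<rho> (s (2 * j)) (s (Suc (2 * j))))"
      if "j \<in> {k..<N}" for j
      using permutes_double_less[OF s, of j] that by (intro int') auto
    have i1: "integrable area_measure (W (s (2 * j)) (s (Suc (2 * j))))" if "j \<in> {k..<N}" for j
      using i[OF that] by (rule integrable.intros)
    have "(\<Prod>j\<in>{k..<N}. integral\<^sup>L area_measure (W (s (2 * j)) (s (Suc (2 * j))))) =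
        (\<Prod>j\<in>{k..<N}. skew_block \<rho> (s (2 * j)) (s (Suc (2 * j))))"
      using i by (intro prod.cong refl) (rule has_bochner_integral_integral_eq)
    then show ?thesis
      unfolding has_bochner_integral_iff
      using product_integrable_prod[OF finite_atLeastLessThan i1] product_integral_prod[OF finite_atLeastLessThan i1]
      by simp
  qed
  have "complex_of_real (\<integral>\<eta>. symplectic_weight Q N (merge {..<k} {k..<N} (\<zeta>, \<eta>)) \<partial>?M) =
    (\<integral>\<eta>. complex_of_real (symplectic_weight Q N (merge {..<k} {k..<N} (\<zeta>, \<eta>))) \<partial>?M)"
    by simp
  also have "\<dots> = alternating_sum (2 * N) (\<lambda>s. (\<Prod>j<k. W (s (2 * j)) (s (Suc (2 * j))) (\<zeta> j)) *
      (\<Prod>j\<in>{k..<N}. skew_block \<rho> (s (2 * j)) (s (Suc (2 * j)))))"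
    unfolding pt alternating_sum_def
    by (intro has_bochner_integral_integral_eq has_bochner_integral_sum has_bochner_integral_mult_right summand) auto
  also have "\<dots> = alternating_sum (2 * N) (\<lambda>s. \<Prod>j<N. G j (s (2 * j)) (s (Suc (2 * j))))"
    unfolding split by (intro alternating_sum_cong arg_cong2[of _ _ _ _ "(*)"] prod.cong refl) (simp_all add: G_def)
  also have "\<dots> = (\<Prod>j<N. \<rho> j) * 2 ^ (N - k) * fact (N - k) / fact k *
    (\<Sum>m\<in>inj_maps k N. (\<Prod>j<k. 1 / \<rho> (m j)) * paired_sum k G m)"
    using alternating_sum_skew_block[of N \<rho> k G] \<rho> \<open>k \<le> N\<close>
    by (simp add: G_def fun_eq_iff divide_simps) (simp add: mult_ac)
  also have "(\<lambda>m. paired_sum k G m) = (\<lambda>m. (\<Prod>j<k. pair_weight Q N (\<zeta> j)) *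
      paired_sum k (\<lambda>j a b. poly (q a) (\<zeta> j) * poly (q b) (cnj (\<zeta> j))) m)"
    unfolding paired_sum_def alternating_sum_cmult[symmetric] prod.distrib[symmetric]
    by (intro ext alternating_sum_cong prod.cong refl) (simp add: G_def W_def mult_ac)
  finally show ?thesis by (simp add: sum_distrib_left mult_ac)
qed

text \<open>The partition function is the case \<open>k = 0\<close> of the same integral, so the
  skew norms and \<open>N!\<close> cancel in the quotient. The surviving
  \<open>1 / (2 ^ k * fact k)\<close> is the normalisation of the Pfaffian, and the minus signs of
  the weights absorb the sign in its expansion.\<close>

theorem correlation_eq_pfaffian:
  fixes q :: "nat \<Rightarrow> complex poly"
  assumes deg: "\<And>i. degree (q i) = i" and monic: "\<And>i. lead_coeff (q i) = 1"
    and int: "\<And>a b. a < 2 * N \<Longrightarrow> b < 2 * N \<Longrightarrow>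
      has_bochner_integral area_measure (\<lambda>z. poly (q a) z * poly (q b) (cnj z) * pair_weight Q N z) (skew_block \<rho> a b)"
    and \<rho>: "\<And>i. i < N \<Longrightarrow> \<rho> i \<noteq> 0" and "k \<le> N"
  shows "complex_of_real (correlation Q N k \<zeta>) = (\<Prod>j<k. - pair_weight Q N (\<zeta> j)) *
    pfaffian k (\<lambda>a b. pair_kernel N \<rho> (\<lambda>i. poly (q i)) (conj_pair \<zeta> a) (conj_pair \<zeta> b))"
proof -
  let ?S = "\<Sum>m\<in>inj_maps k N. (\<Prod>j<k. 1 / \<rho> (m j)) *
       paired_sum k (\<lambda>j a b. poly (q a) (\<zeta> j) * poly (q b) (cnj (\<zeta> j))) m"
  let ?R = "\<Prod>j<N. \<rho> j" and ?w = "\<Prod>j<k. pair_weight Q N (\<zeta> j)"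
  have "inj_maps 0 N = {\<lambda>_. undefined}" by (auto simp: inj_maps_def)
  moreover have "symplectic_weight Q N (merge {..<0} {0..<N} (\<zeta>, \<eta>)) = symplectic_weight Q N \<eta>" for \<eta>
    unfolding symplectic_weight_def
    by (intro arg_cong2[of _ _ _ _ "(*)"] prod.cong refl) (simp_all add: merge_def)
  ultimately have Z: "complex_of_real (partition_function Q N) = ?R * 2 ^ N * fact N"
    using integral_symplectic_weight[where \<zeta> = \<zeta>, OF deg monic int \<rho>, of 0]
    by (simp add: partition_function_def atLeast0LessThan paired_sum_def alternating_sum_0)
  have R: "?R \<noteq> 0" using \<rho> by simp
  have "complex_of_real (correlation Q N k \<zeta>) = fact N / fact (N - k) * (complex_of_real (\<integral>\<eta>. symplectic_weight Q N (merge {..<k} {k..<N} (\<zeta>, \<eta>)) \<partial>(Pi\<^sub>M {k..<N} (\<lambda>_. area_measure))) / complex_of_real (partition_function Q N))"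
    unfolding correlation_def symplectic_density_def by simp
  also have "\<dots> = fact N / fact (N - k) * (?R * 2 ^ (N - k) * fact (N - k) / fact k * ?w * ?S / (?R * 2 ^ N * fact N))"
    unfolding Z by (subst integral_symplectic_weight[OF deg monic int \<rho> \<open>k \<le> N\<close>]) simp_all
  also have "\<dots> = ?w * ?S / (2 ^ k * fact k)"
    using R \<open>k \<le> N\<close> by (simp add: field_simps power_diff)
  also have "\<dots> = (\<Prod>j<k. - pair_weight Q N (\<zeta> j)) * ((-1) ^ k / (2 ^ k * fact k) * ?S)"
    by (simp add: prod_uminus power_mult_distrib[symmetric])
  also have "(-1) ^ k / (2 ^ k * fact k) * ?S =
      pfaffian k (\<lambda>a b. pair_kernel N \<rho> (\<lambda>i. poly (q i)) (conj_pair \<zeta> a) (conj_pair \<zeta> b))"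
    unfolding pfaffian_pair_kernel by (simp add: conj_pair_def)
  finally show ?thesis .
qed


section \<open>Skew-orthogonal polynomials of the elliptic potential\<close>

definition gauss_exp :: "real \<Rightarrow> complex \<Rightarrow> real \<Rightarrow> complex" where
  "gauss_exp v \<beta> x = exp (\<beta> * of_real x - of_real (x\<^sup>2 / (2 * v)))"

lemma real_gauss_eq_normal_density:
  assumes "v > 0"
  shows "exp (b * x - x\<^sup>2 / (2 * v)) = (sqrt (2 * pi * v) * exp (b\<^sup>2 * v / 2)) * normal_density (b * v) (sqrt v) x"
proof -
  have e: "b\<^sup>2 * v / 2 + (- (x - b * v)\<^sup>2 / (2 * v)) = b * x - x\<^sup>2 / (2 * v)"
    using assms by (simp add: field_simps power2_eq_square)
  show ?thesis
    unfolding e[symmetric] exp_add using assms by (simp add: normal_density_def)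
qed

lemma integrable_real_gauss:
  assumes "v > 0"
  shows "integrable lborel (\<lambda>x::real. exp (b * x - x\<^sup>2 / (2 * v)))"
  unfolding real_gauss_eq_normal_density[OF assms] using assms by (intro integrable_mult_right) simp

lemma real_gauss_tendsto_0:
  assumes "v > 0"
  shows "((\<lambda>x::real. exp (b * x - x\<^sup>2 / (2 * v))) \<longlongrightarrow> 0) at_top"
    and "((\<lambda>x::real. exp (b * x - x\<^sup>2 / (2 * v))) \<longlongrightarrow> 0) at_bot"
  using assms by real_asymp+

lemma norm_gauss_exp: "norm (gauss_exp v \<beta> x) = exp (Re \<beta> * x - x\<^sup>2 / (2 * v))"
  by (simp add: gauss_exp_def)

lemma power_le_exp_add_exp: "\<bar>x\<bar> ^ k \<le> fact k * (exp x + exp (- x :: real))"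
proof -
  have "\<bar>x\<bar> ^ k / fact k \<le> exp \<bar>x\<bar>"
  proof -
    have "\<bar>x\<bar> ^ k / fact k = (\<Sum>n\<in>{k}. \<bar>x\<bar> ^ n /\<^sub>R fact n)" by (simp add: divide_inverse_commute)
    also have "\<dots> \<le> exp \<bar>x\<bar>"
      unfolding exp_def using summable_exp_generic[of "\<bar>x\<bar>"] by (intro sum_le_suminf) auto
    finally show ?thesis .
  qed
  also have "exp \<bar>x\<bar> \<le> exp x + exp (- x)" by (cases "x \<ge> 0") auto
  finally show ?thesis by (simp add: field_simps)
qed

text \<open>Polynomial growth is absorbed by moving the linear coefficient of the exponent by one in
  both directions. The same bound yields integrability and the decay at both ends.\<close>

lemma poly_gauss_exp_bound:
  obtains C where "\<And>x. norm (poly P (of_real x) * gauss_exp v \<beta> x) \<le>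
    C * (exp ((Re \<beta> + 1) * x - x\<^sup>2 / (2 * v)) + exp ((Re \<beta> - 1) * x - x\<^sup>2 / (2 * v)))"
proof
  fix x :: real
  let ?C = "\<Sum>i\<le>degree P. norm (coeff P i) * fact i"
  have "norm (poly P (of_real x)) \<le> (\<Sum>i\<le>degree P. norm (coeff P i) * \<bar>x\<bar> ^ i)"
    unfolding poly_altdef by (rule order.trans[OF norm_sum]) (simp add: norm_mult norm_power)
  also have "\<dots> \<le> (\<Sum>i\<le>degree P. norm (coeff P i) * (fact i * (exp x + exp (- x))))"
    by (intro sum_mono mult_left_mono power_le_exp_add_exp) auto
  also have "\<dots> = ?C * (exp x + exp (- x))"
    by (simp add: sum_distrib_right mult.assoc)
  finally have "norm (poly P (of_real x) * gauss_exp v \<beta> x) \<le>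
      ?C * (exp x + exp (- x)) * exp (Re \<beta> * x - x\<^sup>2 / (2 * v))"
    unfolding norm_mult norm_gauss_exp by (intro mult_right_mono) auto
  also have "(exp x + exp (- x)) * exp (Re \<beta> * x - x\<^sup>2 / (2 * v)) =
     exp ((Re \<beta> + 1) * x - x\<^sup>2 / (2 * v)) + exp ((Re \<beta> - 1) * x - x\<^sup>2 / (2 * v))"
    by (simp add: distrib_right exp_add[symmetric] algebra_simps)
  then have "?C * (exp x + exp (- x)) * exp (Re \<beta> * x - x\<^sup>2 / (2 * v)) = 
     ?C * (exp ((Re \<beta> + 1) * x - x\<^sup>2 / (2 * v)) + exp ((Re \<beta> - 1) * x - x\<^sup>2 / (2 * v)))"
    by (simp add: mult.assoc)
  finally show "norm (poly P (of_real x) * gauss_exp v \<beta> x) \<le>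
     ?C * (exp ((Re \<beta> + 1) * x - x\<^sup>2 / (2 * v)) + exp ((Re \<beta> - 1) * x - x\<^sup>2 / (2 * v)))" .
qed

lemma continuous_gauss_exp [continuous_intros]:
  "continuous_on A (gauss_exp v \<beta>)"
proof -
  have "gauss_exp v \<beta> = (\<lambda>x. exp (\<beta> * of_real x - of_real (x\<^sup>2 * (1 / (2 * v)))))"
    by (rule ext) (simp add: gauss_exp_def)
  then show ?thesis by (simp only:) (intro continuous_intros)
qed

lemma borel_measurable_gauss_exp [measurable]: "gauss_exp v \<beta> \<in> borel_measurable borel"
  by (intro borel_measurable_continuous_onI continuous_gauss_exp)

lemma borel_measurable_poly_of_real [measurable]:
  "(\<lambda>x. poly P (complex_of_real x)) \<in> borel_measurable borel"
  by (intro borel_measurable_continuous_onI continuous_intros)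

lemma integrable_poly_gauss_exp:
  assumes "v > 0"
  shows "integrable lborel (\<lambda>x. poly P (of_real x) * gauss_exp v \<beta> x)"
proof -
  obtain C where C: "\<And>x. norm (poly P (of_real x) * gauss_exp v \<beta> x) \<le>
    C * (exp ((Re \<beta> + 1) * x - x\<^sup>2 / (2 * v)) + exp ((Re \<beta> - 1) * x - x\<^sup>2 / (2 * v)))"
    by (rule poly_gauss_exp_bound[of P v \<beta>]) blast
  show ?thesis
  proof (rule Bochner_Integration.integrable_bound)
    show "integrable lborel (\<lambda>x. C * (exp ((Re \<beta> + 1) * x - x\<^sup>2 / (2 * v)) + exp ((Re \<beta> - 1) * x - x\<^sup>2 / (2 * v))))"
      using assms by (intro integrable_mult_right Bochner_Integration.integrable_add integrable_real_gauss)
    show "AE x in lborel. norm (poly P (of_real x) * gauss_exp v \<beta> x) \<le>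
       norm (C * (exp ((Re \<beta> + 1) * x - x\<^sup>2 / (2 * v)) + exp ((Re \<beta> - 1) * x - x\<^sup>2 / (2 * v))))"
      using C by (intro AE_I2) (metis abs_ge_self order.trans real_norm_def)
  qed measurable
qed

lemma poly_gauss_exp_tendsto_0:
  assumes "v > 0"
  shows "((\<lambda>x. poly P (of_real x) * gauss_exp v \<beta> x) \<longlongrightarrow> 0) at_top"
    and "((\<lambda>x. poly P (of_real x) * gauss_exp v \<beta> x) \<longlongrightarrow> 0) at_bot"
proof -
  obtain C where C: "\<And>x. norm (poly P (of_real x) * gauss_exp v \<beta> x) \<le>
    C * (exp ((Re \<beta> + 1) * x - x\<^sup>2 / (2 * v)) + exp ((Re \<beta> - 1) * x - x\<^sup>2 / (2 * v)))"
    by (rule poly_gauss_exp_bound[of P v \<beta>]) blast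
  have lim: "((\<lambda>x. poly P (of_real x) * gauss_exp v \<beta> x) \<longlongrightarrow> 0) F"
    if "\<And>b. ((\<lambda>x. exp (b * x - x\<^sup>2 / (2 * v))) \<longlongrightarrow> 0) F" for F
  proof (rule Lim_null_comparison)
    show "\<forall>\<^sub>F x in F. norm (poly P (of_real x) * gauss_exp v \<beta> x) \<le>
        C * (exp ((Re \<beta> + 1) * x - x\<^sup>2 / (2 * v)) + exp ((Re \<beta> - 1) * x - x\<^sup>2 / (2 * v)))"
      using C by simp
    show "((\<lambda>x. C * (exp ((Re \<beta> + 1) * x - x\<^sup>2 / (2 * v)) + exp ((Re \<beta> - 1) * x - x\<^sup>2 / (2 * v)))) \<longlongrightarrow> 0) F"
      by (rule tendsto_eq_intros that | simp)+
  qed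
  show "((\<lambda>x. poly P (of_real x) * gauss_exp v \<beta> x) \<longlongrightarrow> 0) at_top"
    "((\<lambda>x. poly P (of_real x) * gauss_exp v \<beta> x) \<longlongrightarrow> 0) at_bot"
    using lim[OF real_gauss_tendsto_0(1)[OF assms]] lim[OF real_gauss_tendsto_0(2)[OF assms]] by blast+
qed

lemma integral_derivative_eq_0:
  fixes f F :: "real \<Rightarrow> complex"
  assumes F: "\<And>x. (F has_vector_derivative f x) (at x)" and f: "continuous_on UNIV f" "integrable lborel f"
    and lim: "(F \<longlongrightarrow> 0) at_top" "(F \<longlongrightarrow> 0) at_bot"
  shows "(\<integral>x. f x \<partial>lborel) = 0"
proof -
  have "(LBINT x=-\<infinity>..\<infinity>. f x) = 0 - 0"
  proof (rule interval_integral_FTC_integrable[where F = F])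
    show "isCont f x" for x using f(1) by (simp add: continuous_on_eq_continuous_at)
    show "set_integrable lborel (einterval (-\<infinity>) \<infinity>) f"
      using f(2) by (simp add: set_integrable_def)
    show "((F \<circ> real_of_ereal) \<longlongrightarrow> 0) (at_right (-\<infinity>))" "((F \<circ> real_of_ereal) \<longlongrightarrow> 0) (at_left \<infinity>)"
      using lim by (simp_all add: ereal_tendsto_simps)
  qed (use F in auto)
  then show ?thesis
    by (simp add: interval_lebesgue_integral_def set_lebesgue_integral_def)
qed

lemma gauss_exp_has_vector_derivative:
  assumes "v > 0"
  shows "(gauss_exp v \<beta> has_vector_derivative (\<beta> - of_real (x / v)) * gauss_exp v \<beta> x) (at x)"
proof -
  define g where "g z = exp (\<beta> * z - z\<^sup>2 * of_real (1 / (2 * v)))" for z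
  have eq: "gauss_exp v \<beta> x = g (of_real x)" for x
    by (simp add: gauss_exp_def g_def)
  have "(g has_field_derivative (\<beta> - 2 * of_real x * of_real (1 / (2 * v))) * g (of_real x)) (at (of_real x))"
    unfolding g_def using assms by (auto intro!: derivative_eq_intros)
  also have "2 * of_real x * of_real (1 / (2 * v)) = (of_real (x / v) :: complex)"
    using assms by simp
  finally have "((\<lambda>x. g (of_real x)) has_vector_derivative (\<beta> - of_real (x / v)) * g (of_real x)) (at x)"
    by (rule has_vector_derivative_real_field)
  then show ?thesis unfolding eq[abs_def] .
qed

lemma poly_of_real_has_vector_derivative:
  fixes P :: "complex poly"
  shows "((\<lambda>x. poly P (of_real x)) has_vector_derivative poly (pderiv P) (of_real x)) (at x)"
  using has_vector_derivative_real_field[OF poly_DERIV[of P "of_real x"]] by (simp add: comp_def)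

text \<open>Gaussian integration by parts: the derivative of \<open>P\<close> times the Gaussian has
  integral zero. Moments and recursions are all derived from this identity; only total masses are
  evaluated explicitly.\<close>

lemma integral_pderiv_gauss_exp:
  assumes "v > 0"
  shows "(\<integral>x. poly (pderiv P) (of_real x) * gauss_exp v \<beta> x \<partial>lborel) =
    (\<integral>x. poly ([:- \<beta>, 1 / of_real v:] * P) (of_real x) * gauss_exp v \<beta> x \<partial>lborel)"
proof -
  let ?f = "\<lambda>x. poly (pderiv P - [:- \<beta>, 1 / of_real v:] * P) (of_real x) * gauss_exp v \<beta> x"
  have "(\<integral>x. ?f x \<partial>lborel) = 0"
  proof (rule integral_derivative_eq_0)
    show "((\<lambda>x. poly P (of_real x) * gauss_exp v \<beta> x) has_vector_derivative ?f x) (at x)" for x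
      using assms by (auto intro!: derivative_eq_intros gauss_exp_has_vector_derivative
        poly_of_real_has_vector_derivative simp: algebra_simps)
    show "continuous_on UNIV ?f" by (intro continuous_intros)
  qed (intro integrable_poly_gauss_exp poly_gauss_exp_tendsto_0 assms)+
  moreover have "?f = (\<lambda>x. poly (pderiv P) (of_real x) * gauss_exp v \<beta> x -
      poly ([:- \<beta>, 1 / of_real v:] * P) (of_real x) * gauss_exp v \<beta> x)"
    by (simp only: poly_diff left_diff_distrib)
  ultimately show ?thesis
    using Bochner_Integration.integral_diff[OF integrable_poly_gauss_exp[OF assms, of "pderiv P" \<beta>]
      integrable_poly_gauss_exp[OF assms, of "[:- \<beta>, 1 / of_real v:] * P" \<beta>]]
    by (simp only: right_minus_eq)
qed

lemma gauss_completing_square: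
  fixes B W V :: complex
  shows "(B + \<i> * W) * (B * V) - B\<^sup>2 * V / 2 + - W\<^sup>2 * V / 2 = (B + \<i> * W)\<^sup>2 * V / 2"
proof -
  have "(B + \<i> * W)\<^sup>2 = B\<^sup>2 + 2 * (\<i> * (B * W)) - W\<^sup>2"
    by (simp add: power2_eq_square algebra_simps)
  then have "(B + \<i> * W)\<^sup>2 * V / 2 = (B\<^sup>2 * V + 2 * (\<i> * (B * W) * V) - W\<^sup>2 * V) / 2"
    by (simp only: ring_distribs mult.assoc)
  also have "\<dots> = B\<^sup>2 * V / 2 + \<i> * (B * W) * V - W\<^sup>2 * V / 2"
    by (simp only: add_divide_distrib diff_divide_distrib) simp
  moreover have "(B + \<i> * W) * (B * V) = B\<^sup>2 * V / 2 + B\<^sup>2 * V / 2 + \<i> * (B * W) * V"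
    by (simp add: power2_eq_square ring_distribs mult_ac)
  ultimately show ?thesis by simp
qed

text \<open>Recentring at \<open>b * v\<close> removes the real part of \<open>\<beta>\<close>.
  After scaling by \<open>sqrt v\<close> what remains is the characteristic function of the standard
  normal law, so no contour has to be moved.\<close>

lemma integral_gauss_exp:
  assumes "v > 0"
  shows "(\<integral>x. gauss_exp v \<beta> x \<partial>lborel) = of_real (sqrt (2 * pi * v)) * exp (\<beta>\<^sup>2 * of_real v / 2)"
proof -
  define b \<omega> where "b = Re \<beta>" and "\<omega> = Im \<beta>"
  have \<beta>: "\<beta> = of_real b + \<i> * of_real \<omega>" by (simp add: b_def \<omega>_def complex_eq_iff)
  let ?s = "sqrt v"
  have s: "?s \<noteq> 0" "?s\<^sup>2 = v" "complex_of_real ?s * complex_of_real ?s = of_real v" using assms by (auto simp flip: of_real_mult)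
  have char: "(\<integral>x. of_real (std_normal_density x) * iexp (t * x) \<partial>lborel) = complex_of_real (exp (- (t\<^sup>2) / 2))" for t
    using fun_cong[OF char_std_normal_distribution, of t] unfolding char_def
    by (subst (asm) integral_density) (auto simp: scaleR_conv_of_real)
  have "(\<integral>x. gauss_exp v \<beta> x \<partial>lborel) = ?s *\<^sub>R (\<integral>x. gauss_exp v \<beta> (b * v + ?s * x) \<partial>lborel)"
    using assms by (subst lborel_integral_real_affine[where c = ?s and t = "b * v"]) auto
  also have "(\<lambda>x. gauss_exp v \<beta> (b * v + ?s * x)) = (\<lambda>x. exp (\<beta> * of_real (b * v) - of_real (b\<^sup>2 * v / 2)) * of_real (sqrt (2 * pi)) *
      (of_real (std_normal_density x) * iexp (\<omega> * ?s * x)))"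
  proof
    fix x
    have "\<beta> * of_real (b * v + ?s * x) - of_real ((b * v + ?s * x)\<^sup>2 / (2 * v)) =
       (\<beta> * of_real (b * v) - of_real (b\<^sup>2 * v / 2)) + of_real (- x\<^sup>2 / 2) + \<i> * of_real (\<omega> * ?s * x)"
    proof -
      have "(b * v + ?s * x)\<^sup>2 / (2 * v) = b\<^sup>2 * v / 2 + b * ?s * x + x\<^sup>2 / 2"
      proof -
        have "?s * (b * ?s + x) = b * ?s\<^sup>2 + ?s * x" by (simp add: power2_eq_square algebra_simps)
        then have "b * v + ?s * x = ?s * (b * ?s + x)" by (simp only: s(2))
        then have "(b * v + ?s * x)\<^sup>2 / (2 * v) = (b * ?s + x)\<^sup>2 / 2"
          using assms by (simp only: power_mult_distrib s(2)) simp
        also have "\<dots> = b\<^sup>2 * ?s\<^sup>2 / 2 + b * ?s * x + x\<^sup>2 / 2"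
          by (simp add: power2_eq_square algebra_simps add_divide_distrib)
        finally show ?thesis by (simp only: s(2))
      qed
      then show ?thesis
        by (simp only: of_real_add of_real_mult of_real_divide of_real_power of_real_minus of_real_numeral \<beta> ring_distribs mult.assoc) simp
    qed
    then show "gauss_exp v \<beta> (b * v + ?s * x) = exp (\<beta> * of_real (b * v) - of_real (b\<^sup>2 * v / 2)) * of_real (sqrt (2 * pi)) *
      (of_real (std_normal_density x) * iexp (\<omega> * ?s * x))"
      unfolding gauss_exp_def by (simp only: exp_add) (simp add: std_normal_density_def exp_of_real[symmetric])
  qed
  also have "?s *\<^sub>R (\<integral>x. exp (\<beta> * of_real (b * v) - of_real (b\<^sup>2 * v / 2)) * of_real (sqrt (2 * pi)) *
      (of_real (std_normal_density x) * iexp (\<omega> * ?s * x)) \<partial>lborel) =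
    of_real (sqrt (2 * pi * v)) * (exp (\<beta> * of_real (b * v) - of_real (b\<^sup>2 * v / 2)) * exp (of_real (- ((\<omega> * ?s)\<^sup>2) / 2)))"
    unfolding integral_mult_right_zero char
    by (simp add: scaleR_conv_of_real real_sqrt_mult exp_of_real[symmetric] mult_ac)
  also have "exp (\<beta> * of_real (b * v) - of_real (b\<^sup>2 * v / 2)) * exp (complex_of_real (- ((\<omega> * ?s)\<^sup>2) / 2)) = exp (\<beta>\<^sup>2 * of_real v / 2)"
  proof -
    have *: "complex_of_real (- ((\<omega> * ?s)\<^sup>2) / 2) = - (of_real \<omega>)\<^sup>2 * of_real v / 2"
      by (simp only: power_mult_distrib s(2)) simp
    have "\<beta> * of_real (b * v) - of_real (b\<^sup>2 * v / 2) + complex_of_real (- ((\<omega> * ?s)\<^sup>2) / 2) = \<beta>\<^sup>2 * of_real v / 2"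
      unfolding * \<beta> using gauss_completing_square[of "of_real b" "of_real \<omega>" "of_real v"]
      by (simp only: of_real_mult of_real_power of_real_divide of_real_numeral)
    then show ?thesis unfolding exp_add[symmetric] by (rule arg_cong)
  qed
  finally show ?thesis .
qed


section \<open>Planar Gaussian moments\<close>

lemma lborel_complex_eq_distr:
  "(lborel :: complex measure) = distr (lborel \<Otimes>\<^sub>M lborel) borel (\<lambda>(x, y). Complex x y)"
proof (rule lborel_eqI)
  have meas [measurable]: "(\<lambda>(x, y). Complex x y) \<in> borel_measurable (lborel \<Otimes>\<^sub>M lborel)"
    unfolding case_prod_unfold Complex_eq by measurable
  fix l u :: complex
  assume "\<And>b. b \<in> Basis \<Longrightarrow> l \<bullet> b \<le> u \<bullet> b"
  from this[of 1] this[of \<i>] have le: "Re l \<le> Re u" "Im l \<le> Im u" by (auto simp: Basis_complex_def)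
  have "(\<lambda>(x, y). Complex x y) -` box l u \<inter> space (lborel \<Otimes>\<^sub>M lborel) = {Re l<..<Re u} \<times> {Im l<..<Im u}"
    by (auto simp: space_pair_measure in_box_complex_iff)
  then have "emeasure (distr (lborel \<Otimes>\<^sub>M lborel) borel (\<lambda>(x, y). Complex x y)) (box l u) =
      emeasure lborel {Re l<..<Re u} * emeasure lborel {Im l<..<Im u}"
    by (simp add: emeasure_distr lborel.emeasure_pair_measure_Times)
  then show "emeasure (distr (lborel \<Otimes>\<^sub>M lborel) borel (\<lambda>(x, y). Complex x y)) (box l u) = ennreal (\<Prod>b\<in>Basis. (u - l) \<bullet> b)"
    using le by (simp add: Basis_complex_def ennreal_mult)
qed simp

lemma has_bochner_integral_area_measure:
  fixes f :: "complex \<Rightarrow> complex"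
  assumes "integrable (lborel \<Otimes>\<^sub>M lborel) (\<lambda>(x, y). f (Complex x y))" and [measurable]: "f \<in> borel_measurable borel"
  shows "has_bochner_integral area_measure f ((\<integral>(x, y). f (Complex x y) \<partial>(lborel \<Otimes>\<^sub>M lborel)) / of_real pi)"
proof -
  have meas [measurable]: "(\<lambda>(x, y). Complex x y) \<in> borel_measurable (lborel \<Otimes>\<^sub>M lborel)"
    unfolding case_prod_unfold Complex_eq by measurable
  have "has_bochner_integral (lborel \<Otimes>\<^sub>M lborel) (\<lambda>p. f (case p of (x, y) \<Rightarrow> Complex x y)) (\<integral>(x, y). f (Complex x y) \<partial>(lborel \<Otimes>\<^sub>M lborel))"
    using assms(1) by (simp add: has_bochner_integral_iff case_prod_unfold)
  then have "has_bochner_integral lborel f (\<integral>(x, y). f (Complex x y) \<partial>(lborel \<Otimes>\<^sub>M lborel))"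
    by (subst lborel_complex_eq_distr) (rule has_bochner_integral_distr, auto)
  then have "has_bochner_integral lborel (\<lambda>x. (1 / pi) *\<^sub>R f x) ((1 / pi) *\<^sub>R (\<integral>(x, y). f (Complex x y) \<partial>(lborel \<Otimes>\<^sub>M lborel)))"
    by (rule has_bochner_integral_scaleR_right)
  then show ?thesis
    unfolding area_measure_def by (subst has_bochner_integral_density) (auto simp: scaleR_conv_of_real)
qed

text \<open>The second polynomial is evaluated at the conjugate point but its coefficients are not
  conjugated, since it comes from the row of the conjugate. The resulting pairing is bilinear, not
  sesquilinear.\<close>

definition planar_gauss :: "real \<Rightarrow> real \<Rightarrow> complex poly \<Rightarrow> complex poly \<Rightarrow> real \<times> real \<Rightarrow> complex" where
  "planar_gauss v w f g = (\<lambda>(x, y). poly f (Complex x y) * poly g (cnj (Complex x y)) * (gauss_exp v 0 x * gauss_exp w 0 y))"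

definition planar_moment :: "real \<Rightarrow> real \<Rightarrow> complex poly \<Rightarrow> complex poly \<Rightarrow> complex" where
  "planar_moment v w f g = integral\<^sup>L (lborel \<Otimes>\<^sub>M lborel) (planar_gauss v w f g)"

lemma integrable_pair_mult:
  fixes f g :: "real \<Rightarrow> complex"
  assumes f: "integrable lborel f" and g: "integrable lborel g"
  shows "integrable (lborel \<Otimes>\<^sub>M lborel) (\<lambda>(x, y). f x * g y)"
proof -
  have [measurable]: "f \<in> borel_measurable borel" "g \<in> borel_measurable borel"
    using borel_measurable_integrable[OF f] borel_measurable_integrable[OF g] by auto
  show ?thesis
  proof (rule lborel_pair.Fubini_integrable)
    show "integrable lborel (\<lambda>x. \<integral>y. norm (case (x, y) of (x, y) \<Rightarrow> f x * g y) \<partial>lborel)"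
      using f by (simp add: norm_mult)
    show "AE x in lborel. integrable lborel (\<lambda>y. case (x, y) of (x, y) \<Rightarrow> f x * g y)"
      using g by simp
  qed measurable
qed

text \<open>Factors of \<open>Complex x y\<close> and its conjugate are split off one at a time into
  real and imaginary parts. Each split raises the power of \<open>x\<close> or \<open>y\<close>, so
  the induction has to be general in \<open>a\<close> and \<open>b\<close>.\<close>

lemma integrable_planar_monomial:
  assumes "v > 0" "w > 0"
  shows "integrable (lborel \<Otimes>\<^sub>M lborel) (\<lambda>(x, y). (Complex x y) ^ n * (cnj (Complex x y)) ^ m *
     ((of_real x ^ a * gauss_exp v 0 x) * (of_real y ^ b * gauss_exp w 0 y)))"
proof (induction n arbitrary: m a b)
  case 0
  show ?case
  proof (induction m arbitrary: a b)
    case 0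
    show ?case
      using integrable_pair_mult[OF integrable_poly_gauss_exp[OF assms(1), of "monom 1 a" 0]
          integrable_poly_gauss_exp[OF assms(2), of "monom 1 b" 0]]
      by (simp add: poly_monom)
  next
    case (Suc m)
    show ?case
      using Bochner_Integration.integrable_diff[OF Suc[of "Suc a" b] integrable_mult_right[OF Suc[of a "Suc b"], of \<i>]]
      by (simp add: case_prod_unfold Complex_eq algebra_simps)
  qed
next
  case (Suc n)
  show ?case
    using Bochner_Integration.integrable_add[OF Suc[of m "Suc a" b] integrable_mult_right[OF Suc[of m a "Suc b"], of \<i>]]
    by (simp add: case_prod_unfold Complex_eq algebra_simps)
qed

lemma integrable_planar_gauss:
  assumes "v > 0" "w > 0"
  shows "integrable (lborel \<Otimes>\<^sub>M lborel) (planar_gauss v w f g)"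
proof -
  have "planar_gauss v w f g = (\<lambda>p. \<Sum>i\<le>degree f. \<Sum>j\<le>degree g. coeff f i * coeff g j *
      (case p of (x, y) \<Rightarrow> (Complex x y) ^ i * (cnj (Complex x y)) ^ j *
       ((of_real x ^ 0 * gauss_exp v 0 x) * (of_real y ^ 0 * gauss_exp w 0 y))))"
    unfolding planar_gauss_def poly_altdef
    by (rule ext) (simp add: case_prod_unfold sum_distrib_left sum_distrib_right mult_ac, rule sum.swap)
  then show ?thesis
    by (simp only:) (intro Bochner_Integration.integrable_sum integrable_mult_right integrable_planar_monomial assms)
qed

lemma planar_moment_add:
  assumes "v > 0" "w > 0"
  shows "planar_moment v w (f + f') g = planar_moment v w f g + planar_moment v w f' g"
    and "planar_moment v w f (g + g') = planar_moment v w f g + planar_moment v w f g'"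
proof -
  have "planar_gauss v w (f + f') g = (\<lambda>p. planar_gauss v w f g p + planar_gauss v w f' g p)"
    "planar_gauss v w f (g + g') = (\<lambda>p. planar_gauss v w f g p + planar_gauss v w f g' p)"
    by (auto simp: planar_gauss_def fun_eq_iff algebra_simps)
  then show "planar_moment v w (f + f') g = planar_moment v w f g + planar_moment v w f' g"
    "planar_moment v w f (g + g') = planar_moment v w f g + planar_moment v w f g'"
    using integrable_planar_gauss[OF assms] by (simp_all add: planar_moment_def)
qed

lemma planar_moment_smult:
  "planar_moment v w (smult c f) g = c * planar_moment v w f g"
  "planar_moment v w f (smult c g) = c * planar_moment v w f g"
proof -
  have "planar_gauss v w (smult c f) g = (\<lambda>p. c * planar_gauss v w f g p)"
    "planar_gauss v w f (smult c g) = (\<lambda>p. c * planar_gauss v w f g p)"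
    by (auto simp: planar_gauss_def fun_eq_iff)
  then show "planar_moment v w (smult c f) g = c * planar_moment v w f g"
    "planar_moment v w f (smult c g) = c * planar_moment v w f g"
    by (simp_all add: planar_moment_def)
qed

lemma pderiv_pcompose_linear: "pderiv (pcompose f [:a, b:]) = smult b (pcompose (pderiv f) [:a, b:])"
  by (simp add: pderiv_pcompose pderiv_pCons)

text \<open>Integration by parts along horizontal lines: the point plus its conjugate is
  \<open>2 * x\<close>, and the derivative in \<open>x\<close> of the product of the two polynomials
  differentiates each factor once with coefficient one.\<close>

lemma planar_moment_parts_x:
  assumes "v > 0" "w > 0"
  shows "planar_moment v w (pCons 0 f) g + planar_moment v w f (pCons 0 g) =
    2 * of_real v * (planar_moment v w (pderiv f) g + planar_moment v w f (pderiv g))"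
proof -
  define A where "A p = planar_gauss v w (pderiv f) g p + planar_gauss v w f (pderiv g) p" for p
  define B where "B p = planar_gauss v w (pCons 0 f) g p + planar_gauss v w f (pCons 0 g) p" for p
  note int = integrable_planar_gauss[OF assms]
  have A: "integrable (lborel \<Otimes>\<^sub>M lborel) (\<lambda>(x, y). A (x, y))" and B: "integrable (lborel \<Otimes>\<^sub>M lborel) (\<lambda>(x, y). B (x, y))"
    unfolding A_def B_def case_prod_unfold prod.collapse by (intro Bochner_Integration.integrable_add int)+
  have "(\<integral>x. A (x, y) \<partial>lborel) = (\<integral>x. B (x, y) \<partial>lborel) / (2 * of_real v)" for y
  proof -
    define P where "P = pcompose f [:\<i> * of_real y, 1:] * pcompose g [:- \<i> * of_real y, 1:]"
    have eq: "Complex x y = \<i> * of_real y + of_real x" "cnj (Complex x y) = - \<i> * of_real y + of_real x" for x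
      by (simp_all add: complex_eq_iff)
    have "A (x, y) = gauss_exp w 0 y * (poly (pderiv P) (of_real x) * gauss_exp v 0 x)" for x
      unfolding A_def planar_gauss_def case_prod_conv eq P_def pderiv_mult pderiv_pcompose_linear
      by (simp add: poly_pcompose algebra_simps)
    moreover have "B (x, y) = 2 * of_real v * (gauss_exp w 0 y * (poly ([:- 0, 1 / of_real v:] * P) (of_real x) * gauss_exp v 0 x))" for x
      unfolding B_def planar_gauss_def case_prod_conv eq P_def using assms
      by (simp add: poly_pcompose algebra_simps)
    ultimately show ?thesis
      using assms by (simp only: integral_mult_right_zero integral_pderiv_gauss_exp) simp
  qed
  then have "(\<integral>y. \<integral>x. A (x, y) \<partial>lborel \<partial>lborel) = (\<integral>y. \<integral>x. B (x, y) \<partial>lborel \<partial>lborel) / (2 * of_real v)"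
    by simp
  then have "(\<integral>p. A p \<partial>(lborel \<Otimes>\<^sub>M lborel)) = (\<integral>p. B p \<partial>(lborel \<Otimes>\<^sub>M lborel)) / (2 * of_real v)"
    by (simp add: lborel_pair.integral_snd[OF A] lborel_pair.integral_snd[OF B])
  then show ?thesis
    using assms by (simp add: A_def B_def planar_moment_def int field_simps)
qed

text \<open>Integration by parts along vertical lines: the point minus its conjugate is
  \<open>2 * \<i> * y\<close>, and the derivative in \<open>y\<close> differentiates the two factors
  with opposite coefficients \<open>\<i>\<close> and \<open>- \<i>\<close>. The left side is the
  pairing with the weight of the symplectic ensemble.\<close>

lemma planar_moment_parts_y:
  assumes "v > 0" "w > 0"
  shows "planar_moment v w (pCons 0 f) g - planar_moment v w f (pCons 0 g) =
    - 2 * of_real w * (planar_moment v w (pderiv f) g - planar_moment v w f (pderiv g))"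
proof -
  define A where "A p = planar_gauss v w (pderiv f) g p - planar_gauss v w f (pderiv g) p" for p
  define B where "B p = planar_gauss v w (pCons 0 f) g p - planar_gauss v w f (pCons 0 g) p" for p
  note int = integrable_planar_gauss[OF assms]
  have A: "integrable (lborel \<Otimes>\<^sub>M lborel) A" and B: "integrable (lborel \<Otimes>\<^sub>M lborel) B"
    unfolding A_def B_def by (intro Bochner_Integration.integrable_diff int)+
  have "(\<integral>y. A (x, y) \<partial>lborel) = (\<integral>y. B (x, y) \<partial>lborel) / (- 2 * of_real w)" for x
  proof -
    define P where "P = pcompose f [:of_real x, \<i>:] * pcompose g [:of_real x, - \<i>:]"
    have eq: "Complex x y = of_real x + of_real y * \<i>" "cnj (Complex x y) = of_real x + of_real y * (- \<i>)" for y
      by (simp_all add: complex_eq_iff)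
    have "A (x, y) = - \<i> * (gauss_exp v 0 x * (poly (pderiv P) (of_real y) * gauss_exp w 0 y))" for y
      unfolding A_def planar_gauss_def case_prod_conv eq P_def pderiv_mult pderiv_pcompose_linear
      by (simp add: poly_pcompose algebra_simps)
    moreover have "B (x, y) = - 2 * of_real w * (- \<i> * (gauss_exp v 0 x * (poly ([:- 0, 1 / of_real w:] * P) (of_real y) * gauss_exp w 0 y)))" for y
      unfolding B_def planar_gauss_def case_prod_conv eq P_def using assms
      by (simp add: poly_pcompose algebra_simps)
    ultimately show ?thesis
      using assms by (simp only: integral_mult_right_zero integral_pderiv_gauss_exp) simp
  qed
  then have "(\<integral>x. \<integral>y. A (x, y) \<partial>lborel \<partial>lborel) = (\<integral>x. \<integral>y. B (x, y) \<partial>lborel \<partial>lborel) / (- 2 * of_real w)"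
    by simp
  then have "(\<integral>p. A p \<partial>(lborel \<Otimes>\<^sub>M lborel)) = (\<integral>p. B p \<partial>(lborel \<Otimes>\<^sub>M lborel)) / (- 2 * of_real w)"
    by (simp add: lborel_pair.integral_fst'[OF A] lborel_pair.integral_fst'[OF B])
  then show ?thesis
    using assms by (simp add: A_def B_def planar_moment_def int field_simps)
qed

text \<open>Half the sum and half the difference of the two integrations by parts. Multiplication by
  the variable becomes differentiation, with \<open>v - w\<close> on the same side and
  \<open>v + w\<close> on the other.\<close>

lemma planar_moment_pCons:
  assumes "v > 0" "w > 0"
  shows "planar_moment v w (pCons 0 f) g =
      of_real (v - w) * planar_moment v w (pderiv f) g + of_real (v + w) * planar_moment v w f (pderiv g)"
    and "planar_moment v w f (pCons 0 g) =
      of_real (v + w) * planar_moment v w (pderiv f) g + of_real (v - w) * planar_moment v w f (pderiv g)"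
proof -
  have solve: "a = of_real (v - w) * x + of_real (v + w) * y \<and> b = of_real (v + w) * x + of_real (v - w) * y"
    if "a + b = 2 * of_real v * (x + y)" "a - b = - 2 * of_real w * (x - y)" for a b x y :: complex
  proof -
    have "2 * a = (a + b) + (a - b)" "2 * b = (a + b) - (a - b)" by simp_all
    then have "2 * a = 2 * (of_real (v - w) * x + of_real (v + w) * y)" "2 * b = 2 * (of_real (v + w) * x + of_real (v - w) * y)"
      unfolding that by (simp_all add: algebra_simps)
    then show ?thesis by (simp only: mult_cancel_left) simp
  qed
  show "planar_moment v w (pCons 0 f) g =
      of_real (v - w) * planar_moment v w (pderiv f) g + of_real (v + w) * planar_moment v w f (pderiv g)"
    "planar_moment v w f (pCons 0 g) =
      of_real (v + w) * planar_moment v w (pderiv f) g + of_real (v - w) * planar_moment v w f (pderiv g)"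
    using solve[OF planar_moment_parts_x[OF assms] planar_moment_parts_y[OF assms], of f g] by blast+
qed

lemma planar_moment_1:
  assumes "v > 0" "w > 0"
  shows "planar_moment v w 1 1 = of_real (2 * pi * sqrt v * sqrt w)"
proof -
  have int: "integrable (lborel \<Otimes>\<^sub>M lborel) (planar_gauss v w 1 1)"
    by (rule integrable_planar_gauss[OF assms])
  have "planar_moment v w 1 1 = (\<integral>x. \<integral>y. planar_gauss v w 1 1 (x, y) \<partial>lborel \<partial>lborel)"
    unfolding planar_moment_def by (rule lborel_pair.integral_fst'[OF int, symmetric])
  also have "\<dots> = of_real (sqrt (2 * pi * v)) * of_real (sqrt (2 * pi * w))"
    using assms by (simp add: planar_gauss_def integral_gauss_exp)
  also have "\<dots> = of_real ((sqrt (2 * pi) * sqrt (2 * pi)) * sqrt v * sqrt w)"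
    unfolding real_sqrt_mult[of "2 * pi"] of_real_mult by (simp only: mult_ac)
  finally show ?thesis by (simp only: real_sqrt_mult_self abs_of_pos pi_gt_zero mult_pos_pos zero_less_numeral)
qed


section \<open>Hermite polynomials and skew-orthogonality\<close>

text \<open>These are the monic Hermite polynomials of variance \<open>a\<close>, that is, the
  probabilists' polynomial at \<open>z / sqrt a\<close> times the \<open>n\<close>-th power of
  \<open>sqrt a\<close>. The recursion by multiplication and derivative needs no square root of
  \<open>a\<close> and has the shape of the moment identities above.\<close>

primrec scaled_hermite :: "complex \<Rightarrow> nat \<Rightarrow> complex poly" where
  "scaled_hermite a 0 = 1"
| "scaled_hermite a (Suc n) = pCons 0 (scaled_hermite a n) - smult a (pderiv (scaled_hermite a n))"

declare scaled_hermite.simps(2) [simp del]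

lemma degree_scaled_hermite_lead_coeff:
  "degree (scaled_hermite a n) = n \<and> lead_coeff (scaled_hermite a n) = 1"
proof (induction n)
  case (Suc n)
  let ?p = "scaled_hermite a n"
  have nz: "?p \<noteq> 0" using Suc by auto
  have less: "degree (smult a (pderiv ?p)) < degree (pCons 0 ?p)"
    using Suc nz degree_smult_le[of a "pderiv ?p"] by (simp add: degree_pderiv degree_pCons_eq)
  then have "degree (pCons 0 ?p + - smult a (pderiv ?p)) = degree (pCons 0 ?p)"
    by (intro degree_add_eq_left) simp
  moreover have "coeff ?p n = 1" using Suc by metis
  ultimately show ?case
    using Suc nz coeff_eq_0[OF less] by (auto simp: degree_pCons_eq scaled_hermite.simps(2))
qed simp

text \<open>Differentiation and multiplication by the variable have commutator one, so each step of
  the recursion adds one copy of the polynomial to the derivative. This turns the defining recursion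
  into the three-term one.\<close>

lemma pderiv_scaled_hermite:
  "pderiv (scaled_hermite a (Suc n)) = smult (of_nat (Suc n)) (scaled_hermite a n)"
proof (induction n)
  case 0
  then show ?case by (simp add: pderiv_pCons pderiv_1 pderiv_diff pderiv_smult scaled_hermite.simps(2))
next
  case (Suc n)
  let ?h = "scaled_hermite a"
  have "pderiv (?h (Suc (Suc n))) = ?h (Suc n) + (pCons 0 (pderiv (?h (Suc n))) - smult a (pderiv (pderiv (?h (Suc n)))))"
    by (subst scaled_hermite.simps(2)) (simp only: pderiv_diff pderiv_pCons pderiv_smult add_diff_eq)
  also have "\<dots> = ?h (Suc n) + smult (of_nat (Suc n)) (pCons 0 (?h n) - smult a (pderiv (?h n)))"
    unfolding Suc.IH by (simp add: pderiv_smult smult_diff_right mult.commute del: of_nat_Suc)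
  also have "pCons 0 (?h n) - smult a (pderiv (?h n)) = ?h (Suc n)" by (simp add: scaled_hermite.simps(2))
  also have "?h (Suc n) + smult (of_nat (Suc n)) (?h (Suc n)) = smult (of_nat (Suc (Suc n))) (?h (Suc n))"
  proof -
    have "?h (Suc n) + smult c (?h (Suc n)) = smult (1 + c) (?h (Suc n))" for c
      by (simp only: smult_add_left smult_1_left)
    then show ?thesis by simp
  qed
  finally show ?case .
qed

lemma scaled_hermite_Suc_Suc:
  "poly (scaled_hermite a (Suc (Suc n))) z =
     z * poly (scaled_hermite a (Suc n)) z - a * of_nat (Suc n) * poly (scaled_hermite a n) z"
  by (subst scaled_hermite.simps(2), subst pderiv_scaled_hermite) simp

text \<open>The coefficient is forced: the Hermite polynomial of degree \<open>2 * Suc m\<close> is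
  not skew-orthogonal to the one of degree \<open>2 * m + 1\<close>, and
  \<open>2 * Suc m / N\<close> times the previous even polynomial cancels that product.\<close>

primrec even_skew_hermite :: "complex \<Rightarrow> real \<Rightarrow> nat \<Rightarrow> complex poly" where
  "even_skew_hermite a N 0 = 1"
| "even_skew_hermite a N (Suc m) =
     scaled_hermite a (2 * Suc m) + smult (of_nat (2 * Suc m) / of_real N) (even_skew_hermite a N m)"

definition skew_hermite :: "complex \<Rightarrow> real \<Rightarrow> nat \<Rightarrow> complex poly" where
  "skew_hermite a N n = (if even n then even_skew_hermite a N (n div 2) else scaled_hermite a n)"

lemma skew_hermite_simps:
  "skew_hermite a N (2 * m) = even_skew_hermite a N m"
  "skew_hermite a N (Suc (2 * m)) = scaled_hermite a (Suc (2 * m))"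
  by (simp_all add: skew_hermite_def)

lemma degree_skew_hermite_lead_coeff:
  "degree (skew_hermite a N n) = n \<and> lead_coeff (skew_hermite a N n) = 1"
proof (cases "even n")
  case True
  have "degree (even_skew_hermite a N m) = 2 * m \<and> lead_coeff (even_skew_hermite a N m) = 1" for m
  proof (induction m)
    case (Suc m)
    let ?h = "scaled_hermite a (2 * Suc m)" and ?r = "smult (of_nat (2 * Suc m) / of_real N) (even_skew_hermite a N m)"
    have h: "degree ?h = 2 * Suc m" "coeff ?h (2 * Suc m) = 1"
      using degree_scaled_hermite_lead_coeff[of a "2 * Suc m"] by metis+
    have less: "degree ?r < degree ?h"
      unfolding h using Suc degree_smult_le[of "of_nat (2 * Suc m) / of_real N" "even_skew_hermite a N m"] by simp
    then have d: "degree (?h + ?r) = 2 * Suc m"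
      by (simp only: degree_add_eq_left h)
    moreover have "coeff ?r (2 * Suc m) = 0" using less unfolding h by (rule coeff_eq_0)
    ultimately have "lead_coeff (?h + ?r) = 1" by (simp only: coeff_add h add_0_right)
    then show ?case using d by (simp only: even_skew_hermite.simps)
  qed simp
  moreover from True obtain m where "n = 2 * m" by blast
  ultimately show ?thesis by (metis skew_hermite_simps(1))
next
  case False
  have "degree (scaled_hermite a n) = n" "coeff (scaled_hermite a n) n = 1"
    using degree_scaled_hermite_lead_coeff[of a n] by metis+
  with False show ?thesis by (simp add: skew_hermite_def)
qed

lemma even_skew_hermite_eq_sum:
  assumes "N \<noteq> 0"
  shows "even_skew_hermite a N m = smult (2 ^ m * fact m / of_real N ^ m)
    (\<Sum>l\<le>m. smult (of_real N ^ l / (2 ^ l * fact l)) (scaled_hermite a (2 * l)))"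
proof (induction m)
  case (Suc m)
  let ?S = "\<Sum>l\<le>m. smult (of_real N ^ l / (2 ^ l * fact l)) (scaled_hermite a (2 * l))"
  let ?c = "2 ^ Suc m * fact (Suc m) / of_real N ^ Suc m :: complex"
  have "even_skew_hermite a N (Suc m) = scaled_hermite a (2 * Suc m) +
     smult (of_nat (2 * Suc m) / of_real N * (2 ^ m * fact m / of_real N ^ m)) ?S"
    by (simp only: even_skew_hermite.simps Suc smult_smult)
  also have "of_nat (2 * Suc m) / of_real N * (2 ^ m * fact m / of_real N ^ m) = ?c"
    by (simp add: field_simps)
  also have "scaled_hermite a (2 * Suc m) = smult ?c (smult (of_real N ^ Suc m / (2 ^ Suc m * fact (Suc m))) (scaled_hermite a (2 * Suc m)))"
    unfolding smult_smult using assms by (simp del: power_Suc fact_Suc mult_Suc_right)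
  finally show ?case by (simp only: smult_add_right sum.atMost_Suc add.commute)
qed simp

text \<open>Here \<open>v\<close> and \<open>w\<close> are the variances of the real and imaginary
  parts under \<open>exp (- N * Q)\<close>. Their sum is \<open>1 / N\<close>, and their difference
  is \<open>\<tau> / N\<close>, which is the Hermite parameter \<open>a\<close>.\<close>

locale elliptic_moments =
  fixes \<tau> :: real and N :: nat and v w :: real and a :: complex
  assumes \<tau>: "-1 < \<tau>" "\<tau> < 1" and N: "N > 0"
  defines "v \<equiv> (1 + \<tau>) / (2 * real N)" and "w \<equiv> (1 - \<tau>) / (2 * real N)" and "a \<equiv> of_real (\<tau> / real N)"
begin

abbreviation "M \<equiv> planar_moment v w"
abbreviation "h \<equiv> scaled_hermite a"
abbreviation "H n \<equiv> fact n / of_nat N ^ n * M 1 1"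

lemma vw_pos: "v > 0" "w > 0"
  using \<tau> N by (simp_all add: v_def w_def)

lemma vw_sum: "v + w = 1 / real N" "v - w = \<tau> / real N"
  by (simp_all add: v_def w_def add_divide_distrib[symmetric] diff_divide_distrib[symmetric] field_simps)

lemma planar_moment_diff:
  "M (f - f') g = M f g - M f' g" "M f (g - g') = M f g - M f g'"
  using planar_moment_add(1)[OF vw_pos, of "f - f'" f' g] apply simp
  using planar_moment_add(2)[OF vw_pos, of f "g - g'" g'] apply simp
  done

lemma planar_moment_0: "M 0 g = 0" "M f 0 = 0"
  using planar_moment_smult(1)[of v w 0 0 g] planar_moment_smult(2)[of v w f 0 0] by simp_all

text \<open>Since \<open>a = v - w\<close>, the derivative in the Hermite recursion cancels the
  same-side term of the moment identity. What survives differentiates the other argument, so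
  iteration gives orthogonality together with the norms.\<close>

lemma moment_hermite_Suc:
  "M (h (Suc n)) g = M (h n) (pderiv g) / of_nat N" "M f (h (Suc n)) = M (pderiv f) (h n) / of_nat N"
  using N by (simp_all add: scaled_hermite.simps(2) planar_moment_diff planar_moment_smult planar_moment_pCons[OF vw_pos] vw_sum a_def)

lemma moment_hermite: "M (h n) (h m) = (if n = m then H n else 0)"
proof (induction n arbitrary: m)
  case 0
  show ?case
  proof (cases m)
    case (Suc k)
    then show ?thesis
      by (simp add: moment_hermite_Suc(2) planar_moment_0 pderiv_1)
  qed simp
next
  case (Suc n)
  show ?case
  proof (cases m)
    case 0
    then show ?thesis
      by (simp add: moment_hermite_Suc(1) planar_moment_0 pderiv_1)
  next
    case (Suc k)
    show ?thesis
      unfolding Suc moment_hermite_Suc(1) pderiv_scaled_hermite planar_moment_smult Suc.IH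
      by (simp add: mult_ac del: of_nat_Suc)
  qed
qed

text \<open>The skew form of the ensemble without the factor \<open>1 / pi\<close> of the area
  measure: the weight contributes the difference of the point and its conjugate.\<close>

definition "S f g = M (pCons 0 f) g - M f (pCons 0 g)"

lemma S_eq: "S f g = of_real ((1 - \<tau>) / real N) * (M f (pderiv g) - M (pderiv f) g)"
proof -
  have "(1 - \<tau>) / real N = 2 * w" using N by (simp add: w_def field_simps)
  then have "complex_of_real ((1 - \<tau>) / real N) = 2 * of_real w" by simp
  then show ?thesis
    unfolding S_def planar_moment_parts_y[OF vw_pos] by (simp only:) (simp add: algebra_simps)
qed

lemma S_linear:
  "S (f + f') g = S f g + S f' g" "S f (g + g') = S f g + S f g'"
  "S (smult c f) g = c * S f g" "S f (smult c g) = c * S f g"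
  unfolding S_eq by (simp_all add: planar_moment_add[OF vw_pos] planar_moment_smult pderiv_add pderiv_smult algebra_simps)

text \<open>By parts the skew form only differentiates one of its arguments, and differentiation
  lowers a Hermite polynomial by one degree. Orthogonality then leaves adjacent degrees
  only.\<close>

lemma S_hermite:
  "S (h m) (h n) = of_real ((1 - \<tau>) / real N) *
     (if n = Suc m then of_nat n * H m else if m = Suc n then - of_nat m * H n else 0)"
proof -
  have "M f (pderiv (h n)) = (if n = 0 then 0 else of_nat n * M f (h (n - 1)))"
    "M (pderiv (h n)) f = (if n = 0 then 0 else of_nat n * M (h (n - 1)) f)" for f n
    by (cases n; simp only: pderiv_scaled_hermite; simp add: planar_moment_0 planar_moment_smult pderiv_1)+
  then show ?thesis
    unfolding S_eq by (auto simp: moment_hermite simp del: of_nat_Suc scaled_hermite.simps(1))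
qed

lemma S_hermite_same_parity:
  assumes "even m \<longleftrightarrow> even n"
  shows "S (h m) (h n) = 0"
  unfolding S_hermite using assms by auto

text \<open>The value arises as \<open>(1 - \<tau>) / N\<close> from integration by parts, times
  \<open>2 * m + 1\<close> from the derivative, times the norm \<open>H (2 * m)\<close>.\<close>

definition "norm_const m = of_real (1 - \<tau>) * fact (Suc (2 * m)) / of_nat N ^ Suc (2 * m) * M 1 1"

abbreviation "q \<equiv> skew_hermite a (real N)"
abbreviation "e \<equiv> even_skew_hermite a (real N)"

lemma S_even_even: "S (e i) (e j) = 0"
proof -
  have 1: "S (e i) (h (2 * j)) = 0" for i j
  proof (induction i)
    case 0
    show ?case using S_hermite_same_parity[of 0 "2 * j"] by simp
  next
    case (Suc i)
    then show ?case
      using S_hermite_same_parity[of "2 * Suc i" "2 * j"] by (simp add: S_linear del: mult_Suc_right)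
  qed
  show ?thesis
  proof (induction j)
    case 0
    show ?case using 1[of i 0] by simp
  next
    case (Suc j)
    then show ?case
      using 1[of i "Suc j"] by (simp add: S_linear del: mult_Suc_right)
  qed
qed

lemma S_hermite_even_odd:
  "S (h (2 * i)) (h (Suc (2 * j))) =
     (if i = j then norm_const i else if i = Suc j then - (of_nat (2 * i) / of_nat N * norm_const j) else 0)" (is ?A)
  "S (h (Suc (2 * j))) (h (2 * i)) =
     (if i = j then - norm_const i else if i = Suc j then of_nat (2 * i) / of_nat N * norm_const j else 0)" (is ?B)
proof -
  have val1: "of_real ((1 - \<tau>) / real N) * (of_nat (Suc (2 * k)) * H (2 * k)) = norm_const k" for k
    unfolding norm_const_def by (simp add: mult_ac del: of_nat_Suc)
  have val2: "of_real ((1 - \<tau>) / real N) * (c * H (Suc (2 * k))) = c / of_nat N * norm_const k" for c k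
    unfolding norm_const_def by (simp add: mult_ac del: of_nat_Suc fact_Suc)
  have ne: "Suc (2 * j) \<noteq> Suc (2 * Suc j)" "2 * Suc j = Suc (Suc (2 * j))" "2 * j \<noteq> Suc (Suc (2 * j))"
    "Suc (Suc (2 * j)) \<noteq> Suc (2 * Suc (Suc j))"
    by simp_all
  consider "i = j" | "i = Suc j" | "i \<noteq> j" "i \<noteq> Suc j" by blast
  then have "?A \<and> ?B"
  proof cases
    case 1
    show "?A \<and> ?B"
      unfolding S_hermite 1 using val1[of j] ne(3) by (auto simp del: of_nat_Suc)
  next
    case 2
    have "S (h (2 * i)) (h (Suc (2 * j))) = - (of_real ((1 - \<tau>) / real N) * (of_nat (2 * Suc j) * H (Suc (2 * j))))"
      "S (h (Suc (2 * j))) (h (2 * i)) = of_real ((1 - \<tau>) / real N) * (of_nat (2 * Suc j) * H (Suc (2 * j)))"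
      unfolding S_hermite 2 using ne by (simp_all del: of_nat_Suc mult_Suc_right fact_Suc)
    then show "?A \<and> ?B"
      unfolding val2 2 by simp
  next
    case 3
    then have "Suc (2 * j) \<noteq> Suc (2 * i)" "2 * i \<noteq> Suc (Suc (2 * j))" by auto
    then show "?A \<and> ?B"
      unfolding S_hermite using 3 by auto
  qed
  then show ?A ?B by blast+
qed

text \<open>In the step from \<open>i\<close> to \<open>Suc i\<close> the new Hermite polynomial
  meets the odd degrees directly below and above it. The lower product is cancelled by the multiple
  of the previous even polynomial; the upper one is the new skew norm.\<close>

lemma S_even_odd:
  "S (e i) (h (Suc (2 * j))) = (if i = j then norm_const i else 0) \<and>
   S (h (Suc (2 * j))) (e i) = (if i = j then - norm_const i else 0)"
proof (induction i)
  case 0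
  show ?case using S_hermite_even_odd(1)[of 0 j] S_hermite_even_odd(2)[of j 0] by simp
next
  case (Suc i)
  then show ?case
    using S_hermite_even_odd(1)[of "Suc i" j] S_hermite_even_odd(2)[of j "Suc i"]
    by (auto simp: S_linear simp del: mult_Suc_right of_nat_mult of_nat_Suc)
qed

lemma S_skew_hermite: "S (q k) (q l) = skew_block norm_const k l"
proof -
  obtain i where k: "k = 2 * i \<or> k = Suc (2 * i)" by (metis evenE oddE Suc_eq_plus1)
  obtain j where l: "l = 2 * j \<or> l = Suc (2 * j)" by (metis evenE oddE Suc_eq_plus1)
  have "S (h (Suc (2 * i))) (h (Suc (2 * j))) = 0"
    by (rule S_hermite_same_parity) simp
  then show ?thesis
    using k l S_even_even[of i j] S_even_odd[of i j] S_even_odd[of j i]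
    by (auto simp: skew_hermite_simps skew_block_def)
qed

text \<open>The quadratic form of the potential is diagonal in real and imaginary parts, and
  \<open>1 - \<tau>\<^sup>2 = (1 + \<tau>) * (1 - \<tau>)\<close> cancels one factor in each
  term.\<close>

lemma exp_elliptic_potential:
  "complex_of_real (exp (- real N * elliptic_potential \<tau> (Complex x y))) = gauss_exp v 0 x * gauss_exp w 0 y"
proof -
  have nz: "1 + \<tau> \<noteq> 0" "1 - \<tau> \<noteq> 0" "real N \<noteq> 0" using \<tau> N by auto
  have "1 - \<tau>\<^sup>2 = (1 + \<tau>) * (1 - \<tau>)" by (simp add: power2_eq_square algebra_simps)
  moreover have "(cmod (Complex x y))\<^sup>2 - \<tau> * Re ((Complex x y)\<^sup>2) = (1 - \<tau>) * x\<^sup>2 + (1 + \<tau>) * y\<^sup>2"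
    unfolding cmod_power2 by (simp add: power2_eq_square algebra_simps)
  ultimately have "elliptic_potential \<tau> (Complex x y) = x\<^sup>2 / (1 + \<tau>) + y\<^sup>2 / (1 - \<tau>)"
    unfolding elliptic_potential_def using nz by (simp add: divide_simps)
  moreover have "x\<^sup>2 / (2 * v) = real N * (x\<^sup>2 / (1 + \<tau>))" "y\<^sup>2 / (2 * w) = real N * (y\<^sup>2 / (1 - \<tau>))"
  proof -
    have "2 * v = (1 + \<tau>) / real N" "2 * w = (1 - \<tau>) / real N"
      using N by (simp_all add: v_def w_def field_simps)
    then show "x\<^sup>2 / (2 * v) = real N * (x\<^sup>2 / (1 + \<tau>))" "y\<^sup>2 / (2 * w) = real N * (y\<^sup>2 / (1 - \<tau>))"
      by simp_all
  qed
  ultimately have "- real N * elliptic_potential \<tau> (Complex x y) = - (x\<^sup>2 / (2 * v)) + - (y\<^sup>2 / (2 * w))"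
    by (simp only:) (simp add: algebra_simps)
  then show ?thesis
    unfolding gauss_exp_def mult_exp_exp by (simp flip: exp_of_real)
qed

lemma pair_weight_elliptic:
  "pair_weight (elliptic_potential \<tau>) N (Complex x y) =
    (Complex x y - cnj (Complex x y)) * (gauss_exp v 0 x * gauss_exp w 0 y)"
  unfolding pair_weight_def exp_elliptic_potential ..

lemma has_bochner_integral_skew_hermite:
  "has_bochner_integral area_measure
     (\<lambda>z. poly (q k) z * poly (q l) (cnj z) * pair_weight (elliptic_potential \<tau>) N z)
     (skew_block (\<lambda>m. norm_const m / of_real pi) k l)"
proof -
  let ?F = "\<lambda>z. poly (q k) z * poly (q l) (cnj z) * pair_weight (elliptic_potential \<tau>) N z"
  note int = integrable_planar_gauss[OF vw_pos]
  have eq: "(\<lambda>(x, y). ?F (Complex x y)) =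
      (\<lambda>p. planar_gauss v w (pCons 0 (q k)) (q l) p - planar_gauss v w (q k) (pCons 0 (q l)) p)"
    by (rule ext) (simp add: case_prod_unfold planar_gauss_def pair_weight_elliptic algebra_simps)
  have "continuous_on UNIV ?F"
    unfolding pair_weight_def elliptic_potential_def by (intro continuous_intros)
  then have "?F \<in> borel_measurable borel" by (rule borel_measurable_continuous_onI)
  moreover have "integrable (lborel \<Otimes>\<^sub>M lborel) (\<lambda>(x, y). ?F (Complex x y))"
    unfolding eq by (intro Bochner_Integration.integrable_diff int)
  ultimately have "has_bochner_integral area_measure ?F ((\<integral>(x, y). ?F (Complex x y) \<partial>(lborel \<Otimes>\<^sub>M lborel)) / of_real pi)"
    by (intro has_bochner_integral_area_measure)
  also have "(\<integral>(x, y). ?F (Complex x y) \<partial>(lborel \<Otimes>\<^sub>M lborel)) = S (q k) (q l)"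
    unfolding eq S_def planar_moment_def by (intro Bochner_Integration.integral_diff int)
  also have "\<dots> / of_real pi = skew_block (\<lambda>m. norm_const m / of_real pi) k l"
    unfolding S_skew_hermite by (simp add: skew_block_def)
  finally show ?thesis .
qed

lemma norm_const_eq:
  "norm_const m / of_real pi = of_real ((1 - \<tau>) * sqrt (1 - \<tau>\<^sup>2) * fact (Suc (2 * m)) / real N ^ (2 * m + 2))"
proof -
  have "1 - \<tau>\<^sup>2 = (1 + \<tau>) * (1 - \<tau>)" by (simp add: power2_eq_square algebra_simps)
  then have "v * w = (1 - \<tau>\<^sup>2) / (2 * real N)\<^sup>2"
    by (simp add: v_def w_def power2_eq_square)
  then have "sqrt v * sqrt w = sqrt (1 - \<tau>\<^sup>2) / (2 * real N)"
    using real_sqrt_unique[of "2 * real N" "(2 * real N)\<^sup>2"]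
    by (simp only: real_sqrt_mult[symmetric] real_sqrt_divide)
  then have "M 1 1 = of_real (pi * sqrt (1 - \<tau>\<^sup>2) / real N)"
    unfolding planar_moment_1[OF vw_pos] by (simp add: mult.assoc)
  then show ?thesis unfolding norm_const_def by (simp only:) (simp add: mult_ac del: fact_Suc)
qed

end


section \<open>The Hermite polynomials at the edge\<close>

text \<open>Both sides satisfy the same three-term recursion, for the integral by Gaussian
  integration by parts, and agree in degree zero. The abscissa \<open>r\<close> is free: it will be
  placed near the saddle, and its arbitrariness later replaces a contour shift.\<close>

lemma scaled_hermite_eq_integral:
  fixes a r :: real
  assumes "a > 0"
  shows "poly (scaled_hermite (of_real a) n) z =
    (\<integral>s. (of_real r + \<i> * of_real s) ^ n * exp ((of_real r + \<i> * of_real s - z)\<^sup>2 / (2 * of_real a)) \<partial>lborel) /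
      of_real (sqrt (2 * pi * a))"
proof -
  define \<beta> where "\<beta> = \<i> * (of_real r - z) / of_real a"
  define I where "I n = (\<integral>s. poly ([:of_real r, \<i>:] ^ n) (of_real s) * gauss_exp a \<beta> s \<partial>lborel)" for n
  define E where "E = exp ((of_real r - z)\<^sup>2 / (2 * of_real a))"
  note int = integrable_poly_gauss_exp[OF assms]
  \<comment> \<open>Integration by parts applied to the \<open>n\<close>-th power of the line
    variable. For \<open>n = 0\<close> the truncated index is harmless because its coefficient is
    zero.\<close>
  have step: "I (Suc n) = z * I n - of_real a * of_nat n * I (n - 1)" for n
  proof -
    have "(\<integral>s. poly (pderiv ([:of_real r, \<i>:] ^ n)) (of_real s) * gauss_exp a \<beta> s \<partial>lborel) = \<i> * of_nat n * I (n - 1)"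
    proof (cases n)
      case (Suc k)
      have "pderiv ([:of_real r, \<i>:] ^ n) = smult (\<i> * of_nat n) ([:of_real r, \<i>:] ^ k)"
        unfolding Suc pderiv_power_Suc by (simp add: pderiv_pCons mult.commute del: of_nat_Suc)
      then have "(\<lambda>s. poly (pderiv ([:of_real r, \<i>:] ^ n)) (of_real s) * gauss_exp a \<beta> s) =
          (\<lambda>s. (\<i> * of_nat n) * (poly ([:of_real r, \<i>:] ^ k) (of_real s) * gauss_exp a \<beta> s))"
        by (simp add: mult_ac)
      then show ?thesis unfolding I_def Suc by simp
    qed (simp add: pderiv_1)
    moreover have "[:- \<beta>, 1 / of_real a:] * [:of_real r, \<i>:] ^ n =
        smult (- \<i> / of_real a) ([:of_real r, \<i>:] ^ Suc n - smult z ([:of_real r, \<i>:] ^ n))"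
    proof -
      have "[:- \<beta>, 1 / of_real a:] = smult (- \<i> / of_real a) ([:of_real r, \<i>:] - [:z:])"
        by (simp add: \<beta>_def algebra_simps)
      then show ?thesis
        by (simp only: mult_smult_left left_diff_distrib power_Suc) simp
    qed
    then have "(\<lambda>s. poly ([:- \<beta>, 1 / of_real a:] * [:of_real r, \<i>:] ^ n) (of_real s) * gauss_exp a \<beta> s) =
       (\<lambda>s. (- \<i> / of_real a) * (poly ([:of_real r, \<i>:] ^ Suc n) (of_real s) * gauss_exp a \<beta> s -
          z * (poly ([:of_real r, \<i>:] ^ n) (of_real s) * gauss_exp a \<beta> s)))"
      by (simp only: poly_smult poly_diff) (simp only: mult.assoc left_diff_distrib)
    then have "(\<integral>s. poly ([:- \<beta>, 1 / of_real a:] * [:of_real r, \<i>:] ^ n) (of_real s) * gauss_exp a \<beta> s \<partial>lborel) =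
       (- \<i> / of_real a) * (I (Suc n) - z * I n)"
      unfolding I_def
      by (simp only: integral_mult_right_zero Bochner_Integration.integral_diff[OF int integrable_mult_right[OF int]])
    ultimately have "\<i> * of_nat n * I (n - 1) = (- \<i> / of_real a) * (I (Suc n) - z * I n)"
      using integral_pderiv_gauss_exp[OF assms, of "[:of_real r, \<i>:] ^ n" \<beta>] by simp
    then have "\<i> * (of_real a * of_nat n * I (n - 1)) = \<i> * (z * I n - I (Suc n))"
      using assms by (simp add: field_simps)
    then have "of_real a * of_nat n * I (n - 1) = z * I n - I (Suc n)"
      by (simp only: mult_cancel_left) simp
    then show ?thesis by (simp add: algebra_simps)
  qed
  have base: "E * I 0 = of_real (sqrt (2 * pi * a))"
  proof -
    define X where "X = (of_real r - z)\<^sup>2 / (2 * of_real a)"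
    have "\<beta>\<^sup>2 * of_real a / 2 = - X"
      using assms by (simp add: X_def \<beta>_def power_mult_distrib power_divide field_simps power2_eq_square)
    then have "I 0 = of_real (sqrt (2 * pi * a)) * exp (- X)"
      using integral_gauss_exp[OF assms, of \<beta>] by (simp add: I_def)
    moreover have "E = exp X" by (simp add: E_def X_def)
    ultimately show ?thesis by (simp add: exp_minus)
  qed
  have "poly (scaled_hermite (of_real a) n) z * of_real (sqrt (2 * pi * a)) = E * I n \<and>
        poly (scaled_hermite (of_real a) (Suc n)) z * of_real (sqrt (2 * pi * a)) = E * I (Suc n)"
  proof (induction n)
    case 0
    show ?case using base step[of 0] by (simp add: scaled_hermite.simps(2) pderiv_1)
  next
    case (Suc n)
    then show ?case
    proof -
      let ?s = "complex_of_real (sqrt (2 * pi * a))" and ?p = "\<lambda>n. poly (scaled_hermite (of_real a) n) z"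
      have "?p (Suc (Suc n)) * ?s = z * (?p (Suc n) * ?s) - of_real a * of_nat (Suc n) * (?p n * ?s)"
        by (simp only: scaled_hermite_Suc_Suc left_diff_distrib mult.assoc)
      also have "\<dots> = E * (z * I (Suc n) - of_real a * of_nat (Suc n) * I n)"
        using Suc by (simp only:) (simp only: right_diff_distrib mult_ac)
      also have "z * I (Suc n) - of_real a * of_nat (Suc n) * I n = I (Suc (Suc n))"
        using step[of "Suc n"] by simp
      finally show ?thesis using Suc by blast
    qed
  qed
  moreover have "E * I n = (\<integral>s. (of_real r + \<i> * of_real s) ^ n * exp ((of_real r + \<i> * of_real s - z)\<^sup>2 / (2 * of_real a)) \<partial>lborel)"
  proof -
    have "E * gauss_exp a \<beta> s = exp ((of_real r + \<i> * of_real s - z)\<^sup>2 / (2 * of_real a))" for s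
    proof -
      have "(of_real r - z)\<^sup>2 / (2 * of_real a) + (\<beta> * of_real s - of_real (s\<^sup>2 / (2 * a))) =
          (of_real r + \<i> * of_real s - z)\<^sup>2 / (2 * of_real a)"
        using assms by (simp add: \<beta>_def field_simps power2_eq_square)
      then show ?thesis unfolding E_def gauss_exp_def by (simp flip: exp_add)
    qed
    then have "E * (poly ([:of_real r, \<i>:] ^ n) (of_real s) * gauss_exp a \<beta> s) =
        (of_real r + \<i> * of_real s) ^ n * exp ((of_real r + \<i> * of_real s - z)\<^sup>2 / (2 * of_real a))" for s
      by (simp only: mult.left_commute[of E]) (simp add: poly_power mult.commute[of \<i>])
    then show ?thesis
      by (simp only: I_def integral_mult_right_zero[symmetric])
  qed
  ultimately show ?thesis using assms by (simp add: field_simps)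
qed

text \<open>The bound has to be exact up to second order: it is raised to a power of order
  \<open>N\<close>, and the first two orders must cancel the large terms in the exponent of
  \<open>edge_phase\<close>.\<close>

lemma one_plus_le_exp_cubic:
  fixes x :: real
  assumes "x \<ge> 0"
  shows "1 + x \<le> exp (x - x\<^sup>2 / 2 + x ^ 3 / 3)"
proof -
  have "0 - 0\<^sup>2 / 2 + 0 ^ 3 / 3 - ln (1 + 0) \<le> x - x\<^sup>2 / 2 + x ^ 3 / 3 - ln (1 + x)"
  proof (rule DERIV_nonneg_imp_nondecreasing[OF assms])
    fix y :: real assume y: "0 \<le> y" "y \<le> x"
    have "((\<lambda>x. x - x\<^sup>2 / 2 + x ^ 3 / 3 - ln (1 + x)) has_real_derivative 1 - y + y\<^sup>2 - 1 / (1 + y)) (at y)"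
      using y by (auto intro!: derivative_eq_intros simp: field_simps power2_eq_square)
    moreover have "1 - y + y\<^sup>2 - 1 / (1 + y) = y ^ 3 / (1 + y)"
      using y by (simp add: field_simps power2_eq_square power3_eq_cube)
    ultimately show "\<exists>D. ((\<lambda>x. x - x\<^sup>2 / 2 + x ^ 3 / 3 - ln (1 + x)) has_real_derivative D) (at y) \<and> 0 \<le> D"
      using y by (intro exI[of _ "y ^ 3 / (1 + y)"]) simp
  qed
  then have "ln (1 + x) \<le> x - x\<^sup>2 / 2 + x ^ 3 / 3" by simp
  then show ?thesis using assms by (metis add_pos_nonneg exp_le_cancel_iff exp_ln zero_less_one)
qed

text \<open>The remainder has derivative \<open>- (u ^ 3) / (1 + u)\<close>, and
  \<open>norm (1 + u)\<close> is at least one half on the disc; the mean value inequality supplies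
  the fourth power.\<close>

lemma Ln_cubic_bound:
  assumes "norm w \<le> 1 / 2"
  shows "norm (Ln (1 + w) - w + w\<^sup>2 / 2 - w ^ 3 / 3) \<le> 2 * norm w ^ 4"
proof -
  let ?f = "\<lambda>u. Ln (1 + u) - u + u\<^sup>2 / 2 - u ^ 3 / 3"
  have "norm (?f w - ?f 0) \<le> 2 * norm w ^ 3 * norm (w - 0)"
  proof (rule field_differentiable_bound[of "cball (0 :: complex) (norm w)"])
    fix u :: complex assume u: "u \<in> cball 0 (norm w)"
    then have nu: "norm u \<le> norm w" by simp
    have "norm (1 + u) \<ge> 1 - norm u" using norm_triangle_ineq2[of 1 "- u"] by simp
    then have n1: "norm (1 + u) \<ge> 1 / 2" using nu assms by linarith
    have "1 + Re u > 0" using abs_Re_le_cmod[of u] nu assms by linarith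
    then have "1 + u \<notin> \<real>\<^sub>\<le>\<^sub>0" by (auto simp: complex_nonpos_Reals_iff)
    moreover have ne: "1 + u \<noteq> 0" using n1 by auto
    ultimately have "((\<lambda>u. Ln (1 + u)) has_field_derivative 1 / (1 + u)) (at u)"
      by (auto intro!: derivative_eq_intros simp: inverse_eq_divide)
    moreover have "((\<lambda>u::complex. - u + u\<^sup>2 / 2 - u ^ 3 / 3) has_field_derivative - 1 + u - u\<^sup>2) (at u)"
      by (rule derivative_eq_intros refl | simp)+
    ultimately have "((\<lambda>u. Ln (1 + u) + (- u + u\<^sup>2 / 2 - u ^ 3 / 3)) has_field_derivative 1 / (1 + u) + (- 1 + u - u\<^sup>2)) (at u)"
      by (rule DERIV_add)
    moreover have "(\<lambda>u. Ln (1 + u) + (- u + u\<^sup>2 / 2 - u ^ 3 / 3)) = ?f"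
      by (rule ext) simp
    ultimately have "(?f has_field_derivative 1 / (1 + u) + (- 1 + u - u\<^sup>2)) (at u)"
      by (simp only:)
    moreover have "1 / (1 + u) + (- 1 + u - u\<^sup>2) = - (u ^ 3) / (1 + u)"
      using ne by (simp add: field_simps power2_eq_square power3_eq_cube)
    ultimately show "(?f has_field_derivative - (u ^ 3) / (1 + u)) (at u within cball 0 (norm w))"
      by (simp only: has_field_derivative_at_within)
    have "norm (- (u ^ 3) / (1 + u)) = norm u ^ 3 / norm (1 + u)"
      by (simp add: norm_divide norm_power)
    also have "\<dots> \<le> norm w ^ 3 / (1 / 2)"
      using nu n1 by (intro frac_le power_mono) auto
    finally show "norm (- (u ^ 3) / (1 + u)) \<le> 2 * norm w ^ 3" by simp
  qed auto
  then show ?thesis by (simp add: power_Suc mult_ac numeral_eq_Suc)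
qed

section \<open>Rescaling at the edge\<close>

definition edge_scale :: "nat \<Rightarrow> real" where
  "edge_scale N = (2 * real N) powr (1 / 3)"

lemma edge_scale_pos: "N > 0 \<Longrightarrow> edge_scale N > 0"
  by (simp add: edge_scale_def)

lemma edge_scale_cube: "N > 0 \<Longrightarrow> edge_scale N ^ 3 = 2 * real N"
  unfolding edge_scale_def by (simp flip: powr_realpow add: powr_powr)

lemma filterlim_edge_scale: "filterlim edge_scale at_top sequentially"
  unfolding edge_scale_def by real_asymp

definition edge_tau :: "real \<Rightarrow> nat \<Rightarrow> real" where
  "edge_tau c N = 1 - c\<^sup>2 / edge_scale N"

lemma edge_tau_tendsto: "edge_tau c \<longlonglongrightarrow> 1"
proof -
  have "(\<lambda>N. c\<^sup>2 / edge_scale N) \<longlonglongrightarrow> 0"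
    by (rule tendsto_divide_0[OF tendsto_const filterlim_at_top_imp_at_infinity[OF filterlim_edge_scale]])
  then show ?thesis
    unfolding edge_tau_def[abs_def] using tendsto_diff[OF tendsto_const, of _ 0 sequentially 1] by force
qed

text \<open>The Hermite integrand of degree \<open>2 * N\<close> times the weight factor at
  \<open>u = sqrt 2 * (1 + t / m)\<close>, without the constants \<open>2 ^ N\<close> and
  \<open>exp (- N)\<close>. As \<open>2 * N = m ^ 3\<close>, the power expands to the exponent
  \<open>m\<^sup>2 * t - m * t\<^sup>2 / 2 + t ^ 3 / 3\<close> plus lower order, and the explicit
  terms remove the first two.\<close>

definition edge_phase :: "real \<Rightarrow> nat \<Rightarrow> complex \<Rightarrow> complex \<Rightarrow> complex" where
  "edge_phase c N z t = (1 + t / of_real (edge_scale N)) ^ (2 * N) *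
     exp (- of_real ((edge_scale N)\<^sup>2) * t + of_real (edge_scale N) * t\<^sup>2 / 2 +
       (of_real (c\<^sup>2) * t\<^sup>2 / 2 - of_real (c * sqrt 2 * sqrt (1 + edge_tau c N)) * t * z + z\<^sup>2) / of_real (edge_tau c N))"

definition edge_integral :: "real \<Rightarrow> real \<Rightarrow> nat \<Rightarrow> nat \<Rightarrow> complex \<Rightarrow> complex" where
  "edge_integral c \<alpha> N j z = (\<integral>\<theta>. edge_phase c N z (of_real \<alpha> + \<i> * of_real \<theta>) /
     (1 + (of_real \<alpha> + \<i> * of_real \<theta>) / of_real (edge_scale N)) ^ j \<partial>lborel)"

text \<open>The scale \<open>\<gamma>\<close> of the process with
  \<open>1 - \<tau> = c\<^sup>2 / m\<close> and \<open>N = m ^ 3 / 2\<close> inserted, which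
  displays its order \<open>1 / m\<^sup>2\<close>. The agreement with the square root form is
  \<open>zoom_eq\<close>.\<close>

definition edge_zoom :: "real \<Rightarrow> nat \<Rightarrow> real" where
  "edge_zoom c N = 2 * c * sqrt (1 + edge_tau c N) / (edge_scale N)\<^sup>2"

text \<open>Only the right edge is parametrised; the left edge is reached at the end by the parity
  of the kernel.\<close>

definition edge_point :: "real \<Rightarrow> nat \<Rightarrow> complex \<Rightarrow> complex" where
  "edge_point c N z = of_real (sqrt 2 * (1 + edge_tau c N)) + of_real (edge_zoom c N) * z"

text \<open>
  The holomorphic \<open>h\<close> for which \<open>exp (- N Q) = exp (- 2 (cmod z)\<^sup>2) * h z * h (cnj z)\<close> at the point
  with rescaled coordinate \<open>z\<close>.
\<close>

definition edge_factor :: "real \<Rightarrow> nat \<Rightarrow> complex \<Rightarrow> complex" where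
  "edge_factor c N z = (let \<tau> = edge_tau c N; p = sqrt 2 * (1 + \<tau>) in
     exp (- of_real (real N / (1 - \<tau>\<^sup>2)) * (of_real (p\<^sup>2 / 2) + of_real (p * edge_zoom c N) * z -
       of_real \<tau> * (edge_point c N z)\<^sup>2 / 2)))"

locale edge_regime =
  fixes c :: real and N :: nat and \<tau> m g :: real
  assumes c: "c > 0" and N: "N > 0" and \<tau>_pos: "edge_tau c N > 0"
  defines "\<tau> \<equiv> edge_tau c N" and "m \<equiv> edge_scale N" and "g \<equiv> edge_zoom c N"
begin

lemma m: "m > 0" "real N = m ^ 3 / 2" "c\<^sup>2 = (1 - \<tau>) * m"
  using edge_scale_pos[OF N] edge_scale_cube[OF N] by (simp_all add: m_def \<tau>_def edge_tau_def)

lemma \<tau>: "0 < \<tau>" "\<tau> < 1"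
proof -
  show "0 < \<tau>" using \<tau>_pos by (simp add: \<tau>_def)
  have "c\<^sup>2 > 0" using c by simp
  then show "\<tau> < 1" using m by (simp add: zero_less_mult_iff)
qed

lemma g_eq: "g * m\<^sup>2 = 2 * c * sqrt (1 + \<tau>)"
  using m(1) by (simp add: g_def edge_zoom_def m_def \<tau>_def)

lemma g_square: "real N * g\<^sup>2 = 2 * (1 - \<tau>\<^sup>2)"
proof -
  have "g = 2 * c * sqrt (1 + \<tau>) / m\<^sup>2" using g_eq m(1) by (simp add: field_simps)
  then have "g\<^sup>2 = 4 * ((1 - \<tau>) * m) * (1 + \<tau>) / m ^ 4"
    using \<tau> by (simp add: power_divide power_mult_distrib m(3) flip: power_mult)
  then have "real N * g\<^sup>2 = m ^ 3 / 2 * (4 * ((1 - \<tau>) * m) * (1 + \<tau>) / m ^ 4)" by (simp add: m(2))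
  also have "\<dots> = 2 * ((1 - \<tau>) * (1 + \<tau>))"
    using m(1) by (simp add: field_simps numeral_eq_Suc)
  finally show ?thesis by (simp add: power2_eq_square algebra_simps)
qed

lemma g_pos: "g > 0"
  using c m(1) \<tau> by (simp add: g_def edge_zoom_def m_def[symmetric] \<tau>_def[symmetric])

lemma zoom_eq: "edge_zoom c N = sqrt (2 * (1 - (edge_tau c N)\<^sup>2) / real N)"
proof -
  have "g\<^sup>2 = 2 * (1 - \<tau>\<^sup>2) / real N" using g_square N by (simp add: field_simps)
  then show ?thesis using g_pos unfolding g_def \<tau>_def by (metis less_eq_real_def real_sqrt_unique)
qed

text \<open>The expansion point \<open>sqrt 2\<close> is the saddle for
  \<open>p = sqrt 2 * (1 + \<tau>)\<close>. Hence all constants of order \<open>N\<close> collapse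
  to \<open>- N\<close>, the terms linear in \<open>z\<close> alone cancel, and \<open>z\<close>
  couples to \<open>t\<close> with a bounded coefficient.\<close>

lemma exponent_identity:
  fixes z t :: complex
  defines "p \<equiv> sqrt 2 * (1 + \<tau>)"
  shows "- of_real (real N / (1 - \<tau>\<^sup>2)) * (of_real (p\<^sup>2 / 2) + of_real (p * g) * z - of_real \<tau> * (of_real p + of_real g * z)\<^sup>2 / 2) +
     of_real (real N / (2 * \<tau>)) * (of_real (sqrt 2) * (1 + t / of_real m) - (of_real p + of_real g * z))\<^sup>2 =
     - of_real (real N) + (- of_real (m\<^sup>2) * t + of_real m * t\<^sup>2 / 2 +
       (of_real (c\<^sup>2) * t\<^sup>2 / 2 - of_real (c * sqrt 2 * sqrt (1 + \<tau>)) * t * z + z\<^sup>2) / of_real \<tau>)"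
proof -
  \<comment> \<open>All real constants become complex letters, which reduces the claim to rational
    algebra modulo the relations \<open>q\<close>, \<open>nG\<close>, \<open>n\<close>,
    \<open>G\<mu>\<close> and \<open>c2\<close> below.\<close>
  define T where "T = complex_of_real \<tau>"
  define n where "n = complex_of_real (real N)"
  define q where "q = complex_of_real (sqrt 2)"
  define G where "G = complex_of_real g"
  define \<mu> where "\<mu> = complex_of_real m"
  define C where "C = complex_of_real (c * sqrt (1 + \<tau>))"
  define y where "y = t / \<mu>"
  have \<mu>: "\<mu> \<noteq> 0" using m(1) by (simp add: \<mu>_def)
  have T: "T \<noteq> 0" "1 - T \<noteq> 0" "1 + T \<noteq> 0"
    using \<tau> by (auto simp: T_def complex_eq_iff)
  have T2: "1 - T\<^sup>2 = (1 - T) * (1 + T)" by (simp add: power2_eq_square algebra_simps)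
  have q: "q\<^sup>2 = 2" unfolding q_def by (simp flip: of_real_power)
  have nG: "n * G\<^sup>2 = 2 * (1 - T\<^sup>2)"
    using arg_cong[OF g_square, of complex_of_real] by (simp add: n_def G_def T_def)
  have n: "n = \<mu> ^ 3 / 2" using arg_cong[OF m(2), of complex_of_real] by (simp add: n_def \<mu>_def)
  have G\<mu>: "G * \<mu>\<^sup>2 = 2 * C" using arg_cong[OF g_eq, of complex_of_real] by (simp add: G_def \<mu>_def C_def)
  have c2: "of_real (c\<^sup>2) = (1 - T) * \<mu>" using arg_cong[OF m(3), of complex_of_real] by (simp add: T_def \<mu>_def)
  have t: "t = y * \<mu>" using \<mu> by (simp add: y_def)
  have p: "complex_of_real p = q * (1 + T)" by (simp add: p_def q_def T_def)
  have lin: "n * G * y = C * t"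
  proof -
    have "n * G * y = (G * \<mu>\<^sup>2) * (\<mu> * y) / 2" unfolding n by (simp add: power2_eq_square power3_eq_cube)
    then show ?thesis unfolding G\<mu> t by simp
  qed
  have "- (n / (1 - T\<^sup>2)) * ((q * (1 + T))\<^sup>2 / 2 + q * (1 + T) * G * z - T * (q * (1 + T) + G * z)\<^sup>2 / 2) =
     - n * (1 + T) - n * q * G * z + T * z\<^sup>2"
  proof -
    have "(q * (1 + T))\<^sup>2 / 2 + q * (1 + T) * G * z - T * (q * (1 + T) + G * z)\<^sup>2 / 2 =
      (1 - T\<^sup>2) * ((1 + T) + q * G * z) - T * G\<^sup>2 * z\<^sup>2 / 2"
    proof -
      have "(q * (1 + T))\<^sup>2 = 2 * (1 + T)\<^sup>2" by (simp add: power_mult_distrib q)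
      moreover have "(q * (1 + T) + G * z)\<^sup>2 = (q * (1 + T))\<^sup>2 + 2 * (q * (1 + T)) * (G * z) + G\<^sup>2 * z\<^sup>2"
        by (simp add: power2_sum power_mult_distrib)
      ultimately show ?thesis unfolding T2
        by (simp only:) (simp add: power2_eq_square algebra_simps add_divide_distrib diff_divide_distrib)
    qed
    also have "- (n / (1 - T\<^sup>2)) * \<dots> = - n * ((1 + T) + q * G * z) + T * (n * G\<^sup>2) * z\<^sup>2 / (2 * (1 - T\<^sup>2))"
    proof -
      have "- (n / D) * (D * X - T * G\<^sup>2 * z\<^sup>2 / 2) = - n * X + T * (n * G\<^sup>2) * z\<^sup>2 / (2 * D)" if "D \<noteq> 0" for D X
        using that by (simp add: right_diff_distrib) (simp add: mult_ac)
      moreover have "1 - T\<^sup>2 \<noteq> 0" using T unfolding T2 by simp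
      ultimately show ?thesis by blast
    qed
    also have "T * (n * G\<^sup>2) * z\<^sup>2 / (2 * (1 - T\<^sup>2)) = T * z\<^sup>2"
      unfolding nG using T unfolding T2 by simp
    finally show ?thesis by (simp add: algebra_simps)
  qed
  moreover have "n / (2 * T) * (q * (1 + y) - (q * (1 + T) + G * z))\<^sup>2 =
     n * y\<^sup>2 / T - 2 * n * y + n * T - n * q * G * y * z / T + n * q * G * z + (1 - T\<^sup>2) * z\<^sup>2 / T"
  proof -
    have "(q * (1 + y) - (q * (1 + T) + G * z))\<^sup>2 = q\<^sup>2 * (y - T)\<^sup>2 - 2 * q * (y - T) * (G * z) + G\<^sup>2 * z\<^sup>2"
      by (simp add: power2_eq_square algebra_simps)
    then have "n / (2 * T) * (q * (1 + y) - (q * (1 + T) + G * z))\<^sup>2 =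
       n / (2 * T) * (2 * (y - T)\<^sup>2 - 2 * q * (y - T) * (G * z)) + (n * G\<^sup>2) * z\<^sup>2 / (2 * T)"
      by (simp only: q distrib_left) (simp add: mult_ac)
    then have e: "n / (2 * T) * (q * (1 + y) - (q * (1 + T) + G * z))\<^sup>2 =
       n / (2 * T) * (2 * (y - T)\<^sup>2 - 2 * q * (y - T) * (G * z)) + (2 * (1 - T\<^sup>2)) * z\<^sup>2 / (2 * T)"
      by (simp only: nG)
    show ?thesis unfolding e using T by (simp add: field_simps power2_eq_square)
  qed
  moreover have "- n * (1 + T) - n * q * G * z + T * z\<^sup>2 +
     (n * y\<^sup>2 / T - 2 * n * y + n * T - n * q * G * y * z / T + n * q * G * z + (1 - T\<^sup>2) * z\<^sup>2 / T) =
     - n - 2 * n * y + n * y\<^sup>2 / T - q * (n * G * y) * z / T + z\<^sup>2 / T"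
    using T by (simp add: field_simps power2_eq_square)
  moreover have "- n - 2 * n * y + n * y\<^sup>2 / T - q * (n * G * y) * z / T + z\<^sup>2 / T =
     - n + (- \<mu>\<^sup>2 * t + \<mu> * t\<^sup>2 / 2 + (((1 - T) * \<mu>) * t\<^sup>2 / 2 - (q * C) * t * z + z\<^sup>2) / T)"
  proof -
    have "2 * n * y = \<mu>\<^sup>2 * t" "n * y\<^sup>2 = \<mu> * t\<^sup>2 / 2"
      unfolding n t by (simp_all add: power2_eq_square power3_eq_cube)
    then show ?thesis unfolding lin using T by (simp add: field_simps)
  qed
  ultimately have main: "- (n / (1 - T\<^sup>2)) * ((q * (1 + T))\<^sup>2 / 2 + q * (1 + T) * G * z - T * (q * (1 + T) + G * z)\<^sup>2 / 2) +
    n / (2 * T) * (q * (1 + y) - (q * (1 + T) + G * z))\<^sup>2 =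
    - n + (- \<mu>\<^sup>2 * t + \<mu> * t\<^sup>2 / 2 + (((1 - T) * \<mu>) * t\<^sup>2 / 2 - (q * C) * t * z + z\<^sup>2) / T)"
    by (metis (no_types))
  have R: "of_real (c * sqrt 2 * sqrt (1 + \<tau>)) = q * C"
    "of_real (real N / (1 - \<tau>\<^sup>2)) = n / (1 - T\<^sup>2)" "of_real (real N / (2 * \<tau>)) = n / (2 * T)"
    "of_real (p\<^sup>2 / 2) = (q * (1 + T))\<^sup>2 / 2" "of_real (p * g) = q * (1 + T) * G" "of_real (m\<^sup>2) = \<mu>\<^sup>2"
    by (simp_all add: q_def C_def n_def T_def p_def G_def \<mu>_def)
  show ?thesis
    unfolding R p c2
    unfolding n_def[symmetric] T_def[symmetric] q_def[symmetric] G_def[symmetric] \<mu>_def[symmetric] y_def[symmetric]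
    by (rule main)
qed

text \<open>The vertical line through \<open>sqrt 2 * (1 + \<alpha> / m)\<close> is the one of steepest descent at the scale of the edge.\<close>

lemma hermite_at_edge:
  assumes "j \<le> 2 * N" and "\<alpha> > 0"
  shows "edge_factor c N z * poly (scaled_hermite (of_real (\<tau> / real N)) (2 * N - j)) (edge_point c N z) =
    of_real (sqrt (m / (2 * pi * \<tau>)) * 2 ^ N * exp (- real N) / sqrt 2 ^ j) * edge_integral c \<alpha> N j z"
proof -
  define K where "K = complex_of_real (2 ^ N * exp (- real N) / sqrt 2 ^ j)"
  define f where "f s = (of_real (sqrt 2 * (1 + \<alpha> / m)) + \<i> * of_real s) ^ (2 * N - j) *
     exp ((of_real (sqrt 2 * (1 + \<alpha> / m)) + \<i> * of_real s - edge_point c N z)\<^sup>2 / (2 * of_real (\<tau> / real N)))" for s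
  define J where "J \<theta> = edge_phase c N z (of_real \<alpha> + \<i> * of_real \<theta>) /
     (1 + (of_real \<alpha> + \<i> * of_real \<theta>) / of_real m) ^ j" for \<theta>
  have a: "\<tau> / real N > 0" using \<tau> N by simp
  have q: "(complex_of_real (sqrt 2)) ^ 2 = 2" by (simp flip: of_real_power)
  have pt: "edge_factor c N z * f (sqrt 2 / m * \<theta>) = K * J \<theta>" for \<theta>
  proof -
    define t where "t = complex_of_real \<alpha> + \<i> * of_real \<theta>"
    define v where "v = complex_of_real (sqrt 2) * (1 + t / of_real m)"
    have "1 + Re (t / of_real m) > 0" using m(1) assms(2) by (simp add: t_def add_pos_pos)
    then have ne: "1 + t / of_real m \<noteq> 0" by (auto simp: complex_eq_iff)
    have v: "complex_of_real (sqrt 2 * (1 + \<alpha> / m)) + \<i> * of_real (sqrt 2 / m * \<theta>) = v"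
      using m(1) by (simp add: v_def t_def field_simps)
    have "v ^ (2 * N - j) = v ^ (2 * N) / v ^ j"
      using ne assms by (simp add: v_def power_diff)
    also have "v ^ (2 * N) = 2 ^ N * (1 + t / of_real m) ^ (2 * N)"
      by (simp only: v_def power_mult_distrib power_mult q)
    also have "v ^ j = of_real (sqrt 2 ^ j) * (1 + t / of_real m) ^ j"
      by (simp only: v_def power_mult_distrib of_real_power)
    finally have vpow: "v ^ (2 * N - j) = 2 ^ N / of_real (sqrt 2 ^ j) * (1 + t / of_real m) ^ (2 * N) / (1 + t / of_real m) ^ j"
      by simp
    have expo: "edge_factor c N z * exp ((v - edge_point c N z)\<^sup>2 / (2 * of_real (\<tau> / real N))) =
       exp (- of_real (real N)) * exp (- of_real (m\<^sup>2) * t + of_real m * t\<^sup>2 / 2 +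
       (of_real (c\<^sup>2) * t\<^sup>2 / 2 - of_real (c * sqrt 2 * sqrt (1 + \<tau>)) * t * z + z\<^sup>2) / of_real \<tau>)"
    proof -
      have "(v - edge_point c N z)\<^sup>2 / (2 * of_real (\<tau> / real N)) = of_real (real N / (2 * \<tau>)) * (v - edge_point c N z)\<^sup>2"
        using \<tau> N by (simp add: field_simps)
      then show ?thesis
        unfolding edge_factor_def Let_def exp_add[symmetric]
        using exponent_identity[of z t] unfolding mult_exp_exp
        by (simp only: v_def edge_point_def \<tau>_def[symmetric] g_def[symmetric])
    qed
    have "edge_factor c N z * f (sqrt 2 / m * \<theta>) =
        v ^ (2 * N - j) * (edge_factor c N z * exp ((v - edge_point c N z)\<^sup>2 / (2 * of_real (\<tau> / real N))))"
      unfolding f_def v by (simp only: mult.left_commute)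
    also have "\<dots> = K * (edge_phase c N z t / (1 + t / of_real m) ^ j)"
      unfolding expo vpow edge_phase_def K_def m_def[symmetric] \<tau>_def[symmetric]
      by (simp add: exp_of_real[symmetric])
    finally show ?thesis unfolding J_def t_def .
  qed
  have "poly (scaled_hermite (of_real (\<tau> / real N)) (2 * N - j)) (edge_point c N z) =
      (\<integral>s. f s \<partial>lborel) / of_real (sqrt (2 * pi * (\<tau> / real N)))"
    unfolding f_def by (rule scaled_hermite_eq_integral[OF a])
  \<comment> \<open>The line variable is scaled in accordance with
    \<open>u = sqrt 2 * (1 + t / m)\<close> and
    \<open>t = \<alpha> + \<i> * \<theta>\<close>.\<close>
  also have "(\<integral>s. f s \<partial>lborel) = of_real (sqrt 2 / m) * (\<integral>\<theta>. f (sqrt 2 / m * \<theta>) \<partial>lborel)"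
    using m(1) by (subst lborel_integral_real_affine[where c = "sqrt 2 / m" and t = 0])
      (auto simp: scaleR_conv_of_real)
  finally have "edge_factor c N z * poly (scaled_hermite (of_real (\<tau> / real N)) (2 * N - j)) (edge_point c N z) =
      of_real (sqrt 2 / m / sqrt (2 * pi * (\<tau> / real N))) * (\<integral>\<theta>. edge_factor c N z * f (sqrt 2 / m * \<theta>) \<partial>lborel)"
    by (simp add: mult_ac)
  also have "(\<integral>\<theta>. edge_factor c N z * f (sqrt 2 / m * \<theta>) \<partial>lborel) = K * edge_integral c \<alpha> N j z"
    unfolding edge_integral_def m_def[symmetric] J_def[symmetric] pt by (rule integral_mult_right_zero)
  also have "sqrt 2 / m / sqrt (2 * pi * (\<tau> / real N)) = sqrt (m / (2 * pi * \<tau>))"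
  proof -
    have e: "m / (2 * pi * \<tau>) = 2 / m\<^sup>2 / (2 * pi * (\<tau> / real N))"
      using m \<tau> by (simp add: field_simps power2_eq_square power3_eq_cube)
    show ?thesis unfolding e by (simp only: real_sqrt_divide real_sqrt_abs abs_of_pos[OF m(1)])
  qed
  finally show ?thesis by (simp add: K_def mult_ac)
qed

end


section \<open>Uniform bounds and limits of the edge integrals\<close>

lemma integrable_exp_abs_gauss:
  fixes b d :: real
  assumes "v > 0"
  shows "integrable lborel (\<lambda>x::real. exp (d + b * \<bar>x\<bar> - x\<^sup>2 / (2 * v)))"
proof (rule Bochner_Integration.integrable_bound)
  show "integrable lborel (\<lambda>x::real. exp d * (exp (b * x - x\<^sup>2 / (2 * v)) + exp ((- b) * x - x\<^sup>2 / (2 * v))))"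
    by (intro integrable_mult_right Bochner_Integration.integrable_add integrable_real_gauss assms)
  have "exp (d + b * \<bar>x\<bar> - x\<^sup>2 / (2 * v)) \<le>
      exp d * (exp (b * x - x\<^sup>2 / (2 * v)) + exp ((- b) * x - x\<^sup>2 / (2 * v)))" for x :: real
  proof -
    have "exp (b * \<bar>x\<bar> - x\<^sup>2 / (2 * v)) \<le> exp (b * x - x\<^sup>2 / (2 * v)) + exp ((- b) * x - x\<^sup>2 / (2 * v))"
      by (cases "x \<ge> 0") auto
    then have "exp d * exp (b * \<bar>x\<bar> - x\<^sup>2 / (2 * v)) \<le>
       exp d * (exp (b * x - x\<^sup>2 / (2 * v)) + exp ((- b) * x - x\<^sup>2 / (2 * v)))"
      by (rule mult_left_mono) simp
    then show ?thesis by (simp only: mult_exp_exp add_diff_eq)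
  qed
  then show "AE x in lborel. norm (exp (d + b * \<bar>x\<bar> - x\<^sup>2 / (2 * v))) \<le>
      norm (exp d * (exp (b * x - x\<^sup>2 / (2 * v)) + exp ((- b) * x - x\<^sup>2 / (2 * v))))"
    by (intro AE_I2) (simp add: abs_mult)
qed measurable

text \<open>The coefficients come from \<open>1 / \<tau> \<le> 2\<close> for the terms that may be
  positive and from \<open>1 / \<tau> \<ge> 1\<close> for the Gaussian decay in
  \<open>\<theta>\<close>. Nothing depends on \<open>N\<close>.\<close>

definition edge_majorant :: "real \<Rightarrow> real \<Rightarrow> real \<Rightarrow> real \<Rightarrow> real" where
  "edge_majorant c \<alpha> R \<theta> = exp ((\<alpha> ^ 3 / 3 + c\<^sup>2 * \<alpha>\<^sup>2 + 4 * c * \<alpha> * R + 2 * R\<^sup>2) + 4 * c * R * \<bar>\<theta>\<bar> - \<theta>\<^sup>2 / (2 * (1 / c\<^sup>2)))"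

lemma integrable_edge_majorant: "c > 0 \<Longrightarrow> integrable lborel (edge_majorant c \<alpha> R)"
  unfolding edge_majorant_def by (rule integrable_exp_abs_gauss) simp

context edge_regime
begin

text \<open>With \<open>x = \<alpha> / m\<close> and \<open>q = (\<theta> / m)\<^sup>2\<close> one
  has \<open>(1 + x)\<^sup>2 + q \<le> (1 + x)\<^sup>2 * (1 + q)\<close>, which separates the two
  variables. Since \<open>N = m ^ 3 / 2\<close>, the resulting growth
  \<open>m * \<theta>\<^sup>2 / 2\<close> is exactly compensated by the real part of
  \<open>m * t\<^sup>2 / 2\<close>, and the powers of \<open>m\<close> in \<open>\<alpha>\<close>
  cancel in the same way.\<close>

lemma edge_phase_bound:
  assumes "\<alpha> \<ge> 0" "1 / 2 \<le> \<tau>" "norm z \<le> R"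
  shows "norm (edge_phase c N z (of_real \<alpha> + \<i> * of_real \<theta>)) \<le> edge_majorant c \<alpha> R \<theta>"
proof -
  define x where "x = \<alpha> / m"
  define q where "q = (\<theta> / m)\<^sup>2"
  define t where "t = complex_of_real \<alpha> + \<i> * of_real \<theta>"
  define k where "k = c * sqrt 2 * sqrt (1 + \<tau>)"
  have x: "x \<ge> 0" using assms m(1) by (simp add: x_def)
  have R: "R \<ge> 0" using assms(3) norm_ge_zero order.trans by blast
  have q: "q \<ge> 0" by (simp add: q_def)
  have "(norm (1 + t / of_real m))\<^sup>2 = (1 + x)\<^sup>2 + q"
    unfolding cmod_power2 by (simp add: t_def x_def q_def)
  also have "\<dots> \<le> (1 + x)\<^sup>2 * (1 + q)"
  proof -
    have "1 * q \<le> (1 + x)\<^sup>2 * q" using x q by (intro mult_right_mono) auto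
    then show ?thesis by (simp add: distrib_left)
  qed
  also have "\<dots> \<le> (exp (x - x\<^sup>2 / 2 + x ^ 3 / 3))\<^sup>2 * exp q"
    using x q by (intro mult_mono power_mono one_plus_le_exp_cubic) auto
  also have "\<dots> = exp (2 * x - x\<^sup>2 + 2 * x ^ 3 / 3 + q)"
    by (simp add: exp_add[symmetric] power2_eq_square)
  finally have "((norm (1 + t / of_real m))\<^sup>2) ^ N \<le> exp (2 * x - x\<^sup>2 + 2 * x ^ 3 / 3 + q) ^ N"
    by (rule power_mono) simp
  then have "norm ((1 + t / of_real m) ^ (2 * N)) \<le> exp (real N * (2 * x - x\<^sup>2 + 2 * x ^ 3 / 3 + q))"
    by (simp add: norm_power power_mult exp_of_nat_mult)
  also have "real N * (2 * x - x\<^sup>2 + 2 * x ^ 3 / 3 + q) = m\<^sup>2 * \<alpha> - m * \<alpha>\<^sup>2 / 2 + \<alpha> ^ 3 / 3 + m * \<theta>\<^sup>2 / 2"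
    unfolding m(2) x_def q_def using m(1) by (simp add: field_simps power2_eq_square power3_eq_cube)
  finally have 1: "norm ((1 + t / of_real m) ^ (2 * N)) \<le> exp (m\<^sup>2 * \<alpha> - m * \<alpha>\<^sup>2 / 2 + \<alpha> ^ 3 / 3 + m * \<theta>\<^sup>2 / 2)" .
  define W where "W = c\<^sup>2 * \<alpha>\<^sup>2 / 2 + 2 * c * (\<alpha> + \<bar>\<theta>\<bar>) * R + R\<^sup>2"
  have W: "W \<ge> 0" using c assms R by (simp add: W_def)
  have k: "0 \<le> k" "k \<le> 2 * c"
  proof -
    have "sqrt 2 * sqrt (1 + \<tau>) \<le> sqrt 2 * sqrt 2" using \<tau> by (intro mult_left_mono) auto
    then show "0 \<le> k" "k \<le> 2 * c" using c \<tau> by (auto simp: k_def mult.assoc)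
  qed
  have "Re (- (of_real k * t * z)) \<le> norm (- (of_real k * t * z))" by (rule complex_Re_le_cmod)
  also have "\<dots> = k * (norm t * norm z)" using k by (simp add: norm_mult)
  also have "\<dots> \<le> (2 * c) * ((\<alpha> + \<bar>\<theta>\<bar>) * R)"
  proof -
    have "norm t \<le> \<alpha> + \<bar>\<theta>\<bar>" unfolding t_def using assms(1) by (intro order.trans[OF norm_triangle_ineq]) (simp add: norm_mult)
    then show ?thesis using k assms by (intro mult_mono) auto
  qed
  finally have kt: "Re (- (of_real k * t * z)) \<le> 2 * c * (\<alpha> + \<bar>\<theta>\<bar>) * R" by simp
  have "Re (z\<^sup>2) \<le> (norm z)\<^sup>2" using complex_Re_le_cmod[of "z\<^sup>2"] by (simp add: norm_power)
  also have "\<dots> \<le> R\<^sup>2" using assms(3) by (intro power_mono) auto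
  finally have z2: "Re (z\<^sup>2) \<le> R\<^sup>2" .
  have t2: "Re (t\<^sup>2) = \<alpha>\<^sup>2 - \<theta>\<^sup>2" by (simp add: t_def power2_eq_square)
  have "Re (of_real (c\<^sup>2) * t\<^sup>2 / 2 - of_real k * t * z + z\<^sup>2) \<le> W - c\<^sup>2 * \<theta>\<^sup>2 / 2"
  proof -
    have "Re (of_real (c\<^sup>2) * t\<^sup>2 / 2 - of_real k * t * z + z\<^sup>2) = c\<^sup>2 * Re (t\<^sup>2) / 2 + Re (- (of_real k * t * z)) + Re (z\<^sup>2)"
      by (simp add: Re_divide_numeral mult.assoc)
    then show ?thesis using kt z2 unfolding t2 W_def by (simp add: algebra_simps diff_divide_distrib)
  qed
  then have "Re (of_real (c\<^sup>2) * t\<^sup>2 / 2 - of_real k * t * z + z\<^sup>2) / \<tau> \<le> (W - c\<^sup>2 * \<theta>\<^sup>2 / 2) / \<tau>"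
    using \<tau> by (intro divide_right_mono) auto
  also have "\<dots> \<le> 2 * W - c\<^sup>2 * \<theta>\<^sup>2 / 2"
  proof -
    have "W / \<tau> \<le> W / (1 / 2)" using W assms(2) by (intro divide_left_mono) auto
    moreover have "(c\<^sup>2 * \<theta>\<^sup>2 / 2) / 1 \<le> (c\<^sup>2 * \<theta>\<^sup>2 / 2) / \<tau>" using \<tau> by (intro divide_left_mono) auto
    ultimately show ?thesis by (simp add: diff_divide_distrib)
  qed
  finally have 2: "Re ((of_real (c\<^sup>2) * t\<^sup>2 / 2 - of_real k * t * z + z\<^sup>2) / of_real \<tau>) \<le> 2 * W - c\<^sup>2 * \<theta>\<^sup>2 / 2"
    by simp
  let ?E = "- of_real (m\<^sup>2) * t + of_real m * t\<^sup>2 / 2 + (of_real (c\<^sup>2) * t\<^sup>2 / 2 - of_real k * t * z + z\<^sup>2) / of_real \<tau>"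
  have "Re ?E \<le> - m\<^sup>2 * \<alpha> + m * (\<alpha>\<^sup>2 - \<theta>\<^sup>2) / 2 + (2 * W - c\<^sup>2 * \<theta>\<^sup>2 / 2)"
  proof -
    have "Re (- of_real (m\<^sup>2) * t + of_real m * t\<^sup>2 / 2) = - m\<^sup>2 * \<alpha> + m * Re (t\<^sup>2) / 2"
    proof -
      have "- of_real (m\<^sup>2) * t + of_real m * t\<^sup>2 / 2 = of_real (- m\<^sup>2) * t + of_real (m / 2) * t\<^sup>2" by simp
      moreover have "Re t = \<alpha>" by (simp add: t_def)
      ultimately show ?thesis by (simp add: plus_complex.sel Re_complex_of_real times_complex.sel Im_complex_of_real)
    qed
    then show ?thesis using 2 unfolding t2 by (simp only: plus_complex.sel)
  qed
  then have "norm (exp ?E) \<le> exp (- m\<^sup>2 * \<alpha> + m * (\<alpha>\<^sup>2 - \<theta>\<^sup>2) / 2 + (2 * W - c\<^sup>2 * \<theta>\<^sup>2 / 2))"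
    by simp
  then have "norm ((1 + t / of_real m) ^ (2 * N)) * norm (exp ?E) \<le>
     exp (m\<^sup>2 * \<alpha> - m * \<alpha>\<^sup>2 / 2 + \<alpha> ^ 3 / 3 + m * \<theta>\<^sup>2 / 2) * exp (- m\<^sup>2 * \<alpha> + m * (\<alpha>\<^sup>2 - \<theta>\<^sup>2) / 2 + (2 * W - c\<^sup>2 * \<theta>\<^sup>2 / 2))"
    using 1 by (intro mult_mono) auto
  also have "\<dots> = edge_majorant c \<alpha> R \<theta>"
    unfolding edge_majorant_def W_def mult_exp_exp by (rule arg_cong[of _ _ exp]) (simp add: field_simps)
  finally show ?thesis
    unfolding edge_phase_def norm_mult m_def[symmetric] \<tau>_def[symmetric] k_def[symmetric] t_def[symmetric] .
qed

text \<open>A strictly positive abscissa makes the modulus of \<open>1 + t / m\<close> at least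
  \<open>1 + \<alpha> / m\<close>, so every lost degree gains a definite factor. This geometric
  decay is what controls the double sum.\<close>

lemma edge_integrand_bound:
  assumes "\<alpha> > 0" "1 / 2 \<le> \<tau>" "norm z \<le> R"
  shows "norm (edge_phase c N z (of_real \<alpha> + \<i> * of_real \<theta>) / (1 + (of_real \<alpha> + \<i> * of_real \<theta>) / of_real m) ^ j)
    \<le> edge_majorant c \<alpha> R \<theta> * (1 / (1 + \<alpha> / m)) ^ j"
proof -
  have "1 + \<alpha> / m = Re (1 + (of_real \<alpha> + \<i> * of_real \<theta>) / of_real m)" by simp
  also have "\<dots> \<le> norm (1 + (of_real \<alpha> + \<i> * of_real \<theta>) / of_real m)" by (rule complex_Re_le_cmod)
  finally have le: "1 + \<alpha> / m \<le> norm (1 + (of_real \<alpha> + \<i> * of_real \<theta>) / of_real m)" .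
  have pos: "0 < 1 + \<alpha> / m" using assms m(1) by (simp add: add_pos_pos)
  have "norm (edge_phase c N z (of_real \<alpha> + \<i> * of_real \<theta>)) / norm (1 + (of_real \<alpha> + \<i> * of_real \<theta>) / of_real m) ^ j
     \<le> edge_majorant c \<alpha> R \<theta> / (1 + \<alpha> / m) ^ j"
    using assms le pos by (intro frac_le power_mono edge_phase_bound) (auto simp: edge_majorant_def)
  then show ?thesis by (simp add: norm_divide norm_power power_divide)
qed

lemma edge_integral_bound:
  assumes "\<alpha> > 0" "1 / 2 \<le> \<tau>" "norm z \<le> R"
  shows "norm (edge_integral c \<alpha> N j z) \<le> (\<integral>\<theta>. edge_majorant c \<alpha> R \<theta> \<partial>lborel) * (1 / (1 + \<alpha> / m)) ^ j"
proof -
  have maj: "integrable lborel (\<lambda>\<theta>. edge_majorant c \<alpha> R \<theta> * (1 / (1 + \<alpha> / m)) ^ j)"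
    by (intro integrable_mult_left integrable_edge_majorant c)
  have meas: "(\<lambda>\<theta>. edge_phase c N z (of_real \<alpha> + \<i> * of_real \<theta>) / (1 + (of_real \<alpha> + \<i> * of_real \<theta>) / of_real m) ^ j) \<in> borel_measurable lborel"
    unfolding edge_phase_def by measurable
  have int: "integrable lborel (\<lambda>\<theta>. edge_phase c N z (of_real \<alpha> + \<i> * of_real \<theta>) / (1 + (of_real \<alpha> + \<i> * of_real \<theta>) / of_real m) ^ j)"
    by (rule Bochner_Integration.integrable_bound[OF maj meas])
       (intro AE_I2 order.trans[OF edge_integrand_bound[OF assms]], simp)
  have "norm (edge_integral c \<alpha> N j z) \<le> (\<integral>\<theta>. edge_majorant c \<alpha> R \<theta> * (1 / (1 + \<alpha> / m)) ^ j \<partial>lborel)"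
    unfolding edge_integral_def m_def[symmetric]
    by (rule Bochner_Integration.integral_norm_bound_integral[OF int maj edge_integrand_bound[OF assms]])
  then show ?thesis by simp
qed

end

definition edge_limit_integral :: "real \<Rightarrow> real \<Rightarrow> real \<Rightarrow> complex \<Rightarrow> complex" where
  "edge_limit_integral c \<alpha> x z = (\<integral>\<theta>. (let t = of_real \<alpha> + \<i> * of_real \<theta> in
     exp (t ^ 3 / 3 + of_real (c\<^sup>2) * t\<^sup>2 / 2 - 2 * of_real c * t * z + z\<^sup>2 - of_real x * t)) \<partial>lborel)"

lemma eventually_edge_regime:
  assumes "c > 0"
  shows "\<forall>\<^sub>F N in sequentially. edge_regime c N \<and> edge_tau c N \<ge> 1 / 2 \<and> edge_scale N \<ge> 1"
proof -
  have "\<forall>\<^sub>F N in sequentially. edge_tau c N > 1 / 2"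
    by (rule order_tendstoD(1)[OF edge_tau_tendsto]) simp
  moreover have "\<forall>\<^sub>F N in sequentially. edge_scale N \<ge> 1"
    using filterlim_edge_scale by (simp add: filterlim_at_top)
  moreover have "\<forall>\<^sub>F N in sequentially. N > 0" by (rule eventually_gt_at_top)
  ultimately show ?thesis
    by eventually_elim (auto intro!: edge_regime.intro assms)
qed

text \<open>The exponent is written by means of the logarithm. Multiplied by \<open>m ^ 3\<close>,
  the third order Taylor remainder is of order \<open>1 / m\<close>; the cubic term survives from
  the power \<open>2 * N\<close>, and only the linear term survives from the power
  \<open>J N\<close>, which is of order \<open>m\<close>.\<close>

lemma edge_integrand_tendsto:
  assumes c: "c > 0" and Z: "Z \<longlonglongrightarrow> z" and J: "(\<lambda>N. real (J N) / edge_scale N) \<longlonglongrightarrow> x" and t: "Re t > 0"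
  shows "(\<lambda>N. edge_phase c N (Z N) t / (1 + t / of_real (edge_scale N)) ^ J N) \<longlonglongrightarrow>
     exp (t ^ 3 / 3 + of_real (c\<^sup>2) * t\<^sup>2 / 2 - 2 * of_real c * t * z + z\<^sup>2 - of_real x * t)"
proof -
  define \<mu> where "\<mu> N = complex_of_real (edge_scale N)" for N
  define r where "r N = Ln (1 + t / \<mu> N) - t / \<mu> N + (t / \<mu> N)\<^sup>2 / 2 - (t / \<mu> N) ^ 3 / 3" for N
  define k where "k N = complex_of_real (c * sqrt 2 * sqrt (1 + edge_tau c N))" for N
  \<comment> \<open>\<open>A N\<close> is the exact exponent after the cancellation of the terms of
    order \<open>m\<^sup>2\<close> and \<open>m\<close>, so its limit can be taken term by
    term.\<close>
  define A where "A N = \<mu> N ^ 3 * r N + t ^ 3 / 3 + (of_real (c\<^sup>2) * t\<^sup>2 / 2 - k N * t * Z N + (Z N)\<^sup>2) / of_real (edge_tau c N)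
     - of_real (real (J N) / edge_scale N) * (\<mu> N * r N + t - t\<^sup>2 / 2 * (1 / \<mu> N) + t ^ 3 / 3 * (1 / \<mu> N)\<^sup>2)" for N
  have inv: "(\<lambda>N. 1 / \<mu> N) \<longlonglongrightarrow> 0"
  proof -
    have "(\<lambda>N. 1 / edge_scale N) \<longlonglongrightarrow> 0"
      by (rule tendsto_divide_0[OF tendsto_const filterlim_at_top_imp_at_infinity[OF filterlim_edge_scale]])
    from tendsto_of_real[OF this, where 'a = complex] show ?thesis by (simp add: \<mu>_def)
  qed
  have tau: "(\<lambda>N. complex_of_real (edge_tau c N)) \<longlonglongrightarrow> 1"
    using tendsto_of_real[OF edge_tau_tendsto[of c]] by simp
  have k: "k \<longlonglongrightarrow> 2 * of_real c"
  proof -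
    have "(\<lambda>N. c * sqrt 2 * sqrt (1 + edge_tau c N)) \<longlonglongrightarrow> c * sqrt 2 * sqrt (1 + 1)"
      by (intro tendsto_intros edge_tau_tendsto)
    moreover have "c * sqrt 2 * sqrt (1 + 1) = 2 * c" by simp
    ultimately have "(\<lambda>N. c * sqrt 2 * sqrt (1 + edge_tau c N)) \<longlonglongrightarrow> 2 * c" by (simp only:)
    from tendsto_of_real[OF this, where 'a = complex] show ?thesis by (simp add: k_def[abs_def])
  qed
  have pos: "\<forall>\<^sub>F N in sequentially. N > 0 \<and> edge_scale N \<ge> 1 \<and> edge_scale N \<ge> 2 * norm t"
    using filterlim_edge_scale by (simp add: filterlim_at_top eventually_conj_iff)
  have rb: "\<forall>\<^sub>F N in sequentially. norm (\<mu> N ^ 3 * r N) \<le> 2 * norm t ^ 4 * norm (1 / \<mu> N)"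
    using pos
  proof eventually_elim
    case (elim N)
    then have m: "edge_scale N > 0" and nm: "norm (\<mu> N) = edge_scale N" by (auto simp: \<mu>_def)
    have "norm (t / \<mu> N) \<le> 1 / 2" using elim m by (simp add: norm_divide nm field_simps)
    then have "norm (r N) \<le> 2 * norm (t / \<mu> N) ^ 4" unfolding r_def by (rule Ln_cubic_bound)
    then have "norm (\<mu> N ^ 3 * r N) \<le> edge_scale N ^ 3 * (2 * norm (t / \<mu> N) ^ 4)"
      unfolding norm_mult norm_power nm using m by (intro mult_left_mono) auto
    also have "\<dots> = 2 * norm t ^ 4 * norm (1 / \<mu> N)"
      using m by (simp add: norm_divide nm power_divide field_simps numeral_eq_Suc)
    finally show ?case .
  qed
  have r3: "(\<lambda>N. \<mu> N ^ 3 * r N) \<longlonglongrightarrow> 0"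
    using inv by (intro Lim_null_comparison[OF rb] tendsto_mult_right_zero tendsto_norm_zero)
  have "\<forall>\<^sub>F N in sequentially. \<mu> N * r N = (1 / \<mu> N)\<^sup>2 * (\<mu> N ^ 3 * r N)"
    using pos by eventually_elim (simp add: \<mu>_def power2_eq_square power3_eq_cube)
  moreover have "(\<lambda>N. (1 / \<mu> N)\<^sup>2 * (\<mu> N ^ 3 * r N)) \<longlonglongrightarrow> 0\<^sup>2 * 0"
    by (intro tendsto_intros inv r3)
  ultimately have r1: "(\<lambda>N. \<mu> N * r N) \<longlonglongrightarrow> 0"
    by (subst tendsto_cong) (auto simp: )
  have "A \<longlonglongrightarrow> 0 + t ^ 3 / 3 + (of_real (c\<^sup>2) * t\<^sup>2 / 2 - 2 * of_real c * t * z + z\<^sup>2) / 1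
     - of_real x * (0 + t - t\<^sup>2 / 2 * 0 + t ^ 3 / 3 * 0\<^sup>2)"
    unfolding A_def[abs_def] by (intro tendsto_intros r3 r1 inv tau k Z J) simp
  then have "(\<lambda>N. exp (A N)) \<longlonglongrightarrow> exp (t ^ 3 / 3 + of_real (c\<^sup>2) * t\<^sup>2 / 2 - 2 * of_real c * t * z + z\<^sup>2 - of_real x * t)"
    by (intro tendsto_exp) (simp add: algebra_simps)
  moreover have "\<forall>\<^sub>F N in sequentially. exp (A N) = edge_phase c N (Z N) t / (1 + t / of_real (edge_scale N)) ^ J N"
    using pos
  proof eventually_elim
    case (elim N)
    then have m: "edge_scale N > 0" and \<mu>: "\<mu> N \<noteq> 0" by (auto simp: \<mu>_def)
    define L where "L = Ln (1 + t / \<mu> N)"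
    have "1 + Re (t / \<mu> N) > 0" using m t by (simp add: \<mu>_def add_pos_pos)
    then have ne: "1 + t / \<mu> N \<noteq> 0" by (auto simp: complex_eq_iff)
    have pow: "(1 + t / \<mu> N) ^ n = exp (of_nat n * L)" for n
      using ne by (simp add: exp_of_nat_mult L_def)
    have N: "of_nat (2 * N) = \<mu> N ^ 3"
      using arg_cong[OF edge_scale_cube[of N], of complex_of_real] elim by (simp add: \<mu>_def)
    have L: "L = r N + t / \<mu> N - (t / \<mu> N)\<^sup>2 / 2 + (t / \<mu> N) ^ 3 / 3" by (simp add: r_def L_def)
    have a: "of_nat (2 * N) * L - (\<mu> N)\<^sup>2 * t + \<mu> N * t\<^sup>2 / 2 = \<mu> N ^ 3 * r N + t ^ 3 / 3"
      unfolding N L using \<mu> by (simp add: field_simps power2_eq_square power3_eq_cube)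
    have e: "\<mu> N * L = \<mu> N * r N + t - t\<^sup>2 / 2 * (1 / \<mu> N) + t ^ 3 / 3 * (1 / \<mu> N)\<^sup>2"
      unfolding L using \<mu> by (simp add: field_simps power2_eq_square power3_eq_cube)
    have "of_nat (J N) * L = of_real (real (J N) / edge_scale N) * (\<mu> N * L)"
      using m by (simp add: \<mu>_def)
    then have b: "of_nat (J N) * L = of_real (real (J N) / edge_scale N) * (\<mu> N * r N + t - t\<^sup>2 / 2 * (1 / \<mu> N) + t ^ 3 / 3 * (1 / \<mu> N)\<^sup>2)"
      by (simp only: e)
    have "edge_phase c N (Z N) t / (1 + t / \<mu> N) ^ J N =
      exp (of_nat (2 * N) * L + (- (\<mu> N)\<^sup>2 * t + \<mu> N * t\<^sup>2 / 2 + (of_real (c\<^sup>2) * t\<^sup>2 / 2 - k N * t * Z N + (Z N)\<^sup>2) / of_real (edge_tau c N)) - of_nat (J N) * L)"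
      unfolding edge_phase_def \<mu>_def[symmetric] of_real_power k_def[symmetric] pow exp_diff exp_add by simp
    also have "of_nat (2 * N) * L + (- (\<mu> N)\<^sup>2 * t + \<mu> N * t\<^sup>2 / 2 + (of_real (c\<^sup>2) * t\<^sup>2 / 2 - k N * t * Z N + (Z N)\<^sup>2) / of_real (edge_tau c N)) - of_nat (J N) * L = A N"
      unfolding A_def b[symmetric] a[symmetric] by simp
    finally show ?case by (simp add: \<mu>_def)
  qed
  ultimately show ?thesis by (rule Lim_transform_eventually)
qed

lemma edge_integral_tendsto:
  assumes c: "c > 0" and \<alpha>: "\<alpha> > 0" and Z: "Z \<longlonglongrightarrow> z" and J: "(\<lambda>N. real (J N) / edge_scale N) \<longlonglongrightarrow> x"
  shows "(\<lambda>N. edge_integral c \<alpha> N (J N) (Z N)) \<longlonglongrightarrow> edge_limit_integral c \<alpha> x z"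
proof -
  obtain R where R: "\<And>N. norm (Z N) \<le> R"
    using Bseq_eq_bounded[of Z] convergent_imp_Bseq[OF convergentI[OF Z]] by (auto simp: Bseq_def)
  \<comment> \<open>The majorant is available only from some index on, while dominated convergence
    asks for all indices; hence the shift by \<open>n0\<close>, undone at the end.\<close>
  obtain n0 where n0: "\<And>N. N \<ge> n0 \<Longrightarrow> edge_regime c N \<and> edge_tau c N \<ge> 1 / 2"
    using eventually_edge_regime[OF c] by (auto simp: eventually_sequentially)
  let ?t = "\<lambda>\<theta>. complex_of_real \<alpha> + \<i> * of_real \<theta>"
  let ?f = "\<lambda>N \<theta>. edge_phase c N (Z N) (?t \<theta>) / (1 + ?t \<theta> / of_real (edge_scale N)) ^ J N"
  have "(\<lambda>N. \<integral>\<theta>. ?f (N + n0) \<theta> \<partial>lborel) \<longlonglongrightarrow> (\<integral>\<theta>. exp (?t \<theta> ^ 3 / 3 + of_real (c\<^sup>2) * (?t \<theta>)\<^sup>2 / 2 - 2 * of_real c * ?t \<theta> * z + z\<^sup>2 - of_real x * ?t \<theta>) \<partial>lborel)"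
  proof (rule integral_dominated_convergence[where w = "edge_majorant c \<alpha> R"])
    show "integrable lborel (edge_majorant c \<alpha> R)" by (rule integrable_edge_majorant[OF c])
    show "AE \<theta> in lborel. (\<lambda>N. ?f (N + n0) \<theta>) \<longlonglongrightarrow> exp (?t \<theta> ^ 3 / 3 + of_real (c\<^sup>2) * (?t \<theta>)\<^sup>2 / 2 - 2 * of_real c * ?t \<theta> * z + z\<^sup>2 - of_real x * ?t \<theta>)"
    proof (rule AE_I2)
      fix \<theta>
      show "(\<lambda>N. ?f (N + n0) \<theta>) \<longlonglongrightarrow> exp (?t \<theta> ^ 3 / 3 + of_real (c\<^sup>2) * (?t \<theta>)\<^sup>2 / 2 - 2 * of_real c * ?t \<theta> * z + z\<^sup>2 - of_real x * ?t \<theta>)"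
        by (rule LIMSEQ_ignore_initial_segment[where k = n0, OF edge_integrand_tendsto[OF c Z J]]) (simp add: \<alpha>)
    qed
    show "AE \<theta> in lborel. norm (?f (N + n0) \<theta>) \<le> edge_majorant c \<alpha> R \<theta>" for N
    proof (rule AE_I2)
      fix \<theta>
      interpret edge_regime c "N + n0" "edge_tau c (N + n0)" "edge_scale (N + n0)" "edge_zoom c (N + n0)"
        using n0[of "N + n0"] by simp_all
      have le1: "(1 / (1 + \<alpha> / edge_scale (N + n0))) ^ J (N + n0) \<le> 1"
        using \<alpha> m(1) by (intro power_le_one) (auto simp: divide_simps add_nonneg_nonneg)
      have "norm (?f (N + n0) \<theta>) \<le> edge_majorant c \<alpha> R \<theta> * (1 / (1 + \<alpha> / edge_scale (N + n0))) ^ J (N + n0)"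
        using n0[of "N + n0"] by (intro edge_integrand_bound[OF \<alpha> _ R]) auto
      also have "\<dots> \<le> edge_majorant c \<alpha> R \<theta> * 1"
        using le1 by (intro mult_left_mono) (auto simp: edge_majorant_def)
      finally show "norm (?f (N + n0) \<theta>) \<le> edge_majorant c \<alpha> R \<theta>" by simp
    qed
  qed (unfold edge_phase_def, measurable)
  then have "(\<lambda>N. edge_integral c \<alpha> (N + n0) (J (N + n0)) (Z (N + n0))) \<longlonglongrightarrow> edge_limit_integral c \<alpha> x z"
    unfolding edge_integral_def edge_limit_integral_def Let_def .
  then show ?thesis by (rule LIMSEQ_offset)
qed


section \<open>Identification with the Airy function\<close>

definition airy_line :: "real \<Rightarrow> complex \<Rightarrow> complex" where
  "airy_line b \<zeta> = (\<integral>\<theta>. exp ((of_real b + \<i> * of_real \<theta>) ^ 3 / 3 - \<zeta> * (of_real b + \<i> * of_real \<theta>)) \<partial>lborel)"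

text \<open>Completing the cube. For \<open>C = c\<close> and \<open>D = c\<^sup>2 / 2\<close> it
  produces the constants of the limit: \<open>2 * D * C = c ^ 3\<close>,
  \<open>2 * D ^ 3 / 3 = c ^ 6 / 12\<close> and \<open>D\<^sup>2 = c ^ 4 / 4\<close>.\<close>

lemma cubic_shift_identity:
  fixes D C z t :: complex
  shows "t ^ 3 / 3 + D * t\<^sup>2 - 2 * C * z * t =
    2 * D * C * z + 2 * D ^ 3 / 3 + ((t + D) ^ 3 / 3 - (2 * C * z + D\<^sup>2) * (t + D))"
proof -
  have "(t + D) ^ 3 / 3 = t ^ 3 / 3 + t\<^sup>2 * D + t * D\<^sup>2 + D ^ 3 / 3"
  proof -
    have "(t + D) ^ 3 = t ^ 3 + 3 * (t\<^sup>2 * D) + 3 * (t * D\<^sup>2) + D ^ 3"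
      by (simp add: power2_eq_square power3_eq_cube algebra_simps)
    then show ?thesis by (simp only: add_divide_distrib) simp
  qed
  moreover have "(2 * C * z + D\<^sup>2) * (t + D) = 2 * C * z * t + 2 * C * z * D + D\<^sup>2 * t + D ^ 3"
    by (simp add: power2_eq_square power3_eq_cube algebra_simps)
  ultimately have "2 * D * C * z + 2 * D ^ 3 / 3 + ((t + D) ^ 3 / 3 - (2 * C * z + D\<^sup>2) * (t + D)) =
     2 * D * C * z + 2 * D ^ 3 / 3 + ((t ^ 3 / 3 + t\<^sup>2 * D + t * D\<^sup>2 + D ^ 3 / 3) - (2 * C * z * t + 2 * C * z * D + D\<^sup>2 * t + D ^ 3))"
    by (simp only:)
  also have "\<dots> = t ^ 3 / 3 + D * t\<^sup>2 - 2 * C * z * t + (2 * D ^ 3 / 3 + D ^ 3 / 3 - D ^ 3)"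
    by (simp add: mult_ac)
  also have "2 * D ^ 3 / 3 + D ^ 3 / 3 - D ^ 3 = 0" by simp
  finally show ?thesis by simp
qed

text \<open>Because \<open>x * t = 2 * c * (x / (2 * c)) * t\<close>, a lower degree acts as a
  translation of \<open>z\<close> by \<open>x / (2 * c)\<close>. Completing the cube moves the line
  by \<open>c\<^sup>2 / 2\<close>.\<close>

lemma edge_limit_integral_eq_airy_line:
  assumes "c > 0"
  shows "edge_limit_integral c \<alpha> x z =
    exp (z\<^sup>2 + (of_real (c ^ 3) * (z + of_real (x / (2 * c))) + of_real (c ^ 6 / 12))) *
    airy_line (\<alpha> + c\<^sup>2 / 2) (2 * of_real c * (z + of_real (x / (2 * c))) + of_real (c ^ 4 / 4))"
proof -
  define w where "w = z + of_real (x / (2 * c))"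
  define D where "D = complex_of_real (c\<^sup>2 / 2)"
  have "t ^ 3 / 3 + of_real (c\<^sup>2) * t\<^sup>2 / 2 - 2 * of_real c * t * z + z\<^sup>2 - of_real x * t =
     (z\<^sup>2 + (of_real (c ^ 3) * w + of_real (c ^ 6 / 12))) + ((t + D) ^ 3 / 3 - (2 * of_real c * w + of_real (c ^ 4 / 4)) * (t + D))" for t
  proof -
    have x: "complex_of_real x = 2 * of_real c * of_real (x / (2 * c))" using assms by simp
    have "t ^ 3 / 3 + of_real (c\<^sup>2) * t\<^sup>2 / 2 - 2 * of_real c * t * z + z\<^sup>2 - of_real x * t =
       z\<^sup>2 + (t ^ 3 / 3 + D * t\<^sup>2 - 2 * of_real c * w * t)"
      unfolding w_def by (subst (1) x) (simp add: D_def algebra_simps)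
    also have "\<dots> = z\<^sup>2 + (2 * D * of_real c * w + 2 * D ^ 3 / 3 + ((t + D) ^ 3 / 3 - (2 * of_real c * w + D\<^sup>2) * (t + D)))"
      by (subst cubic_shift_identity) (rule refl)
    also have "2 * D * of_real c = of_real (c ^ 3)" by (simp add: D_def power2_eq_square power3_eq_cube)
    also have "D\<^sup>2 = of_real (c ^ 4 / 4)" by (simp add: D_def power_divide flip: power_mult)
    also have "2 * D ^ 3 / 3 = of_real (c ^ 6 / 12)" by (simp add: D_def power_divide flip: power_mult)
    finally show ?thesis by simp
  qed
  moreover have "of_real \<alpha> + \<i> * of_real \<theta> + D = of_real (\<alpha> + c\<^sup>2 / 2) + \<i> * of_real \<theta>" for \<theta>
    by (simp add: D_def)
  ultimately show ?thesis
    unfolding edge_limit_integral_def airy_line_def Let_def w_def[symmetric]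
    by (simp only: exp_add[of "z\<^sup>2 + _"] integral_mult_right_zero)
qed

text \<open>
  At finite \<open>N\<close> the integral does not depend on the line, since it represents a Hermite polynomial;
  this passes to the limit and spares a contour shift for the Airy integral.
\<close>

lemma airy_line_eq:
  assumes b: "b > 0" "b' > 0"
  shows "airy_line b \<zeta> = airy_line b' \<zeta>"
proof -
  \<comment> \<open>With \<open>c\<^sup>2 = min b b'\<close> both abscissas remain positive after
    subtracting \<open>c\<^sup>2 / 2\<close>, so both lines occur at finite \<open>N\<close> for one
    and the same \<open>c\<close>. The point \<open>z\<close> is chosen to make the Airy argument
    equal to \<open>\<zeta>\<close>.\<close>
  define c where "c = sqrt (min b b')"
  define z where "z = (\<zeta> - of_real (c ^ 4 / 4)) / (2 * of_real c)"
  have c: "c > 0" "c\<^sup>2 = min b b'" using b by (simp_all add: c_def)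
  have \<alpha>: "b - c\<^sup>2 / 2 > 0" "b' - c\<^sup>2 / 2 > 0" using b unfolding c(2) by auto
  have "\<forall>\<^sub>F N in sequentially. edge_integral c (b - c\<^sup>2 / 2) N 0 z = edge_integral c (b' - c\<^sup>2 / 2) N 0 z"
    using eventually_edge_regime[OF c(1)]
  proof eventually_elim
    case (elim N)
    then interpret edge_regime c N "edge_tau c N" "edge_scale N" "edge_zoom c N" by simp_all
    have "sqrt (edge_scale N / (2 * pi * edge_tau c N)) * 2 ^ N * exp (- real N) / sqrt 2 ^ 0 \<noteq> 0"
      using m(1) \<tau> by simp
    then show ?case
      using hermite_at_edge[of 0 "b - c\<^sup>2 / 2" z] hermite_at_edge[of 0 "b' - c\<^sup>2 / 2" z] \<alpha>
      by (metis le0 mult_cancel_left of_real_eq_0_iff)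
  qed
  moreover have lim: "(\<lambda>N. edge_integral c \<alpha> N 0 z) \<longlonglongrightarrow> edge_limit_integral c \<alpha> 0 z" if "\<alpha> > 0" for \<alpha>
    using edge_integral_tendsto[OF c(1) that tendsto_const, of "\<lambda>_. 0" 0 z] by simp
  ultimately have "edge_limit_integral c (b - c\<^sup>2 / 2) 0 z = edge_limit_integral c (b' - c\<^sup>2 / 2) 0 z"
    using LIMSEQ_unique[OF Lim_transform_eventually[OF lim[OF \<alpha>(1)]] lim[OF \<alpha>(2)]] by blast
  moreover have "2 * of_real c * (z + of_real (0 / (2 * c))) + of_real (c ^ 4 / 4) = \<zeta>"
    using c(1) by (simp add: z_def)
  ultimately show ?thesis
    unfolding edge_limit_integral_eq_airy_line[OF c(1)] by (simp only:) simp
qed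

lemma Airy_Ai_eq_airy_line: "Airy_Ai z = airy_line 1 z / (2 * of_real pi)"
  unfolding Airy_Ai_def airy_line_def by simp

lemma edge_limit_integral_eq_Airy:
  assumes c: "c > 0" and \<alpha>: "\<alpha> > 0"
  shows "edge_limit_integral c \<alpha> x z = 2 * of_real pi * exp (z\<^sup>2) *
    (exp (of_real (c ^ 3) * (z + of_real (x / (2 * c))) + of_real (c ^ 6 / 12)) *
     Airy_Ai (2 * of_real c * (z + of_real (x / (2 * c))) + of_real (c ^ 4 / 4)))"
proof -
  have b: "\<alpha> + c\<^sup>2 / 2 > 0" using \<alpha> by (simp add: add_pos_nonneg)
  show ?thesis
    unfolding edge_limit_integral_eq_airy_line[OF c] airy_line_eq[OF b zero_less_one] Airy_Ai_eq_airy_line exp_add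
    by simp
qed

text \<open>On the line of abscissa one the cubic has real part \<open>1 / 3 - s\<^sup>2\<close>, so
  for bounded arguments the integrand is dominated by a Gaussian.\<close>

lemma continuous_on_Airy_Ai: "continuous_on A Airy_Ai"
proof -
  have "continuous_on UNIV Airy_Ai"
    unfolding continuous_on_sequentially
  proof (intro allI ballI impI, elim conjE)
    fix X and \<zeta> :: complex
    assume X: "X \<longlonglongrightarrow> \<zeta>"
    obtain R where R: "\<And>n. norm (X n) \<le> R"
      using convergent_imp_Bseq[OF convergentI[OF X]] by (auto simp: Bseq_def)
    let ?t = "\<lambda>s. 1 + \<i> * complex_of_real s"
    have "(\<lambda>n. CLBINT s. exp (?t s ^ 3 / 3 - X n * ?t s)) \<longlonglongrightarrow> (CLBINT s. exp (?t s ^ 3 / 3 - \<zeta> * ?t s))"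
    proof (rule integral_dominated_convergence[where w = "\<lambda>s. exp ((1 / 3 + R) + R * \<bar>s\<bar> - s\<^sup>2 / (2 * (1 / 2)))"])
      show "integrable lborel (\<lambda>s. exp ((1 / 3 + R) + R * \<bar>s\<bar> - s\<^sup>2 / (2 * (1 / 2))))"
        by (rule integrable_exp_abs_gauss) simp
      show "AE s in lborel. (\<lambda>n. exp (?t s ^ 3 / 3 - X n * ?t s)) \<longlonglongrightarrow> exp (?t s ^ 3 / 3 - \<zeta> * ?t s)"
        by (intro AE_I2 tendsto_intros X)
      show "AE s in lborel. norm (exp (?t s ^ 3 / 3 - X n * ?t s)) \<le> exp ((1 / 3 + R) + R * \<bar>s\<bar> - s\<^sup>2 / (2 * (1 / 2)))" for n
      proof (rule AE_I2)
        fix s :: real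
        have "Re (?t s ^ 3) = 1 - 3 * s\<^sup>2" by (simp add: power3_eq_cube power2_eq_square algebra_simps)
        then have 1: "Re (?t s ^ 3 / 3) = 1 / 3 - s\<^sup>2" by (simp add: Re_divide_numeral)
        have "- Re (X n * ?t s) \<le> norm (X n * ?t s)" using abs_Re_le_cmod[of "X n * ?t s"] by linarith
        also have "\<dots> \<le> R * (1 + \<bar>s\<bar>)"
          unfolding norm_mult using norm_triangle_ineq[of 1 "\<i> * complex_of_real s"] order.trans[OF norm_ge_zero R[of n]]
          by (intro mult_mono R) (simp_all add: norm_mult)
        finally have "Re (?t s ^ 3 / 3 - X n * ?t s) \<le> (1 / 3 + R) + R * \<bar>s\<bar> - s\<^sup>2"
          using 1 by (simp add: algebra_simps)
        then show "norm (exp (?t s ^ 3 / 3 - X n * ?t s)) \<le> exp ((1 / 3 + R) + R * \<bar>s\<bar> - s\<^sup>2 / (2 * (1 / 2)))"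
          by simp
      qed
    qed measurable
    then show "(Airy_Ai \<circ> X) \<longlonglongrightarrow> Airy_Ai \<zeta>"
      unfolding comp_def Airy_Ai_def by (intro tendsto_mult_left)
  qed
  then show ?thesis by (rule continuous_on_subset) simp
qed


section \<open>Riemann sums and uniform convergence\<close>

lemma has_bochner_integral_power_exp:
  "has_bochner_integral lborel (\<lambda>x::real. indicator {0..} x * (x ^ k * exp (- x))) (fact k)"
proof (rule has_bochner_integral_nn_integral)
  have "(\<integral>\<^sup>+x. ennreal (indicator {0..} x * (x ^ k * exp (- x))) \<partial>lborel) =
      (\<integral>\<^sup>+x. ennreal (x ^ k * exp (- x)) * indicator {0 ..} x \<partial>(lborel :: real measure))"
    by (intro nn_integral_cong) (simp split: split_indicator)
  then show "(\<integral>\<^sup>+x. ennreal (indicator {0..} x * (x ^ k * exp (- x))) \<partial>(lborel :: real measure)) = ennreal (fact k)"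
    using nn_intergal_power_times_exp_Ici[of k] by simp
  show "AE x in (lborel :: real measure). 0 \<le> indicator {0..} x * (x ^ k * exp (- x))"
    by (intro AE_I2) (simp split: split_indicator)
  show "(\<lambda>x::real. indicator {0..} x * (x ^ k * exp (- x))) \<in> borel_measurable lborel"
    by (intro borel_measurable_times borel_measurable_indicator borel_measurable_power borel_measurable_exp) simp_all
qed simp

lemma integrable_exp_neg:
  fixes \<beta> :: real
  assumes "\<beta> > 0"
  shows "integrable lborel (\<lambda>x::real. indicator {0..} x * exp (- \<beta> * x))"
proof -
  have "integrable lborel (\<lambda>x::real. indicator {0..} x * (x ^ 0 * exp (- x)))"
    using has_bochner_integral_power_exp by (rule integrable.intros)
  then have "integrable lborel (\<lambda>x::real. indicator {0..} (0 + \<beta> * x) * ((0 + \<beta> * x) ^ 0 * exp (- (0 + \<beta> * x))))"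
    using assms by (intro lborel_integrable_real_affine) auto
  moreover have "indicator {0..} (0 + \<beta> * x) = (indicator {0..} x :: real)" for x
    using assms by (simp add: indicator_def zero_le_mult_iff)
  ultimately show ?thesis by simp
qed

lemma one_plus_le_exp_square_nonpos:
  fixes u :: real
  assumes "u \<le> 0" "-1 \<le> u"
  shows "1 + u \<le> exp (u - u\<^sup>2 / 2)"
proof (cases "u = -1")
  case False
  then have u: "-1 < u" using assms by simp
  have "0 - 0\<^sup>2 / 2 - ln (1 + 0) \<le> u - u\<^sup>2 / 2 - ln (1 + u)"
  proof (rule DERIV_nonpos_imp_nonincreasing[OF assms(1), where f = "\<lambda>u. u - u\<^sup>2 / 2 - ln (1 + u)"])
    fix y :: real assume y: "u \<le> y" "y \<le> 0"
    then have y1: "1 + y > 0" using u by simp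
    have "((\<lambda>u. u - u\<^sup>2 / 2 - ln (1 + u)) has_real_derivative (1 - y - 1 / (1 + y))) (at y)"
      using y1 by (auto intro!: derivative_eq_intros)
    moreover have "1 - y - 1 / (1 + y) \<le> 0"
    proof -
      have "(1 - y) * (1 + y) \<le> 1" by (simp add: algebra_simps)
      then show ?thesis using y1 by (simp add: pos_le_divide_eq)
    qed
    ultimately show "\<exists>D. ((\<lambda>u. u - u\<^sup>2 / 2 - ln (1 + u)) has_real_derivative D) (at y) \<and> D \<le> 0" by blast
  qed
  then have "ln (1 + u) \<le> u - u\<^sup>2 / 2" by simp
  then have "exp (ln (1 + u)) \<le> exp (u - u\<^sup>2 / 2)" by simp
  then show ?thesis using u by simp
qed simp

lemma one_plus_le_exp_nonneg:
  fixes u :: real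
  assumes "u \<ge> 0"
  shows "1 + u \<le> exp (u - u\<^sup>2 / (2 * (1 + u)))"
proof -
  have "((1 + 0) - 1 / (1 + 0)) / 2 - ln (1 + 0) \<le> ((1 + u) - 1 / (1 + u)) / 2 - ln (1 + u)"
  proof (rule DERIV_nonneg_imp_nondecreasing[OF assms, where f = "\<lambda>u. ((1 + u) - 1 / (1 + u)) / 2 - ln (1 + u)"])
    fix y :: real assume y: "0 \<le> y"
    have "((\<lambda>u. ((1 + u) - 1 / (1 + u)) / 2 - ln (1 + u)) has_real_derivative ((1 + (1 / (1 + y))\<^sup>2) / 2 - 1 / (1 + y))) (at y)"
      using y by (auto intro!: derivative_eq_intros simp: power2_eq_square)
    moreover have "(1 + w\<^sup>2) / 2 - w = (1 - w)\<^sup>2 / 2" for w :: real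
      by (simp add: power2_diff field_simps)
    ultimately have "((\<lambda>u. ((1 + u) - 1 / (1 + u)) / 2 - ln (1 + u)) has_real_derivative ((1 - 1 / (1 + y))\<^sup>2 / 2)) (at y)"
      by (simp only:)
    then show "\<exists>D. ((\<lambda>u. ((1 + u) - 1 / (1 + u)) / 2 - ln (1 + u)) has_real_derivative D) (at y) \<and> 0 \<le> D"
      by (intro exI[of _ "(1 - 1 / (1 + y))\<^sup>2 / 2"]) simp
  qed
  moreover have "((1 + u) - 1 / (1 + u)) / 2 = u - u\<^sup>2 / (2 * (1 + u))"
    using assms by (simp add: field_simps power2_eq_square)
  ultimately have "ln (1 + u) \<le> u - u\<^sup>2 / (2 * (1 + u))" by simp
  then have "exp (ln (1 + u)) \<le> exp (u - u\<^sup>2 / (2 * (1 + u)))" by simp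
  then show ?thesis using assms by simp
qed

text \<open>For negative \<open>s\<close> the second order bound on the logarithm already gives
  Gaussian decay. For positive \<open>s\<close> only \<open>s\<^sup>2 / (2 * (1 + u))\<close> is
  available; there \<open>u \<le> s\<close>, since \<open>sqrt n \<ge> 1\<close>, which leaves
  exponential decay. A common majorant independent of \<open>n\<close> results.\<close>

lemma stirling_integrand_bound:
  fixes s :: real
  assumes n: "n > 0" and s: "- sqrt n \<le> s"
  shows "(1 + s / sqrt (real n)) ^ n * exp (- (sqrt (real n) * s)) \<le> exp (- (1 / 2) * (\<bar>s\<bar> - 1))"
proof -
  define r where "r = sqrt (real n)"
  have r: "r > 0" "r * r = real n" "r \<ge> 1" using n by (simp_all add: r_def)
  define u where "u = s / r"
  have s_eq: "s = r * u" using r by (simp add: u_def)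
  have u: "-1 \<le> u" using s r by (simp add: u_def r_def[symmetric] field_simps)
  have key: "(1 + u) ^ n * exp (- (r * s)) \<le> exp (real n * v - r * s)" if "1 + u \<le> exp v" for v
  proof -
    have "(1 + u) ^ n \<le> exp v ^ n" using that u by (intro power_mono) auto
    then have "(1 + u) ^ n * exp (- (r * s)) \<le> exp (real n * v) * exp (- (r * s))"
      by (intro mult_right_mono) (simp_all add: exp_of_nat_mult)
    then show ?thesis by (simp add: mult_exp_exp)
  qed
  have "(1 + u) ^ n * exp (- (r * s)) \<le> exp (- (1 / 2) * (\<bar>s\<bar> - 1))"
  proof (cases "s \<ge> 0")
    case True
    then have u0: "u \<ge> 0" using r by (simp add: u_def)
    have "real n * (u - u\<^sup>2 / (2 * (1 + u))) - r * s = - (s\<^sup>2 / (2 * (1 + u)))"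
      using u0 by (simp add: s_eq r(2)[symmetric] power_mult_distrib right_diff_distrib) (simp add: power2_eq_square)
    moreover have "s\<^sup>2 / (2 * (1 + u)) \<ge> s\<^sup>2 / (2 * (1 + s))"
    proof -
      have "u \<le> s" using True r(3) mult_right_mono[of 1 r u] u0 by (simp add: s_eq)
      then show ?thesis using u0 by (intro divide_left_mono mult_pos_pos) auto
    qed
    moreover have "s\<^sup>2 / (2 * (1 + s)) \<ge> (s - 1) / 2"
    proof -
      have "(s - 1) / 2 = (s\<^sup>2 - 1) / (2 * (1 + s))" using True by (simp add: field_simps power2_eq_square)
      also have "\<dots> \<le> s\<^sup>2 / (2 * (1 + s))" using True by (intro divide_right_mono) auto
      finally show ?thesis .
    qed
    ultimately have "real n * (u - u\<^sup>2 / (2 * (1 + u))) - r * s \<le> - (1 / 2) * (\<bar>s\<bar> - 1)"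
      using True by (simp add: diff_divide_distrib)
    then show ?thesis using key[OF one_plus_le_exp_nonneg[OF u0]] by (meson exp_le_cancel_iff order.trans)
  next
    case False
    then have u0: "u \<le> 0" using r by (simp add: u_def divide_nonpos_pos)
    have "real n * (u - u\<^sup>2 / 2) - r * s = - (s\<^sup>2 / 2)"
      by (simp add: s_eq r(2)[symmetric] power_mult_distrib right_diff_distrib) (simp add: power2_eq_square)
    also have "\<dots> \<le> - (1 / 2) * (\<bar>s\<bar> - 1)"
    proof -
      have "0 \<le> (\<bar>s\<bar> - 1)\<^sup>2 + \<bar>s\<bar>" by simp
      then have "\<bar>s\<bar> - 1 \<le> s\<^sup>2" by (simp add: power2_diff)
      then show ?thesis by simp
    qed
    finally show ?thesis
      using key[OF one_plus_le_exp_square_nonpos[OF u0 u]] by (meson exp_le_cancel_iff order.trans)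
  qed
  then show ?thesis by (simp add: u_def r_def)
qed

text \<open>The integral for \<open>n!\<close> is recentred at the maximum \<open>x = n\<close> of
  its integrand and scaled by the width \<open>sqrt n\<close>; dominated convergence then leads to
  the Gaussian integral. The quotient is kept in the form in which it enters the kernel.\<close>

lemma stirling_tendsto:
  "(\<lambda>n. real n ^ n * exp (- real n) * sqrt (real n) / fact n) \<longlonglongrightarrow> 1 / sqrt (2 * pi)"
proof -
  define f where "f n s = indicator {- sqrt (real n)..} s * ((1 + s / sqrt (real n)) ^ n * exp (- (sqrt (real n) * s)))" for n :: nat and s :: real
  have f_int: "(\<integral>s. f n s \<partial>lborel) = fact n / (real n ^ n * exp (- real n) * sqrt (real n))" if "n > 0" for n
  proof -
    define r where "r = sqrt (real n)"
    have r: "r > 0" "real n = r * r" using that by (simp_all add: r_def)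
    have "fact n = (\<integral>x. indicator {0..} x * (x ^ n * exp (- x)) \<partial>(lborel :: real measure))"
      by (rule has_bochner_integral_integral_eq[OF has_bochner_integral_power_exp, symmetric])
    also have "\<dots> = r * (\<integral>s. indicator {0..} (real n + r * s) * ((real n + r * s) ^ n * exp (- (real n + r * s))) \<partial>lborel)"
      using r(1) by (subst lborel_integral_real_affine[where c = r and t = "real n"]) simp_all
    also have "(\<lambda>s. indicator {0..} (real n + r * s) * ((real n + r * s) ^ n * exp (- (real n + r * s)))) =
       (\<lambda>s. real n ^ n * exp (- real n) * f n s)"
    proof
      fix s
      have eq: "real n + r * s = r * (r + s)" "real n + r * s = real n * (1 + s / r)"
        unfolding r(2) using r(1) by (simp_all add: field_simps)
      have "0 \<le> r * (r + s) \<longleftrightarrow> - r \<le> s" using r(1) by (auto simp: zero_le_mult_iff)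
      then have ind: "indicator {0..} (real n + r * s) = (indicator {- r..} s :: real)"
        unfolding eq(1) by (simp add: indicator_def)
      have ex: "exp (- (real n + r * s)) = exp (- real n) * exp (- (r * s))"
        by (simp add: mult_exp_exp)
      have pw: "(real n + r * s) ^ n = real n ^ n * (1 + s / r) ^ n"
        by (simp only: eq(2) power_mult_distrib)
      show "indicator {0..} (real n + r * s) * ((real n + r * s) ^ n * exp (- (real n + r * s))) = real n ^ n * exp (- real n) * f n s"
        unfolding ind ex pw f_def r_def[symmetric] by simp
    qed
    finally show ?thesis using r that by (simp add: field_simps r_def[symmetric])
  qed
  have maj: "integrable lborel (\<lambda>s::real. exp (- (1 / 2) * (\<bar>s\<bar> - 1)))"
  proof (rule Bochner_Integration.integrable_bound)
    let ?g = "\<lambda>s::real. indicator {0..} s * exp (- (1 / 2) * s)"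
    have g: "integrable lborel ?g" by (rule integrable_exp_neg) simp
    have g': "integrable lborel (\<lambda>s. ?g (0 + (- 1) * s))" by (rule lborel_integrable_real_affine[OF g]) simp
    show "integrable lborel (\<lambda>s. exp (1 / 2) * (?g s + ?g (0 + (- 1) * s)))"
      by (intro integrable_mult_right Bochner_Integration.integrable_add g g')
    have "exp (- (1 / 2) * (\<bar>s\<bar> - 1)) = exp (1 / 2) * exp (- (1 / 2) * \<bar>s\<bar>)" for s :: real
      by (simp add: mult_exp_exp field_simps)
    then show "AE s in lborel. norm (exp (- (1 / 2) * (\<bar>s\<bar> - 1))) \<le> norm (exp (1 / 2) * (?g s + ?g (0 + (- 1) * s)))"
      by (intro AE_I2) (auto simp: abs_mult indicator_def abs_if)
  qed measurable
  \<comment> \<open>Successors are used because the scaling by \<open>sqrt n\<close> degenerates at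
    zero, where neither \<open>f_int\<close> nor the bound holds.\<close>
  have "(\<lambda>n. \<integral>s. f (Suc n) s \<partial>lborel) \<longlonglongrightarrow> (\<integral>s. exp (- (s\<^sup>2) / 2) \<partial>(lborel :: real measure))"
  proof (rule integral_dominated_convergence[OF _ _ maj])
    show "AE s in lborel. norm (f (Suc n) s) \<le> exp (- (1 / 2) * (\<bar>s\<bar> - 1))" for n
    proof (rule AE_I2)
      fix s :: real
      show "norm (f (Suc n) s) \<le> exp (- (1 / 2) * (\<bar>s\<bar> - 1))"
      proof (cases "- sqrt (real (Suc n)) \<le> s")
        case True
        have "1 + s / sqrt (real (Suc n)) \<ge> 0" using True by (simp add: field_simps)
        then have "norm (f (Suc n) s) = (1 + s / sqrt (real (Suc n))) ^ Suc n * exp (- (sqrt (real (Suc n)) * s))"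
          using True by (simp add: f_def abs_mult power_abs del: of_nat_Suc power_Suc)
        then show ?thesis using stirling_integrand_bound[of "Suc n" s] True by simp
      qed (simp add: f_def)
    qed
    show "AE s in lborel. (\<lambda>n. f (Suc n) s) \<longlonglongrightarrow> exp (- (s\<^sup>2) / 2)"
    proof (rule AE_I2)
      fix s :: real
      have "(\<lambda>n. (1 + s / sqrt (real n)) ^ n * exp (- (sqrt (real n) * s))) \<longlonglongrightarrow> exp (- (s\<^sup>2) / 2)"
        by (cases s "0 :: real" rule: linorder_cases; real_asymp simp: power2_eq_square)
      moreover have "\<forall>\<^sub>F n in sequentially. - sqrt (real n) \<le> s"
      proof -
        have "\<forall>\<^sub>F n in sequentially. sqrt (real n) \<ge> - s"
          using filterlim_compose[OF sqrt_at_top filterlim_real_sequentially] by (simp add: filterlim_at_top)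
        then show ?thesis by eventually_elim simp
      qed
      then have "\<forall>\<^sub>F n in sequentially. (1 + s / sqrt (real n)) ^ n * exp (- (sqrt (real n) * s)) = f n s"
        by eventually_elim (simp add: f_def)
      ultimately have "(\<lambda>n. f n s) \<longlonglongrightarrow> exp (- (s\<^sup>2) / 2)" by (rule Lim_transform_eventually)
      then show "(\<lambda>n. f (Suc n) s) \<longlonglongrightarrow> exp (- (s\<^sup>2) / 2)" by (rule LIMSEQ_Suc)
    qed
  qed (unfold f_def, measurable)
  moreover have "(\<integral>s. exp (- (s\<^sup>2) / 2) \<partial>(lborel :: real measure)) = sqrt (2 * pi)"
  proof -
    have "(\<lambda>s::real. exp (- (s\<^sup>2) / 2)) = (\<lambda>s. sqrt (2 * pi) * std_normal_density s)"
      by (simp add: std_normal_density_def)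
    then show ?thesis by simp
  qed
  ultimately have "(\<lambda>n. 1 / (\<integral>s. f (Suc n) s \<partial>lborel)) \<longlonglongrightarrow> 1 / sqrt (2 * pi)"
    by (auto intro!: tendsto_intros)
  moreover have "1 / (\<integral>s. f (Suc n) s \<partial>lborel) = real (Suc n) ^ Suc n * exp (- real (Suc n)) * sqrt (real (Suc n)) / fact (Suc n)" for n
    unfolding f_int[OF zero_less_Suc] by simp
  ultimately have "(\<lambda>n. real (Suc n) ^ Suc n * exp (- real (Suc n)) * sqrt (real (Suc n)) / fact (Suc n)) \<longlonglongrightarrow> 1 / sqrt (2 * pi)"
    by (simp only:)
  then show ?thesis by (rule LIMSEQ_imp_Suc)
qed


section \<open>Double Riemann sums by dominated convergence\<close>

lemma has_bochner_integral_step: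
  fixes f :: "nat \<Rightarrow> complex" and \<Delta> :: real
  assumes "\<Delta> > 0"
  shows "has_bochner_integral lborel (\<lambda>x. indicator {0..<real n * \<Delta>} x *\<^sub>R f (nat \<lfloor>x / \<Delta>\<rfloor>)) (of_real \<Delta> * (\<Sum>i<n. f i))"
proof (induction n)
  case (Suc n)
  have "indicator {0..<real (Suc n) * \<Delta>} x *\<^sub>R f (nat \<lfloor>x / \<Delta>\<rfloor>) =
      indicator {0..<real n * \<Delta>} x *\<^sub>R f (nat \<lfloor>x / \<Delta>\<rfloor>) + indicator {real n * \<Delta>..<real (Suc n) * \<Delta>} x *\<^sub>R f n" for x
  proof (cases "x \<in> {real n * \<Delta>..<real (Suc n) * \<Delta>}")
    case True
    then have "real n \<le> x / \<Delta>" "x / \<Delta> < real n + 1"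
      using assms by (simp_all add: field_simps)
    then have "\<lfloor>x / \<Delta>\<rfloor> = int n" by (intro floor_unique) auto
    moreover have "0 \<le> x" using True assms by (auto intro: order.trans[rotated])
    ultimately show ?thesis using True by simp
  next
    case False
    moreover have "real n * \<Delta> \<le> real (Suc n) * \<Delta>" using assms by simp
    ultimately have "x \<in> {0..<real (Suc n) * \<Delta>} \<longleftrightarrow> x \<in> {0..<real n * \<Delta>}" by auto
    with False show ?thesis by (simp add: indicator_def del: of_nat_Suc)
  qed
  moreover have "has_bochner_integral lborel (\<lambda>x. indicator {real n * \<Delta>..<real (Suc n) * \<Delta>} x *\<^sub>R f n) (of_real \<Delta> * f n)"
    using has_bochner_integral_indicator[of "{real n * \<Delta>..<real (Suc n) * \<Delta>}" lborel "f n"] assms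
    by (simp add: scaleR_conv_of_real distrib_right)
  ultimately show ?case
    using has_bochner_integral_add[OF Suc] by (simp add: distrib_left)
qed (simp add: has_bochner_integral_iff)

lemma floor_index_bounds:
  fixes x \<Delta> :: real
  assumes "\<Delta> > 0" "x \<ge> 0"
  shows "real (nat \<lfloor>x / \<Delta>\<rfloor>) * \<Delta> \<le> x" "x < (real (nat \<lfloor>x / \<Delta>\<rfloor>) + 1) * \<Delta>"
proof -
  have "0 \<le> x / \<Delta>" using assms by simp
  then have "real (nat \<lfloor>x / \<Delta>\<rfloor>) = of_int \<lfloor>x / \<Delta>\<rfloor>" by simp
  then have "real (nat \<lfloor>x / \<Delta>\<rfloor>) \<le> x / \<Delta>" "x / \<Delta> < real (nat \<lfloor>x / \<Delta>\<rfloor>) + 1" by linarith+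
  then show "real (nat \<lfloor>x / \<Delta>\<rfloor>) * \<Delta> \<le> x" "x < (real (nat \<lfloor>x / \<Delta>\<rfloor>) + 1) * \<Delta>"
    by (simp_all only: pos_le_divide_eq[OF assms(1)] pos_divide_less_eq[OF assms(1)])
qed

lemma floor_index_tendsto:
  fixes \<Delta> :: "nat \<Rightarrow> real"
  assumes \<Delta>: "\<And>N. \<Delta> N > 0" "\<Delta> \<longlonglongrightarrow> 0" and x: "x \<ge> 0"
  shows "(\<lambda>N. real (nat \<lfloor>x / \<Delta> N\<rfloor>) * \<Delta> N) \<longlonglongrightarrow> x"
proof (rule tendsto_sandwich)
  show "\<forall>\<^sub>F N in sequentially. x - \<Delta> N \<le> real (nat \<lfloor>x / \<Delta> N\<rfloor>) * \<Delta> N"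
    using floor_index_bounds(2)[OF \<Delta>(1) x] by (intro always_eventually allI) (simp add: distrib_right less_imp_le diff_le_eq)
  show "\<forall>\<^sub>F N in sequentially. real (nat \<lfloor>x / \<Delta> N\<rfloor>) * \<Delta> N \<le> x"
    using floor_index_bounds(1)[OF \<Delta>(1) x] by (intro always_eventually allI)
  show "(\<lambda>N. x - \<Delta> N) \<longlonglongrightarrow> x" using tendsto_diff[OF tendsto_const \<Delta>(2), of x] by simp
qed simp

text \<open>The sample point is the left end of the mesh cell and lags behind \<open>x\<close> by at
  most \<open>D\<close>; in the exponential this costs the factor
  \<open>exp (\<beta> * D)\<close>.\<close>

lemma step_bound:
  fixes x \<Delta> \<beta> K D :: real
  assumes \<Delta>: "\<Delta> > 0" "\<Delta> \<le> D" and "\<beta> > 0" and F: "norm z \<le> K * exp (- \<beta> * (real (nat \<lfloor>x / \<Delta>\<rfloor>) * \<Delta>))" and "K \<ge> 0"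
  shows "norm (indicator {0..<y} x *\<^sub>R z) \<le> K * exp (\<beta> * D) * (indicator {0..} x * exp (- \<beta> * x))"
proof (cases "x \<in> {0..<y}")
  case True
  then have "x < (real (nat \<lfloor>x / \<Delta>\<rfloor>) + 1) * \<Delta>" using floor_index_bounds(2)[of \<Delta> x] assms by auto
  then have "x - D \<le> real (nat \<lfloor>x / \<Delta>\<rfloor>) * \<Delta>" using \<Delta> by (simp add: distrib_right)
  then have "\<beta> * (x - D) \<le> \<beta> * (real (nat \<lfloor>x / \<Delta>\<rfloor>) * \<Delta>)" using \<open>\<beta> > 0\<close> by simp
  then have "exp (- \<beta> * (real (nat \<lfloor>x / \<Delta>\<rfloor>) * \<Delta>)) \<le> exp (\<beta> * D + - \<beta> * x)" by (simp add: algebra_simps)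
  then have "K * exp (- \<beta> * (real (nat \<lfloor>x / \<Delta>\<rfloor>) * \<Delta>)) \<le> K * (exp (\<beta> * D) * exp (- \<beta> * x))"
    using \<open>K \<ge> 0\<close> unfolding exp_add by (rule mult_left_mono)
  then show ?thesis using True F by (simp add: mult.assoc)
next
  case False
  then have "norm (indicator {0..<y} x *\<^sub>R z) = 0" by simp
  also have "0 \<le> K * exp (\<beta> * D) * (indicator {0..} x * exp (- \<beta> * x))" using \<open>K \<ge> 0\<close> by simp
  finally show ?thesis .
qed

text \<open>Both sums become integrals of step functions, and dominated convergence is applied
  twice: for fixed \<open>y\<close> to the inner sum, whose values are bounded by one constant, and
  then to the outer sum. Convergence along every index sequence with rescaled limit \<open>x\<close>
  is exactly the pointwise hypothesis needed, and it replaces any uniformity or continuity of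
  \<open>F\<close> and \<open>G\<close>.\<close>

lemma nested_riemann_sum_tendsto:
  fixes F G :: "nat \<Rightarrow> nat \<Rightarrow> complex" and f g :: "real \<Rightarrow> complex" and \<Delta> :: "nat \<Rightarrow> real" and L :: "nat \<Rightarrow> nat"
  assumes \<Delta>: "\<And>N. \<Delta> N > 0" "\<Delta> \<longlonglongrightarrow> 0" and L: "filterlim (\<lambda>N. real (L N) * \<Delta> N) at_top sequentially"
    and F: "\<And>N i. norm (F N i) \<le> K * exp (- \<beta> * (real i * \<Delta> N))"
    and G: "\<And>N i. norm (G N i) \<le> K * exp (- \<beta> * (real i * \<Delta> N))"
    and \<beta>: "\<beta> > 0"
    and f: "\<And>x I. x > 0 \<Longrightarrow> (\<lambda>N. real (I N) * \<Delta> N) \<longlonglongrightarrow> x \<Longrightarrow> (\<lambda>N. F N (I N)) \<longlonglongrightarrow> f x"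
    and g: "\<And>x I. x > 0 \<Longrightarrow> (\<lambda>N. real (I N) * \<Delta> N) \<longlonglongrightarrow> x \<Longrightarrow> (\<lambda>N. G N (I N)) \<longlonglongrightarrow> g x"
    and [measurable]: "f \<in> borel_measurable borel" "g \<in> borel_measurable borel"
    and exp_int: "integrable lborel (\<lambda>x::real. indicator {0..} x * exp (- \<beta> * x))"
  shows "(\<lambda>N. of_real ((\<Delta> N)\<^sup>2) * (\<Sum>l<L N. \<Sum>i\<le>l. F N i * G N l)) \<longlonglongrightarrow>
    (\<integral>y. indicator {0..} y *\<^sub>R (g y * (\<integral>x. indicator {0..y} x *\<^sub>R f x \<partial>lborel)) \<partial>lborel)" (is ?lim)
    and "integrable lborel (\<lambda>y. indicator {0..} y *\<^sub>R (g y * (\<integral>x. indicator {0..y} x *\<^sub>R f x \<partial>lborel)))" (is ?int)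
proof -
  define idx where "idx N x = nat \<lfloor>x / \<Delta> N\<rfloor>" for N and x :: real
  obtain D where D: "\<And>N. \<Delta> N \<le> D"
    using convergent_imp_Bseq[OF convergentI[OF \<Delta>(2)]] by (auto simp: Bseq_def) (metis abs_le_iff)
  have K: "K \<ge> 0" using order.trans[OF norm_ge_zero F[of 0 0]] by simp
  define w where "w x = K * exp (\<beta> * D) * (indicator {0..} x * exp (- \<beta> * x))" for x
  have w_int: "integrable lborel w" unfolding w_def by (intro integrable_mult_right exp_int)
  define S where "S N l = of_real (\<Delta> N) * (\<Sum>i<Suc l. F N i)" for N l
  have S_step: "has_bochner_integral lborel (\<lambda>x. indicator {0..<real (Suc l) * \<Delta> N} x *\<^sub>R F N (idx N x)) (S N l)" for N l
    unfolding S_def idx_def by (rule has_bochner_integral_step[OF \<Delta>(1)])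
  have F_bound: "norm (indicator {0..<y} x *\<^sub>R F N (idx N x)) \<le> w x" for N x y
    unfolding w_def idx_def by (rule step_bound[OF \<Delta>(1) D \<beta> F K])
  define C where "C = (\<integral>x. w x \<partial>lborel)"
  have S_bound: "norm (S N l) \<le> C" for N l
  proof -
    have "norm (\<integral>x. indicator {0..<real (Suc l) * \<Delta> N} x *\<^sub>R F N (idx N x) \<partial>lborel) \<le> C"
      unfolding C_def using S_step[of l N]
      by (intro Bochner_Integration.integral_norm_bound_integral w_int F_bound) (auto simp: has_bochner_integral_iff)
    then show ?thesis using has_bochner_integral_integral_eq[OF S_step[of l N]] by simp
  qed
  have C: "C \<ge> 0" using order.trans[OF norm_ge_zero S_bound[of 0 0]] .
  have lim_idx: "(\<lambda>N. real (idx N x) * \<Delta> N) \<longlonglongrightarrow> x" if "x \<ge> 0" for x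
    unfolding idx_def by (rule floor_index_tendsto[OF \<Delta> that])
  have S_lim: "(\<lambda>N. S N (idx N y)) \<longlonglongrightarrow> (\<integral>x. indicator {0..y} x *\<^sub>R f x \<partial>lborel)" if y: "y > 0" for y
  proof -
    have "(\<lambda>N. \<integral>x. indicator {0..<real (Suc (idx N y)) * \<Delta> N} x *\<^sub>R F N (idx N x) \<partial>lborel) \<longlonglongrightarrow> (\<integral>x. indicator {0..y} x *\<^sub>R f x \<partial>lborel)"
    proof (rule integral_dominated_convergence[OF _ _ w_int])
      show "(\<lambda>x. indicator {0..<real (Suc (idx N y)) * \<Delta> N} x *\<^sub>R F N (idx N x)) \<in> borel_measurable lborel" for N
        using S_step[of "idx N y" N] by (auto simp: has_bochner_integral_iff)
      show "AE x in lborel. norm (indicator {0..<real (Suc (idx N y)) * \<Delta> N} x *\<^sub>R F N (idx N x)) \<le> w x" for N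
        using F_bound by simp
      \<comment> \<open>Convergence is assumed at positive points only, so the origin is discarded
        as a null set. The point \<open>x = y\<close> belongs to the case \<open>x \<le> y\<close>,
        because the diagonal cell is included in the inner sum.\<close>
      have "AE x in lborel. x \<noteq> (0::real)" by (rule AE_lborel_singleton)
      then show "AE x in lborel. (\<lambda>N. indicator {0..<real (Suc (idx N y)) * \<Delta> N} x *\<^sub>R F N (idx N x)) \<longlonglongrightarrow> indicator {0..y} x *\<^sub>R f x"
      proof eventually_elim
        case (elim x)
        consider "x < 0" | "0 < x" "x \<le> y" | "0 < x" "y < x" using elim by linarith
        then show ?case
        proof cases
          case 1
          then show ?thesis by simp
        next
          case 2
          have "x < real (Suc (idx N y)) * \<Delta> N" for N
            using floor_index_bounds(2)[OF \<Delta>(1)[of N], of y] 2 by (simp add: idx_def add.commute)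
          then show ?thesis using 2 f[OF 2(1) lim_idx] by simp
        next
          case 3
          have "(\<lambda>N. real (idx N y) * \<Delta> N + \<Delta> N) \<longlonglongrightarrow> y + 0"
            using y by (intro tendsto_add lim_idx \<Delta>(2)) simp
          then have lim: "(\<lambda>N. real (idx N y) * \<Delta> N + \<Delta> N) \<longlonglongrightarrow> y" by simp
          have "\<forall>\<^sub>F N in sequentially. real (idx N y) * \<Delta> N + \<Delta> N < x"
            by (rule order_tendstoD(2)[OF lim 3(2)])
          then have "\<forall>\<^sub>F N in sequentially. 0 = indicator {0..<real (Suc (idx N y)) * \<Delta> N} x *\<^sub>R F N (idx N x)"
            by eventually_elim (simp add: distrib_right add.commute)
          then have "(\<lambda>N. indicator {0..<real (Suc (idx N y)) * \<Delta> N} x *\<^sub>R F N (idx N x)) \<longlonglongrightarrow> 0"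
            by (rule Lim_transform_eventually[OF tendsto_const])
          then show ?thesis using 3 by simp
        qed
      qed
    qed measurable
    then show ?thesis using has_bochner_integral_integral_eq[OF S_step] by simp
  qed
  have outer: "has_bochner_integral lborel (\<lambda>y. indicator {0..<real (L N) * \<Delta> N} y *\<^sub>R (G N (idx N y) * S N (idx N y)))
      (of_real ((\<Delta> N)\<^sup>2) * (\<Sum>l<L N. \<Sum>i\<le>l. F N i * G N l))" for N
  proof -
    have "of_real (\<Delta> N) * (\<Sum>l<L N. G N l * S N l) = of_real ((\<Delta> N)\<^sup>2) * (\<Sum>l<L N. \<Sum>i\<le>l. F N i * G N l)"
      unfolding S_def by (simp add: sum_distrib_left sum_distrib_right lessThan_Suc_atMost power2_eq_square mult_ac)
    then show ?thesis
      using has_bochner_integral_step[OF \<Delta>(1)[of N], of "L N" "\<lambda>l. G N l * S N l"] by (simp add: idx_def)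
  qed
    have dom_int: "integrable lborel (\<lambda>y. w y * C)" by (intro integrable_mult_left w_int)
    have seq_meas: "(\<lambda>y. indicator {0..<real (L N) * \<Delta> N} y *\<^sub>R (G N (idx N y) * S N (idx N y))) \<in> borel_measurable lborel" for N
      using outer[of N] by (auto simp: has_bochner_integral_iff)
    have dom: "AE y in lborel. norm (indicator {0..<real (L N) * \<Delta> N} y *\<^sub>R (G N (idx N y) * S N (idx N y))) \<le> w y * C" for N
    proof (rule AE_I2)
      fix y :: real
      have "norm (indicator {0..<real (L N) * \<Delta> N} y *\<^sub>R (G N (idx N y) * S N (idx N y))) =
        norm (indicator {0..<real (L N) * \<Delta> N} y *\<^sub>R G N (idx N y)) * norm (S N (idx N y))"
        by (simp add: norm_mult)
      also have "norm (indicator {0..<real (L N) * \<Delta> N} y *\<^sub>R G N (idx N y)) \<le> w y"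
        unfolding w_def idx_def by (rule step_bound[OF \<Delta>(1) D \<beta> G K])
      then have "norm (indicator {0..<real (L N) * \<Delta> N} y *\<^sub>R G N (idx N y)) * norm (S N (idx N y)) \<le> w y * C"
        using S_bound C order.trans[OF norm_ge_zero] by (intro mult_mono) blast+
      finally show "norm (indicator {0..<real (L N) * \<Delta> N} y *\<^sub>R (G N (idx N y) * S N (idx N y))) \<le> w y * C" .
    qed
    have "AE y in lborel. y \<noteq> (0::real)" by (rule AE_lborel_singleton)
    then have ae_lim: "AE y in lborel. (\<lambda>N. indicator {0..<real (L N) * \<Delta> N} y *\<^sub>R (G N (idx N y) * S N (idx N y))) \<longlonglongrightarrow>
       indicator {0..} y *\<^sub>R (g y * (\<integral>x. indicator {0..y} x *\<^sub>R f x \<partial>lborel))"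
    proof eventually_elim
      case (elim y)
      show ?case
      proof (cases "y > 0")
        case True
        have "(\<lambda>N. G N (idx N y) * S N (idx N y)) \<longlonglongrightarrow> g y * (\<integral>x. indicator {0..y} x *\<^sub>R f x \<partial>lborel)"
          using True by (intro tendsto_mult g S_lim lim_idx) auto
        moreover have "\<forall>\<^sub>F N in sequentially. real (L N) * \<Delta> N > y"
          using L by (simp add: filterlim_at_top_dense)
        then have "\<forall>\<^sub>F N in sequentially. G N (idx N y) * S N (idx N y) = indicator {0..<real (L N) * \<Delta> N} y *\<^sub>R (G N (idx N y) * S N (idx N y))"
          by eventually_elim (use True in simp)
        ultimately have "(\<lambda>N. indicator {0..<real (L N) * \<Delta> N} y *\<^sub>R (G N (idx N y) * S N (idx N y))) \<longlonglongrightarrow> g y * (\<integral>x. indicator {0..y} x *\<^sub>R f x \<partial>lborel)"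
          by (rule Lim_transform_eventually)
        then show ?thesis using True by simp
      qed (use elim in simp)
    qed
    \<comment> \<open>As a conditional in both variables the indicator is jointly measurable, which
      makes the inner integral a measurable function of \<open>y\<close>.\<close>
    have ind: "indicator {0..y} x = (if 0 \<le> x \<and> x \<le> y then 1 else 0 :: real)" for x y :: real by simp
    have "(\<lambda>y. \<integral>x. (if 0 \<le> x \<and> x \<le> y then 1 else 0 :: real) *\<^sub>R f x \<partial>lborel) \<in> borel_measurable lborel"
      by measurable
    then have lim_meas: "(\<lambda>y. indicator {0..} y *\<^sub>R (g y * (\<integral>x. indicator {0..y} x *\<^sub>R f x \<partial>lborel))) \<in> borel_measurable lborel"
      unfolding ind by (intro borel_measurable_scaleR borel_measurable_times borel_measurable_indicator) simp_all
  note dct = lim_meas seq_meas dom_int ae_lim dom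
  show ?lim
    using integral_dominated_convergence[OF dct] unfolding has_bochner_integral_integral_eq[OF outer] .
  show ?int
    by (rule integrable_dominated_convergence[OF dct])
qed

section \<open>From convergence along sequences to uniform convergence\<close>

text \<open>Otherwise bad points at distance below \<open>1 / Suc j\<close> exist at arbitrarily
  late indices. Chosen at strictly increasing indices, they are part of one sequence converging to
  \<open>x\<close> along which the assumed convergence fails.\<close>

lemma continuous_convergence_local:
  fixes f :: "nat \<Rightarrow> 'a::metric_space \<Rightarrow> 'b::metric_space"
  assumes conv: "\<And>X x. X \<longlonglongrightarrow> x \<Longrightarrow> (\<lambda>n. f n (X n)) \<longlonglongrightarrow> g x" and e: "e > 0"
  shows "\<exists>d>0. \<exists>n0. \<forall>n\<ge>n0. \<forall>y. dist y x < d \<longrightarrow> dist (f n y) (g x) < e"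
proof (rule ccontr)
  assume "\<not> ?thesis"
  then have neg: "\<And>d n0. d > 0 \<Longrightarrow> \<exists>n\<ge>n0. \<exists>y. dist y x < d \<and> dist (f n y) (g x) \<ge> e"
    by (meson not_less)
  have "\<exists>h. \<forall>j. (dist (snd (h j)) x < 1 / real (Suc j) \<and> dist (f (fst (h j)) (snd (h j))) (g x) \<ge> e) \<and> fst (h j) < fst (h (Suc j))"
  proof (rule dependent_nat_choice)
    show "\<exists>p. dist (snd p) x < 1 / real (Suc 0) \<and> dist (f (fst p) (snd p)) (g x) \<ge> e"
      using neg[of 1 0] by auto
    show "\<exists>q. (dist (snd q) x < 1 / real (Suc (Suc j)) \<and> dist (f (fst q) (snd q)) (g x) \<ge> e) \<and> fst p < fst q" for p :: "nat \<times> 'a" and j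
    proof -
      obtain n y where "n \<ge> Suc (fst p)" "dist y x < 1 / real (Suc (Suc j))" "dist (f n y) (g x) \<ge> e"
        using neg[of "1 / real (Suc (Suc j))" "Suc (fst p)"] by auto
      then show ?thesis by (intro exI[of _ "(n, y)"]) auto
    qed
  qed
  then obtain h where h: "\<And>j. dist (snd (h j)) x < 1 / real (Suc j)" "\<And>j. dist (f (fst (h j)) (snd (h j))) (g x) \<ge> e"
    and mono: "strict_mono (\<lambda>j. fst (h j))"
    by (auto simp: strict_mono_Suc_iff)
  \<comment> \<open>The hypothesis speaks of full sequences, so the gaps between the chosen indices
    are filled with the limit point \<open>x\<close>.\<close>
  define X where "X n = (if n \<in> range (\<lambda>j. fst (h j)) then snd (h (inv (\<lambda>j. fst (h j)) n)) else x)" for n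
  have X: "X (fst (h j)) = snd (h j)" for j
    unfolding X_def using inv_f_f[OF strict_mono_imp_inj_on[OF mono], of j] by simp
  have "X \<longlonglongrightarrow> x"
  proof (rule metric_LIMSEQ_I)
    fix r :: real assume "r > 0"
    then obtain J where J: "1 / real (Suc J) < r" using nat_approx_posE by blast
    have "dist (X n) x < r" if n: "n \<ge> fst (h J)" for n
    proof (cases "n \<in> range (\<lambda>j. fst (h j))")
      case True
      then obtain j where j: "n = fst (h j)" by auto
      then have "J \<le> j" using n strict_mono_less_eq[OF mono, of J j] by simp
      then have "1 / real (Suc j) \<le> 1 / real (Suc J)" by (simp add: frac_le)
      then show ?thesis using h(1)[of j] J X[of j] j by simp
    qed (simp add: X_def \<open>r > 0\<close>)
    then show "\<exists>no. \<forall>n\<ge>no. dist (X n) x < r" by blast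
  qed
  from metric_LIMSEQ_D[OF conv[OF this] e] obtain n0 where n0: "\<And>n. n \<ge> n0 \<Longrightarrow> dist (f n (X n)) (g x) < e" by blast
  have "fst (h n0) \<ge> n0" using mono by (rule strict_mono_imp_increasing)
  from n0[OF this] h(2)[of n0] show False by (simp add: X)
qed

lemma continuous_convergence_imp_uniform_limit:
  fixes f :: "nat \<Rightarrow> 'a::metric_space \<Rightarrow> 'b::metric_space"
  assumes conv: "\<And>X x. X \<longlonglongrightarrow> x \<Longrightarrow> (\<lambda>n. f n (X n)) \<longlonglongrightarrow> g x" and K: "compact K"
  shows "uniform_limit K f g sequentially"
proof (rule uniform_limitI)
  fix e :: real assume e: "e > 0"
  have "\<forall>x. \<exists>d n0. d > 0 \<and> (\<forall>n\<ge>n0. \<forall>y. dist y x < d \<longrightarrow> dist (f n y) (g x) < e / 2)"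
    using continuous_convergence_local[where f = f and g = g, OF conv, of "e / 2"] e by (metis half_gt_zero)
  then obtain d n0 where d: "\<And>x. d x > 0" and n0: "\<And>x n y. n \<ge> n0 x \<Longrightarrow> dist y x < d x \<Longrightarrow> dist (f n y) (g x) < e / 2"
    by metis
  have "K \<subseteq> (\<Union>x\<in>K. ball x (d x))" using d by auto
  then obtain A where A: "A \<subseteq> K" "finite A" "K \<subseteq> (\<Union>x\<in>A. ball x (d x))"
    using compactE_image[OF K, of K "\<lambda>x. ball x (d x)"] by auto
  have "dist (f n y) (g y) < e" if n: "n \<ge> Max (n0 ` A)" and y: "y \<in> K" for n y
  proof -
    obtain x where x: "x \<in> A" "dist y x < d x" using A(3) y by (auto simp: dist_commute)
    have "n0 x \<le> n" using x A n by (meson Max_ge finite_imageI imageI order.trans)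
    then have "dist (f n y) (g x) < e / 2" using n0 x by blast
    \<comment> \<open>The local estimate passes to the limit along the constant sequence
      \<open>y\<close>, so continuity of \<open>g\<close> need not be known beforehand.\<close>
    moreover have "dist (g y) (g x) \<le> e / 2"
    proof (rule tendsto_upperbound)
      show "(\<lambda>n. dist (f n y) (g x)) \<longlonglongrightarrow> dist (g y) (g x)"
        by (intro tendsto_dist conv tendsto_const)
      show "\<forall>\<^sub>F n in sequentially. dist (f n y) (g x) \<le> e / 2"
        using n0[OF _ x(2)] by (auto simp: eventually_sequentially intro!: exI[of _ "n0 x"] less_imp_le)
    qed simp
    ultimately show ?thesis using dist_triangle2[of "f n y" "g y" "g x"] by linarith
  qed
  then show "\<forall>\<^sub>F n in sequentially. \<forall>y\<in>K. dist (f n y) (g y) < e"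
    unfolding eventually_sequentially by blast
qed


section \<open>Convergence of the kernel\<close>

text \<open>The quotient of the double factorials of \<open>2 * N - 1\<close> and
  \<open>2 * N - 1 - 2 * i\<close>, divided by \<open>(2 * N) ^ i\<close>.\<close>

definition falling_odd :: "nat \<Rightarrow> nat \<Rightarrow> real" where
  "falling_odd N i = (\<Prod>r<i. 1 - (2 * real r + 1) / (2 * real N))"

text \<open>The quotient of the double factorials of \<open>2 * N - 2\<close> and
  \<open>2 * N - 2 - 2 * i\<close>, divided by \<open>(2 * N) ^ i\<close>.\<close>

definition falling_even :: "nat \<Rightarrow> nat \<Rightarrow> real" where
  "falling_even N i = (\<Prod>r<i. 1 - (2 * real r + 2) / (2 * real N))"

text \<open>With \<open>k = N - 1 - i\<close> the left side is the inverse double factorial of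
  \<open>2 * k + 1\<close>, and one more step of \<open>i\<close> removes the factor
  \<open>2 * k + 3\<close>. Every factorial is thereby expressed through its value at the top, so
  that Stirling's formula is required for \<open>2 * N\<close> only.\<close>

lemma falling_odd_eq:
  "i < N \<Longrightarrow> 2 ^ (N - 1 - i) * fact (N - 1 - i) / fact (2 * (N - 1 - i) + 1) =
     falling_odd N i * (2 * real N) ^ i * (2 ^ (N - 1) * fact (N - 1) / fact (2 * N - 1))"
proof (induction i)
  case 0
  then show ?case by (cases N) (simp_all add: falling_odd_def)
next
  case (Suc i)
  define k where "k = N - 1 - Suc i"
  have k: "N - 1 - i = Suc k" "real N = real k + real i + 2" using Suc.prems by (auto simp: k_def)
  have N: "real N > 0" using Suc.prems by simp
  have "2 ^ k * fact k / fact (2 * k + 1) = (2 * real k + 3) * (2 ^ Suc k * fact (Suc k) / fact (2 * Suc k + 1))"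
    by (simp add: divide_simps)
  also have "2 ^ Suc k * fact (Suc k) / fact (2 * Suc k + 1) = falling_odd N i * (2 * real N) ^ i * (2 ^ (N - 1) * fact (N - 1) / fact (2 * N - 1))"
    using Suc unfolding k(1) by simp
  also have "2 * real k + 3 = (1 - (2 * real i + 1) / (2 * real N)) * (2 * real N)"
    using N k(2) by (simp add: field_simps)
  finally show ?case
    unfolding k_def[symmetric] falling_odd_def by simp
qed

lemma falling_even_eq:
  "i < N \<Longrightarrow> 1 / (2 ^ (N - 1 - i) * fact (N - 1 - i)) =
     falling_even N i * (2 * real N) ^ i / (2 ^ (N - 1) * fact (N - 1))"
proof (induction i)
  case 0
  then show ?case by (simp add: falling_even_def)
next
  case (Suc i)
  define k where "k = N - 1 - Suc i"
  have k: "N - 1 - i = Suc k" "real N = real k + real i + 2" using Suc.prems by (auto simp: k_def)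
  have N: "real N > 0" using Suc.prems by simp
  have "1 / (2 ^ k * fact k) = (2 * real k + 2) * (1 / (2 ^ Suc k * fact (Suc k)))"
    by (simp add: divide_simps)
  also have "1 / (2 ^ Suc k * fact (Suc k)) = falling_even N i * (2 * real N) ^ i / (2 ^ (N - 1) * fact (N - 1))"
    using Suc unfolding k(1) by simp
  also have "2 * real k + 2 = (1 - (2 * real i + 2) / (2 * real N)) * (2 * real N)"
    using N k(2) by (simp add: field_simps)
  finally show ?case
    unfolding k_def[symmetric] falling_even_def by simp
qed

text \<open>Each factor deviates from one by at most \<open>i / N\<close>, and the Weierstrass
  product inequality adds up these deviations. For \<open>i\<close> of order \<open>m\<close> the
  error \<open>i\<^sup>2 / N\<close> is of order \<open>1 / m\<close>.\<close>

lemma falling_bounds: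
  assumes "i < N"
  shows "0 \<le> falling_odd N i" "falling_odd N i \<le> 1" "1 - (real i)\<^sup>2 / real N \<le> falling_odd N i"
    and "0 \<le> falling_even N i" "falling_even N i \<le> 1" "1 - (real i)\<^sup>2 / real N \<le> falling_even N i"
proof -
  have N: "real N > 0" using assms by simp
  have bound: "0 \<le> (\<Prod>r<i. 1 - (2 * real r + d) / (2 * real N)) \<and> (\<Prod>r<i. 1 - (2 * real r + d) / (2 * real N)) \<le> 1 \<and>
      1 - (real i)\<^sup>2 / real N \<le> (\<Prod>r<i. 1 - (2 * real r + d) / (2 * real N))" if d: "0 \<le> d" "d \<le> 2" for d
  proof (intro conjI)
    have le: "(2 * real r + d) / (2 * real N) \<le> real i / real N" "0 \<le> (2 * real r + d) / (2 * real N)" if "r < i" for r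
    proof -
      have "2 * real r + d \<le> 2 * real i" using that d by linarith
      then have "(2 * real r + d) / (2 * real N) \<le> 2 * real i / (2 * real N)" using N by (intro divide_right_mono) auto
      then show "(2 * real r + d) / (2 * real N) \<le> real i / real N" by simp
    qed (use d N in simp)
    have iN: "real i / real N \<le> 1" using assms N by simp
    show "0 \<le> (\<Prod>r<i. 1 - (2 * real r + d) / (2 * real N))"
      using le iN by (intro prod_nonneg) (auto intro: order.trans)
    show "(\<Prod>r<i. 1 - (2 * real r + d) / (2 * real N)) \<le> 1"
      using le iN by (intro prod_le_1) (auto intro: order.trans)
    have "(\<Sum>r<i. (2 * real r + d) / (2 * real N)) \<le> (\<Sum>r<i. real i / real N)"
      using le by (intro sum_mono) auto
    then have "1 - (real i)\<^sup>2 / real N \<le> 1 - (\<Sum>r<i. (2 * real r + d) / (2 * real N))"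
      by (simp add: power2_eq_square)
    also have "\<dots> \<le> (\<Prod>r<i. 1 - (2 * real r + d) / (2 * real N))"
      using le iN by (intro Weierstrass_prod_ineq) (auto intro: order.trans)
    finally show "1 - (real i)\<^sup>2 / real N \<le> (\<Prod>r<i. 1 - (2 * real r + d) / (2 * real N))" .
  qed
  show "0 \<le> falling_odd N i" "falling_odd N i \<le> 1" "1 - (real i)\<^sup>2 / real N \<le> falling_odd N i"
    "0 \<le> falling_even N i" "falling_even N i \<le> 1" "1 - (real i)\<^sup>2 / real N \<le> falling_even N i"
    using bound[of 1] bound[of 2] unfolding falling_odd_def falling_even_def by auto
qed

text \<open>Counting from the top reverses the order, so the inner index afterwards belongs to the
  first argument, which is the odd polynomial.\<close>

lemma sum_triangle_reflect:
  fixes G :: "nat \<Rightarrow> nat \<Rightarrow> complex"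
  shows "(\<Sum>k<N. \<Sum>l\<le>k. G k l) = (\<Sum>l<N. \<Sum>i\<le>l. G (N - 1 - i) (N - 1 - l))"
proof -
  have "(\<Sum>k<N. \<Sum>l\<le>k. G k l) = (\<Sum>(k, l)\<in>(SIGMA k:{..<N}. {..k}). G k l)"
    by (rule sum.Sigma) auto
  also have "\<dots> = (\<Sum>(l, i)\<in>(SIGMA l:{..<N}. {..l}). G (N - 1 - i) (N - 1 - l))"
    by (rule sum.reindex_bij_witness[where i = "\<lambda>(l, i). (N - 1 - i, N - 1 - l)" and j = "\<lambda>(k, l). (N - 1 - l, N - 1 - k)"]) auto
  also have "\<dots> = (\<Sum>l<N. \<Sum>i\<le>l. G (N - 1 - i) (N - 1 - l))"
    by (rule sum.Sigma[symmetric]) auto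
  finally show ?thesis .
qed

text \<open>The offsets are the distances from degree \<open>2 * N\<close>: for
  \<open>k = N - 1 - i\<close> the odd degree is \<open>2 * k + 1 = 2 * N - (2 * i + 1)\<close>, and
  the even degree \<open>2 * (N - 1 - l)\<close> is \<open>2 * N - (2 * l + 2)\<close>.\<close>

definition edge_sum :: "real \<Rightarrow> nat \<Rightarrow> complex \<Rightarrow> complex \<Rightarrow> complex" where
  "edge_sum c N z w = (\<Sum>l<N. \<Sum>i\<le>l. (of_real (falling_odd N i) * edge_integral c 1 N (2 * i + 1) z) *
     (of_real (falling_even N l) * edge_integral c 1 N (2 * l + 2) w))"

definition stirling_ratio :: "nat \<Rightarrow> real" where
  "stirling_ratio n = real n ^ n * exp (- real n) * sqrt (real n) / fact n"

definition edge_kernel :: "real \<Rightarrow> nat \<Rightarrow> complex \<Rightarrow> complex \<Rightarrow> complex" where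
  "edge_kernel c N z w = of_real (edge_zoom c N ^ 3) * edge_factor c N z * edge_factor c N w *
     pair_kernel N (\<lambda>i. of_real ((1 - edge_tau c N) * sqrt (1 - (edge_tau c N)\<^sup>2) * fact (Suc (2 * i)) / real N ^ (2 * i + 2)))
       (\<lambda>n. poly (skew_hermite (of_real (edge_tau c N / real N)) (real N) n)) (edge_point c N z) (edge_point c N w)"

context edge_regime
begin

abbreviation "s \<equiv> sqrt (1 - \<tau>\<^sup>2)"

lemma s_pos: "s > 0" "s\<^sup>2 = 1 - \<tau>\<^sup>2"
proof -
  have "\<tau>\<^sup>2 < 1" using \<tau> by (simp add: power_less_one_iff abs_square_less_1)
  then show "s > 0" "s\<^sup>2 = 1 - \<tau>\<^sup>2" by simp_all
qed

definition "hermite_const j = sqrt (m / (2 * pi * \<tau>)) * 2 ^ N * exp (- real N) / sqrt 2 ^ j"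

lemma hermite_at_edge':
  assumes "j \<le> 2 * N"
  shows "edge_factor c N z * poly (scaled_hermite (of_real (\<tau> / real N)) (2 * N - j)) (edge_point c N z) =
    of_real (hermite_const j) * edge_integral c 1 N j z"
  unfolding hermite_const_def by (rule hermite_at_edge[OF assms]) simp

text \<open>The first factor is half the inverse skew norm, and the other two form the coefficient
  of the Hermite polynomial of degree \<open>2 * l\<close> in the even polynomial of degree
  \<open>2 * k\<close>.\<close>

definition "kernel_coeff k l = real N ^ (2 * k + 2) / (2 * ((1 - \<tau>) * s * fact (Suc (2 * k)))) * (2 ^ k * fact k / real N ^ k) * (real N ^ l / (2 ^ l * fact l))"

text \<open>The square of \<open>2 / m\<close> is split off as the mesh of the double Riemann sum;
  the remaining factor has a finite limit.\<close>

definition "kernel_const = stirling_ratio (2 * N) * (1 + \<tau>) / (sqrt 2 * 4 * pi * \<tau>) * (2 / m)\<^sup>2"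

text \<open>The powers \<open>2 ^ (i + l)\<close> from the factorials cancel the powers of
  \<open>sqrt 2\<close> from the Hermite integrals, and the powers of \<open>N\<close> always add up
  to \<open>2 * N\<close>. Thus the indices survive only in the two falling products.\<close>

lemma const_identity:
  assumes i: "i \<le> l" "l < N"
  shows "g ^ 3 * kernel_coeff (N - 1 - i) (N - 1 - l) * hermite_const (2 * i + 1) * hermite_const (2 * l + 2) =
    kernel_const * (falling_odd N i * falling_even N l)"
proof -
  define k' l' where "k' = N - 1 - i" and "l' = N - 1 - l"
  have eqs: "k' + i + 1 = N" "l' + l + 1 = N" using i by (simp_all add: k'_def l'_def)
  have Np: "real N > 0" using N by simp
  let ?A = "2 ^ (N - 1) * fact (N - 1) :: real"
  have A: "?A > 0" by simp
  have odd: "2 ^ k' * fact k' / fact (Suc (2 * k')) = falling_odd N i * (2 * real N) ^ i * (?A / fact (2 * N - 1))"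
    using falling_odd_eq[of i N] i unfolding k'_def by simp
  have even: "1 / (2 ^ l' * fact l') = falling_even N l * (2 * real N) ^ l / ?A"
    using falling_even_eq[of l N] i unfolding l'_def by simp
  have "kernel_coeff k' l' = real N ^ (2 * k' + 2) / real N ^ k' * real N ^ l' / (2 * ((1 - \<tau>) * s)) *
      (2 ^ k' * fact k' / fact (Suc (2 * k'))) * (1 / (2 ^ l' * fact l'))"
    by (simp add: kernel_coeff_def mult_ac del: fact_Suc)
  also have "\<dots> = real N ^ (2 * k' + 2) / real N ^ k' * real N ^ l' / (2 * ((1 - \<tau>) * s)) *
      (2 * real N) ^ i * (2 * real N) ^ l / fact (2 * N - 1) * (falling_odd N i * falling_even N l)"
    unfolding odd even using A by (simp add: mult_ac)
  also have "real N ^ (2 * k' + 2) / real N ^ k' * real N ^ l' / (2 * ((1 - \<tau>) * s)) * (2 * real N) ^ i * (2 * real N) ^ l / fact (2 * N - 1) =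
      real N ^ (2 * N) * 2 ^ (i + l) / (2 * (1 - \<tau>) * s * fact (2 * N - 1))"
  proof -
    have "2 * k' + 2 = k' + (k' + 2)" by simp
    then have 1: "real N ^ (2 * k' + 2) / real N ^ k' = real N ^ (k' + 2)"
      using Np by (simp only: power_add) simp
    have 2: "real N ^ (k' + 2) * real N ^ l' * (real N ^ i * real N ^ l) = real N ^ (2 * N)"
      unfolding power_add[symmetric] using eqs by (intro arg_cong[of _ _ "\<lambda>n. real N ^ n"]) linarith
    have "real N ^ (2 * k' + 2) / real N ^ k' * real N ^ l' / (2 * D) * (2 * real N) ^ i * (2 * real N) ^ l / F =
      (real N ^ (k' + 2) * real N ^ l' * (real N ^ i * real N ^ l)) * 2 ^ (i + l) / (2 * D * F)" for D F :: real
      unfolding 1 power_mult_distrib power_add[of 2 i l] by (simp only: times_divide_eq_left times_divide_eq_right divide_divide_eq_left mult_ac)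
    from this[of "(1 - \<tau>) * s" "fact (2 * N - 1)"] show ?thesis
      unfolding 2 by (simp only: mult.assoc)
  qed
  finally have c: "kernel_coeff k' l' = real N ^ (2 * N) * 2 ^ (i + l) / (2 * (1 - \<tau>) * s * fact (2 * N - 1)) * (falling_odd N i * falling_even N l)" .
  have q: "sqrt 2 ^ (2 * i + 1) * sqrt 2 ^ (2 * l + 2) = 2 ^ (i + l) * (2 * sqrt 2)"
    by (simp add: power_mult power_add)
  have h: "hermite_const (2 * i + 1) * hermite_const (2 * l + 2) = m / (2 * pi * \<tau>) * (2 ^ (2 * N) * exp (- real (2 * N))) / (2 ^ (i + l) * (2 * sqrt 2))"
  proof -
    have "hermite_const (2 * i + 1) * hermite_const (2 * l + 2) =
       (sqrt (m / (2 * pi * \<tau>)) * sqrt (m / (2 * pi * \<tau>))) * ((2 ^ N * 2 ^ N) * (exp (- real N) * exp (- real N))) / (sqrt 2 ^ (2 * i + 1) * sqrt 2 ^ (2 * l + 2))"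
      unfolding hermite_const_def times_divide_times_eq by (simp only: mult_ac)
    also have "sqrt (m / (2 * pi * \<tau>)) * sqrt (m / (2 * pi * \<tau>)) = m / (2 * pi * \<tau>)"
      using m(1) \<tau> by simp
    also have "exp (- real N) * exp (- real N) = exp (- real (2 * N))" by (simp add: mult_exp_exp)
    also have "(2 ^ N * 2 ^ N :: real) = 2 ^ (2 * N)" by (simp add: mult_2 power_add)
    finally show ?thesis unfolding q .
  qed
  \<comment> \<open>This is the cube of \<open>g * sqrt N = sqrt 2 * s\<close>. One power of
    \<open>s\<close> cancels the square root in the skew norm, and
    \<open>s\<^sup>2 / (1 - \<tau>)\<close> is the factor \<open>1 + \<tau>\<close> of the
    constant.\<close>
  have g3: "g ^ 3 * sqrt (real N) * real N = 2 * sqrt 2 * s ^ 3"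
  proof -
    have gs: "g * sqrt (real N) = sqrt 2 * s"
    proof -
      have "(g * sqrt (real N))\<^sup>2 = (sqrt 2 * s)\<^sup>2"
        using g_square s_pos(2) by (simp add: power_mult_distrib mult.commute)
      then show ?thesis using g_pos s_pos(1) by (simp add: power2_eq_iff_nonneg)
    qed
    have "g ^ 3 * sqrt (real N) * real N = (g * sqrt (real N)) ^ 3" by (simp add: power_mult_distrib power3_eq_cube mult_ac)
    also have "\<dots> = 2 * sqrt 2 * s ^ 3" unfolding gs by (simp add: power_mult_distrib power3_eq_cube mult_ac)
    finally show ?thesis .
  qed
  have fact_eq: "fact (2 * N) = 2 * real N * fact (2 * N - 1)"
    using N by (subst fact_reduce) auto
  have st: "stirling_ratio (2 * N) = (2 * real N) ^ (2 * N) * exp (- real (2 * N)) * (sqrt 2 * sqrt (real N)) / (2 * real N * fact (2 * N - 1))"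
    unfolding stirling_ratio_def fact_eq by (simp add: real_sqrt_mult)
  have s2: "s\<^sup>2 / (1 - \<tau>) = 1 + \<tau>"
  proof -
    have "s\<^sup>2 = (1 + \<tau>) * (1 - \<tau>)" using s_pos(2) by (simp add: power2_eq_square algebra_simps)
    then show ?thesis using \<tau> by simp
  qed
  have g3': "g ^ 3 = 2 * sqrt 2 * s ^ 3 / (sqrt (real N) * real N)"
    using g3 Np by (simp add: field_simps)
  have rearrange: "G * (n ^ k * q / (2 * D * s * F)) * (m / (2 * pi * \<tau>) * (2 ^ k * e) / (q * (2 * sqrt 2))) =
      G * ((2 * n) ^ k * e / F) * m / (sqrt 2 * 8 * pi * \<tau> * D * s)" if "q \<noteq> 0" for G n q D F e :: real and k
    using that by (simp add: power_mult_distrib) (simp only: mult_ac)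
  have "g ^ 3 * (real N ^ (2 * N) * 2 ^ (i + l) / (2 * (1 - \<tau>) * s * fact (2 * N - 1))) *
      (m / (2 * pi * \<tau>) * (2 ^ (2 * N) * exp (- real (2 * N))) / (2 ^ (i + l) * (2 * sqrt 2))) =
     g ^ 3 * ((2 * real N) ^ (2 * N) * exp (- real (2 * N)) / fact (2 * N - 1)) * m / (sqrt 2 * 8 * pi * \<tau> * (1 - \<tau>) * s)"
    by (rule rearrange) simp
  also have "g ^ 3 * ((2 * real N) ^ (2 * N) * exp (- real (2 * N)) / fact (2 * N - 1)) * m / (sqrt 2 * 8 * pi * \<tau> * (1 - \<tau>) * s) =
     ((2 * real N) ^ (2 * N) * exp (- real (2 * N)) / fact (2 * N - 1)) / (sqrt (real N) * real N) * m * (s\<^sup>2 / (1 - \<tau>)) / (4 * pi * \<tau>)"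
    unfolding g3'
    using s_pos(1) \<tau> Np by (simp add: divide_simps power2_eq_square power3_eq_cube)
  also have "\<dots> = kernel_const"
  proof -
    have mN: "(2 / m)\<^sup>2 = 2 * m / real N" unfolding m(2) using m(1) by (simp add: power2_eq_square power3_eq_cube)
    have rN: "sqrt (real N) * sqrt (real N) = real N" by simp
    define X where "X = (2 * real N) ^ (2 * N) * exp (- real (2 * N)) / fact (2 * N - 1)"
    define r where "r = sqrt (real N)"
    have r: "r > 0" "real N = r * r" using Np by (simp_all add: r_def)
    have "stirling_ratio (2 * N) = X * (sqrt 2 * r) / (2 * real N)"
      unfolding st X_def r_def by simp
    moreover have "(sqrt 2 * r) * (sqrt 2 * r) = 2 * real N" by (simp add: r(2))
    ultimately have X: "X = stirling_ratio (2 * N) * (sqrt 2 * r)"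
      using Np by (simp add: mult.assoc)
    have h1: "1 / sqrt 2 = sqrt 2 / 2" by (simp add: divide_simps)
    have h2: "a / (sqrt 2 * 4 * pi * \<tau>) = a * (1 / sqrt 2) / (4 * pi * \<tau>)" for a by simp
    have half: "a / (sqrt 2 * 4 * pi * \<tau>) = a * (sqrt 2 / 2) / (4 * pi * \<tau>)" for a by (simp only: h2 h1)
    show ?thesis
      unfolding kernel_const_def s2 mN X_def[symmetric] r_def[symmetric] half unfolding X r(2) using r(1) \<tau>
      by (simp add: field_simps)
  qed
  finally have K: "g ^ 3 * (real N ^ (2 * N) * 2 ^ (i + l) / (2 * (1 - \<tau>) * s * fact (2 * N - 1))) *
      (m / (2 * pi * \<tau>) * (2 ^ (2 * N) * exp (- real (2 * N))) / (2 ^ (i + l) * (2 * sqrt 2))) = kernel_const" .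
  have "g ^ 3 * kernel_coeff k' l' * hermite_const (2 * i + 1) * hermite_const (2 * l + 2) =
     (g ^ 3 * (real N ^ (2 * N) * 2 ^ (i + l) / (2 * (1 - \<tau>) * s * fact (2 * N - 1))) * (hermite_const (2 * i + 1) * hermite_const (2 * l + 2))) * (falling_odd N i * falling_even N l)"
    unfolding c by (simp only: mult_ac)
  then show ?thesis unfolding h K k'_def[symmetric] l'_def[symmetric] .
qed

text \<open>Each product in the prekernel contains one Hermite polynomial at either point, so the
  two holomorphic factors turn it into a product of two edge integrals. All constants then merge
  into a single one.\<close>

lemma edge_kernel_eq: "edge_kernel c N z w = of_real kernel_const * (edge_sum c N z w - edge_sum c N w z)"
proof -
  define P where "P n \<zeta> = poly (scaled_hermite (of_real (\<tau> / real N)) n) \<zeta>" for n \<zeta>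
  define Z W where "Z = edge_point c N z" and "W = edge_point c N w"
  define hz hw where "hz = edge_factor c N z" and "hw = edge_factor c N w"
  define \<rho> where "\<rho> i = complex_of_real ((1 - \<tau>) * s * fact (Suc (2 * i)) / real N ^ (2 * i + 2))" for i
  define q where "q n = poly (skew_hermite (of_real (\<tau> / real N)) (real N) n)" for n
  have N0: "real N \<noteq> 0" using N by simp
  define x where "x k = real N ^ (2 * k + 2) / (2 * ((1 - \<tau>) * s * fact (Suc (2 * k))))" for k
  define y where "y k l = 2 ^ k * fact k / real N ^ k * (real N ^ l / (2 ^ l * fact l))" for k l
  have even: "q (2 * k) \<zeta> = (\<Sum>l\<le>k. of_real (y k l) * P (2 * l) \<zeta>)" for k \<zeta>
    unfolding q_def skew_hermite_simps even_skew_hermite_eq_sum[OF N0] P_def y_def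
    by (simp add: poly_sum sum_distrib_left mult_ac)
  have odd: "q (Suc (2 * k)) \<zeta> = P (Suc (2 * k)) \<zeta>" for k \<zeta>
    unfolding q_def skew_hermite_simps P_def ..
  have \<rho>: "1 / (2 * \<rho> k) = of_real (x k)" for k
    unfolding \<rho>_def x_def by simp
  have kc: "complex_of_real (kernel_coeff k l) = of_real (x k) * of_real (y k l)" for k l
    unfolding of_real_mult[symmetric] by (simp only: kernel_coeff_def x_def y_def mult.assoc)
  have summand: "(q (Suc (2 * k)) Z * q (2 * k) W - q (2 * k) Z * q (Suc (2 * k)) W) / (2 * \<rho> k) =
      (\<Sum>l\<le>k. of_real (kernel_coeff k l) * (P (Suc (2 * k)) Z * P (2 * l) W - P (Suc (2 * k)) W * P (2 * l) Z))" for k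
  proof -
    have "(q (Suc (2 * k)) Z * q (2 * k) W - q (2 * k) Z * q (Suc (2 * k)) W) / (2 * \<rho> k) =
      1 / (2 * \<rho> k) * (q (Suc (2 * k)) Z * q (2 * k) W - q (2 * k) Z * q (Suc (2 * k)) W)" by simp
    also have "\<dots> = (\<Sum>l\<le>k. of_real (kernel_coeff k l) * (P (Suc (2 * k)) Z * P (2 * l) W - P (Suc (2 * k)) W * P (2 * l) Z))"
      unfolding \<rho> odd even sum_distrib_left sum_distrib_right sum_subtractf[symmetric]
      by (intro sum.cong refl) (simp only: kc right_diff_distrib mult_ac)
    finally show ?thesis .
  qed
  have herm: "hz * P (2 * N - j) Z = of_real (hermite_const j) * edge_integral c 1 N j z"
    "hw * P (2 * N - j) W = of_real (hermite_const j) * edge_integral c 1 N j w" if "j \<le> 2 * N" for j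
    unfolding hz_def hw_def Z_def W_def P_def using hermite_at_edge'[OF that] by simp_all
  have pair: "pair_kernel N \<rho> q Z W = (\<Sum>l<N. \<Sum>i\<le>l. of_real (kernel_coeff (N - 1 - i) (N - 1 - l)) *
      (P (Suc (2 * (N - 1 - i))) Z * P (2 * (N - 1 - l)) W - P (Suc (2 * (N - 1 - i))) W * P (2 * (N - 1 - l)) Z))"
    unfolding pair_kernel_def summand by (rule sum_triangle_reflect)
  have "edge_kernel c N z w = of_real (g ^ 3) * hz * hw * pair_kernel N \<rho> q Z W"
    unfolding edge_kernel_def \<rho>_def q_def Z_def W_def hz_def hw_def g_def \<tau>_def by simp
  also have "\<dots> = (\<Sum>l<N. \<Sum>i\<le>l. of_real kernel_const *
      ((of_real (falling_odd N i) * edge_integral c 1 N (2 * i + 1) z) * (of_real (falling_even N l) * edge_integral c 1 N (2 * l + 2) w) -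
       (of_real (falling_odd N i) * edge_integral c 1 N (2 * i + 1) w) * (of_real (falling_even N l) * edge_integral c 1 N (2 * l + 2) z)))"
    unfolding pair sum_distrib_left
  proof (intro sum.cong refl)
    fix l i assume "l \<in> {..<N}" "i \<in> {..l}"
    then have il: "i \<le> l" "l < N" by auto
    define C where "C = kernel_coeff (N - 1 - i) (N - 1 - l)"
    define a b where "a = hermite_const (2 * i + 1)" and "b = hermite_const (2 * l + 2)"
    define fo fe where "fo = falling_odd N i" and "fe = falling_even N l"
    have idx: "Suc (2 * (N - 1 - i)) = 2 * N - (2 * i + 1)" "2 * (N - 1 - l) = 2 * N - (2 * l + 2)"
      using il by auto
    have le: "2 * i + 1 \<le> 2 * N" "2 * l + 2 \<le> 2 * N" using il by auto
    have K: "of_real (g ^ 3) * of_real C * of_real a * of_real b = of_real kernel_const * (of_real fo * of_real fe :: complex)"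
      using arg_cong[OF const_identity[OF il], of complex_of_real]
      unfolding C_def a_def b_def fo_def fe_def of_real_mult .
    have "of_real (g ^ 3) * hz * hw * (of_real C * (P (2 * N - (2 * i + 1)) Z * P (2 * N - (2 * l + 2)) W - P (2 * N - (2 * i + 1)) W * P (2 * N - (2 * l + 2)) Z)) =
       of_real (g ^ 3) * of_real C * ((hz * P (2 * N - (2 * i + 1)) Z) * (hw * P (2 * N - (2 * l + 2)) W) - (hw * P (2 * N - (2 * i + 1)) W) * (hz * P (2 * N - (2 * l + 2)) Z))"
      by (simp only: right_diff_distrib mult_ac)
    also have "\<dots> = (of_real (g ^ 3) * of_real C * of_real a * of_real b) *
       (edge_integral c 1 N (2 * i + 1) z * edge_integral c 1 N (2 * l + 2) w - edge_integral c 1 N (2 * i + 1) w * edge_integral c 1 N (2 * l + 2) z)"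
      unfolding herm[OF le(1)] herm[OF le(2)] a_def[symmetric] b_def[symmetric] by (simp only: right_diff_distrib mult_ac)
    also have "\<dots> = of_real kernel_const *
      ((of_real fo * edge_integral c 1 N (2 * i + 1) z) * (of_real fe * edge_integral c 1 N (2 * l + 2) w) -
       (of_real fo * edge_integral c 1 N (2 * i + 1) w) * (of_real fe * edge_integral c 1 N (2 * l + 2) z))"
      unfolding K by (simp only: right_diff_distrib mult_ac)
    finally show "of_real (g ^ 3) * hz * hw * (of_real (kernel_coeff (N - 1 - i) (N - 1 - l)) *
        (P (Suc (2 * (N - 1 - i))) Z * P (2 * (N - 1 - l)) W - P (Suc (2 * (N - 1 - i))) W * P (2 * (N - 1 - l)) Z)) =
      of_real kernel_const *
      ((of_real (falling_odd N i) * edge_integral c 1 N (2 * i + 1) z) * (of_real (falling_even N l) * edge_integral c 1 N (2 * l + 2) w) -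
       (of_real (falling_odd N i) * edge_integral c 1 N (2 * i + 1) w) * (of_real (falling_even N l) * edge_integral c 1 N (2 * l + 2) z))"
      unfolding idx C_def fo_def fe_def .
  qed
  also have "\<dots> = of_real kernel_const * (edge_sum c N z w - edge_sum c N w z)"
    unfolding edge_sum_def sum_distrib_left[symmetric] sum_subtractf ..
  finally show ?thesis .
qed

end


section \<open>Limit of the double sum and the Wronskian integral\<close>

text \<open>At \<open>z - of_real u\<close> this is the derivative of \<open>edge_f c z\<close> at
  \<open>u\<close>: the function \<open>edge_f\<close> depends on \<open>z\<close> by translation of
  its integrand.\<close>

definition edge_density :: "real \<Rightarrow> complex \<Rightarrow> complex" where
  "edge_density c z = 2 * of_real c * (exp (of_real (c ^ 3) * z + of_real (c ^ 6 / 12)) *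
     Airy_Ai (2 * of_real c * z + of_real (c ^ 4 / 4)))"

lemma continuous_on_edge_density [continuous_intros]:
  assumes "continuous_on A f"
  shows "continuous_on A (\<lambda>x. edge_density c (f x))"
  unfolding edge_density_def
  by (intro continuous_intros assms continuous_on_compose2[OF continuous_on_Airy_Ai[of UNIV]]) auto

lemma edge_limit_integral_eq_density:
  assumes "c > 0" "\<alpha> > 0"
  shows "edge_limit_integral c \<alpha> x z = of_real (pi / c) * exp (z\<^sup>2) * edge_density c (z + of_real (x / (2 * c)))"
  unfolding edge_limit_integral_eq_Airy[OF assms] edge_density_def using assms by simp

lemma borel_measurable_edge_limit_integral:
  assumes "c > 0" "\<alpha> > 0"
  shows "(\<lambda>x. edge_limit_integral c \<alpha> x z) \<in> borel_measurable borel"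
proof -
  have "continuous_on UNIV (\<lambda>x::real. of_real (pi / c) * exp (z\<^sup>2) * edge_density c (z + of_real (x * (1 / (2 * c)))))"
    by (intro continuous_intros)
  then show ?thesis
    unfolding edge_limit_integral_eq_density[OF assms] by (intro borel_measurable_continuous_onI) simp
qed

text \<open>The inner variable stems from the odd polynomial at \<open>z\<close>, the outer one from
  the even polynomial at \<open>w\<close>; the constraint \<open>x \<le> y\<close> is the limit of
  \<open>i \<le> l\<close>.\<close>

definition edge_pair_integral :: "real \<Rightarrow> complex \<Rightarrow> complex \<Rightarrow> complex" where
  "edge_pair_integral c z w = (\<integral>y. indicator {0..} y *\<^sub>R (edge_limit_integral c 1 y w *
     (\<integral>x. indicator {0..y} x *\<^sub>R edge_limit_integral c 1 x z \<partial>lborel)) \<partial>lborel)"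

text \<open>Turns the gain per degree into an exponential. A step of \<open>i\<close> lowers the
  degree by two and moves the rescaled variable by \<open>2 / m\<close>, which makes the decay rate
  \<open>1 / 2\<close> in that variable.\<close>

lemma inverse_one_plus_le_exp:
  fixes m :: real
  assumes "m \<ge> 1"
  shows "1 / (1 + 1 / m) \<le> exp (- (1 / (2 * m)))"
proof -
  define x where "x = 1 / (2 * m)"
  have x: "0 < x" "x \<le> 1" using assms by (simp_all add: x_def)
  have "exp x \<le> 1 + x + x\<^sup>2" using x by (intro exp_bound) auto
  also have "\<dots> \<le> 1 + 2 * x" using x by (simp add: power2_eq_square mult_left_le)
  also have "2 * x = 1 / m" by (simp add: x_def)
  finally have "1 / (1 + 1 / m) \<le> 1 / exp x" by (intro divide_left_mono) (use assms in \<open>auto simp: add_pos_pos\<close>)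
  then show ?thesis by (simp add: exp_minus x_def[symmetric] inverse_eq_divide)
qed

text \<open>Consecutive indices differ by two degrees, so the mesh is \<open>2 / m\<close>. At
  indices of order \<open>m\<close> the falling products tend to one and the integrals to their
  limits; the geometric decay in the degree dominates all remaining terms.\<close>

lemma edge_sum_tendsto:
  assumes c: "c > 0" and Z: "Z \<longlonglongrightarrow> z" and W: "W \<longlonglongrightarrow> w"
  shows "(\<lambda>N. of_real ((2 / edge_scale N)\<^sup>2) * edge_sum c N (Z N) (W N)) \<longlonglongrightarrow> edge_pair_integral c z w"
    and "integrable lborel (\<lambda>y. indicator {0..} y *\<^sub>R (edge_limit_integral c 1 y w *
     (\<integral>x. indicator {0..y} x *\<^sub>R edge_limit_integral c 1 x z \<partial>lborel)))"
proof -
  obtain n0 where n0: "\<And>N. N \<ge> n0 \<Longrightarrow> edge_regime c N \<and> edge_tau c N \<ge> 1 / 2 \<and> edge_scale N \<ge> 1"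
    using eventually_edge_regime[OF c] by (auto simp: eventually_sequentially)
  have "\<exists>R. (\<forall>N. norm (Z N) \<le> R) \<and> (\<forall>N. norm (W N) \<le> R)"
  proof -
    obtain A B where "\<forall>N. norm (Z N) \<le> A" "\<forall>N. norm (W N) \<le> B"
      using convergent_imp_Bseq[OF convergentI[OF Z]] convergent_imp_Bseq[OF convergentI[OF W]] by (auto simp: Bseq_def)
    then show ?thesis by (intro exI[of _ "max A B"]) (auto simp: le_max_iff_disj)
  qed
  then obtain R where R: "\<And>N. norm (Z N) \<le> R" "\<And>N. norm (W N) \<le> R" by blast
  define K where "K = (\<integral>\<theta>. edge_majorant c 1 R \<theta> \<partial>lborel)"
  have K: "K \<ge> 0" unfolding K_def by (intro Bochner_Integration.integral_nonneg) (simp add: edge_majorant_def)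
  let ?N = "\<lambda>N. N + n0"
  define \<Delta> where "\<Delta> N = 2 / edge_scale (?N N)" for N
  \<comment> \<open>The Riemann sum lemma demands its bounds for every \<open>i\<close>, whereas the
    falling products are controlled only for \<open>i < N\<close>; the rest is set to zero.\<close>
  define F where "F N i = (if i < ?N N then of_real (falling_odd (?N N) i) * edge_integral c 1 (?N N) (2 * i + 1) (Z (?N N)) else 0)" for N i
  define G where "G N i = (if i < ?N N then of_real (falling_even (?N N) i) * edge_integral c 1 (?N N) (2 * i + 2) (W (?N N)) else 0)" for N i
  have scale: "edge_scale (?N N) \<ge> 1" for N using n0[of "?N N"] by simp
  have cube: "edge_scale (?N N) ^ 3 = 2 * real (?N N)" for N
  proof -
    interpret edge_regime c "?N N" "edge_tau c (?N N)" "edge_scale (?N N)" "edge_zoom c (?N N)"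
      using n0[of "?N N"] by simp_all
    show ?thesis using edge_scale_cube[OF N] .
  qed
  have \<Delta>: "\<Delta> N > 0" for N using scale[of N] by (simp add: \<Delta>_def)
  have \<Delta>0: "\<Delta> \<longlonglongrightarrow> 0"
    unfolding \<Delta>_def
    by (intro LIMSEQ_ignore_initial_segment[where f = "\<lambda>N. 2 / edge_scale N"]
        tendsto_divide_0[OF tendsto_const filterlim_at_top_imp_at_infinity[OF filterlim_edge_scale]])
  have NN: "real (?N N) = edge_scale (?N N) ^ 3 / 2" for N using cube[of N] by simp
  have L: "filterlim (\<lambda>N. real (?N N) * \<Delta> N) at_top sequentially"
  proof -
    have "real (?N N) * \<Delta> N = (edge_scale (?N N))\<^sup>2" for N
      unfolding NN \<Delta>_def using scale[of N] by (simp add: power2_eq_square power3_eq_cube)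
    moreover have "filterlim (\<lambda>N. (edge_scale (?N N))\<^sup>2) at_top sequentially"
      by (intro filterlim_pow_at_top filterlim_compose[OF filterlim_edge_scale filterlim_add_const_nat_at_top]) simp
    ultimately show ?thesis by (simp only:)
  qed
  have J_bound: "norm (edge_integral c 1 (?N N) (2 * i + d) u) \<le> K * exp (- (1 / 2) * (real i * \<Delta> N))"
    if "norm u \<le> R" for N i d u
  proof -
    interpret edge_regime c "?N N" "edge_tau c (?N N)" "edge_scale (?N N)" "edge_zoom c (?N N)"
      using n0[of "?N N"] by simp_all
    let ?b = "1 / (1 + 1 / edge_scale (?N N))"
    have b: "0 \<le> ?b" "?b \<le> 1" using scale[of N] by (simp_all add: divide_simps)
    have b_exp: "?b \<le> exp (- (1 / (2 * edge_scale (?N N))))" by (rule inverse_one_plus_le_exp[OF scale])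
    have "norm (edge_integral c 1 (?N N) (2 * i + d) u) \<le> K * ?b ^ (2 * i + d)"
      unfolding K_def using n0[of "?N N"] that by (intro edge_integral_bound) auto
    also have "\<dots> \<le> K * exp (- (1 / (2 * edge_scale (?N N)))) ^ (2 * i)"
    proof (intro mult_left_mono K)
      have "?b ^ (2 * i + d) \<le> ?b ^ (2 * i)" using b by (intro power_decreasing) auto
      also have "\<dots> \<le> exp (- (1 / (2 * edge_scale (?N N)))) ^ (2 * i)" using b b_exp by (intro power_mono) auto
      finally show "?b ^ (2 * i + d) \<le> exp (- (1 / (2 * edge_scale (?N N)))) ^ (2 * i)" .
    qed
    also have "exp (- (1 / (2 * edge_scale (?N N)))) ^ (2 * i) = exp (- (1 / 2) * (real i * \<Delta> N))"
      by (simp add: \<Delta>_def flip: exp_of_nat_mult)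
    finally show ?thesis .
  qed
  have cut: "norm (of_real a * x) \<le> B" if "0 \<le> a" "a \<le> 1" "norm x \<le> B" for a B :: real and x :: complex
  proof -
    have "norm (of_real a * x) = a * norm x" using that by (simp add: norm_mult)
    also have "\<dots> \<le> 1 * norm x" using that by (intro mult_right_mono) auto
    finally show ?thesis using that by simp
  qed
  have F: "norm (F N i) \<le> K * exp (- (1 / 2) * (real i * \<Delta> N))" for N i
    unfolding F_def using K falling_bounds(1,2)[of i "?N N"] J_bound[OF R(1), where d = 1] by (auto intro!: cut)
  have G: "norm (G N i) \<le> K * exp (- (1 / 2) * (real i * \<Delta> N))" for N i
    unfolding G_def using K falling_bounds(4,5)[of i "?N N"] J_bound[OF R(2), where d = 2] by (auto intro!: cut)
  have small: "\<forall>\<^sub>F N in sequentially. I N < ?N N" if I: "(\<lambda>N. real (I N) * \<Delta> N) \<longlonglongrightarrow> x" for I x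
  proof -
    have "\<forall>\<^sub>F N in sequentially. real (I N) * \<Delta> N < x + 1" by (rule order_tendstoD(2)[OF I]) simp
    moreover have "\<forall>\<^sub>F N in sequentially. x + 1 < real (?N N) * \<Delta> N" using L by (simp add: filterlim_at_top_dense)
    ultimately show ?thesis
    proof eventually_elim
      case (elim N)
      then have "real (I N) * \<Delta> N < real (?N N) * \<Delta> N" by linarith
      then have "real (I N) < real (?N N)" using \<Delta>[of N] by (simp only: mult_less_cancel_right_pos)
      then show ?case by (simp only: of_nat_less_iff)
    qed
  qed
  \<comment> \<open>Since \<open>N = m ^ 3 / 2\<close> and the mesh is \<open>2 / m\<close>, the
    quotient is the squared rescaled index times a quarter of the mesh.\<close>
  have ratio: "(\<lambda>N. (real (I N))\<^sup>2 / real (?N N)) \<longlonglongrightarrow> 0" if I: "(\<lambda>N. real (I N) * \<Delta> N) \<longlonglongrightarrow> x" for I x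
  proof -
    have "(real (I N))\<^sup>2 / real (?N N) = (real (I N) * \<Delta> N)\<^sup>2 * \<Delta> N / 4" for N
      unfolding NN \<Delta>_def using scale[of N] by (simp add: power2_eq_square power3_eq_cube field_simps)
    moreover have "(\<lambda>N. (real (I N) * \<Delta> N)\<^sup>2 * \<Delta> N / 4) \<longlonglongrightarrow> x\<^sup>2 * 0 / 4"
      by (intro tendsto_intros I \<Delta>0) simp
    ultimately show ?thesis by (simp only: mult_zero_right div_0)
  qed
  have fall1: "(\<lambda>N. fo (?N N) (I N)) \<longlonglongrightarrow> 1"
    if I: "(\<lambda>N. real (I N) * \<Delta> N) \<longlonglongrightarrow> x" and fo: "\<And>i n. i < n \<Longrightarrow> 1 - (real i)\<^sup>2 / real n \<le> fo n i \<and> fo n i \<le> 1"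
    for fo :: "nat \<Rightarrow> nat \<Rightarrow> real" and I x
  proof (rule tendsto_sandwich)
    show "\<forall>\<^sub>F N in sequentially. 1 - (real (I N))\<^sup>2 / real (?N N) \<le> fo (?N N) (I N)"
      using small[OF I] by eventually_elim (use fo in blast)
    show "\<forall>\<^sub>F N in sequentially. fo (?N N) (I N) \<le> 1"
      using small[OF I] by eventually_elim (use fo in blast)
    show "(\<lambda>N. 1 - (real (I N))\<^sup>2 / real (?N N)) \<longlonglongrightarrow> 1"
      using tendsto_diff[OF tendsto_const ratio[OF I], of 1] by simp
  qed simp
  have J_lim: "(\<lambda>N. edge_integral c 1 (?N N) (2 * I N + d) (U (?N N))) \<longlonglongrightarrow> edge_limit_integral c 1 x u"
    if I: "(\<lambda>N. real (I N) * \<Delta> N) \<longlonglongrightarrow> x" and U: "U \<longlonglongrightarrow> u" for I x d U u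
  proof -
    have "(\<lambda>N. real (I N) * \<Delta> N + real d / 2 * \<Delta> N) \<longlonglongrightarrow> x + real d / 2 * 0" by (intro tendsto_intros I \<Delta>0)
    moreover have "real (I N) * \<Delta> N + real d / 2 * \<Delta> N = real (2 * I N + d) / edge_scale (?N N)" for N
      by (simp add: \<Delta>_def add_divide_distrib)
    ultimately have "(\<lambda>N. real (2 * I N + d) / edge_scale (?N N)) \<longlonglongrightarrow> x" by simp
    then have "(\<lambda>N. real (2 * I (?N N - n0) + d) / edge_scale (?N N)) \<longlonglongrightarrow> x" by simp
    then have "(\<lambda>N. real (2 * I (N - n0) + d) / edge_scale N) \<longlonglongrightarrow> x"
      by (rule LIMSEQ_offset)
    from edge_integral_tendsto[OF c zero_less_one U this]
    have "(\<lambda>N. edge_integral c 1 N (2 * I (N - n0) + d) (U N)) \<longlonglongrightarrow> edge_limit_integral c 1 x u" .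
    from LIMSEQ_ignore_initial_segment[OF this, of n0] show ?thesis by simp
  qed
  have f: "(\<lambda>N. F N (I N)) \<longlonglongrightarrow> edge_limit_integral c 1 x z" if "x > 0" and I: "(\<lambda>N. real (I N) * \<Delta> N) \<longlonglongrightarrow> x" for x I
  proof -
    have "(\<lambda>N. of_real (falling_odd (?N N) (I N)) * edge_integral c 1 (?N N) (2 * I N + 1) (Z (?N N))) \<longlonglongrightarrow> of_real 1 * edge_limit_integral c 1 x z"
      by (intro tendsto_mult tendsto_of_real fall1[OF I, of falling_odd] J_lim[OF I Z] conjI) (use falling_bounds in auto)
    moreover have "\<forall>\<^sub>F N in sequentially. of_real (falling_odd (?N N) (I N)) * edge_integral c 1 (?N N) (2 * I N + 1) (Z (?N N)) = F N (I N)"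
      using small[OF I] by eventually_elim (simp add: F_def)
    ultimately have "(\<lambda>N. F N (I N)) \<longlonglongrightarrow> of_real 1 * edge_limit_integral c 1 x z"
      by (rule Lim_transform_eventually)
    then show ?thesis by simp
  qed
  have g: "(\<lambda>N. G N (I N)) \<longlonglongrightarrow> edge_limit_integral c 1 x w" if "x > 0" and I: "(\<lambda>N. real (I N) * \<Delta> N) \<longlonglongrightarrow> x" for x I
  proof -
    have "(\<lambda>N. of_real (falling_even (?N N) (I N)) * edge_integral c 1 (?N N) (2 * I N + 2) (W (?N N))) \<longlonglongrightarrow> of_real 1 * edge_limit_integral c 1 x w"
      by (intro tendsto_mult tendsto_of_real fall1[OF I, of falling_even] J_lim[OF I W] conjI) (use falling_bounds in auto)
    moreover have "\<forall>\<^sub>F N in sequentially. of_real (falling_even (?N N) (I N)) * edge_integral c 1 (?N N) (2 * I N + 2) (W (?N N)) = G N (I N)"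
      using small[OF I] by eventually_elim (simp add: G_def)
    ultimately have "(\<lambda>N. G N (I N)) \<longlonglongrightarrow> of_real 1 * edge_limit_integral c 1 x w"
      by (rule Lim_transform_eventually)
    then show ?thesis by simp
  qed
  have exp_int: "integrable lborel (\<lambda>x::real. indicator {0..} x * exp (- (1 / 2) * x))"
    by (rule integrable_exp_neg) simp
  note nested = nested_riemann_sum_tendsto[OF \<Delta> \<Delta>0 L F G _ f g
      borel_measurable_edge_limit_integral[OF c zero_less_one] borel_measurable_edge_limit_integral[OF c zero_less_one] exp_int]
  have sum_eq: "(\<Sum>l<?N N. \<Sum>i\<le>l. F N i * G N l) = edge_sum c (?N N) (Z (?N N)) (W (?N N))" for N
    unfolding edge_sum_def by (intro sum.cong refl) (simp add: F_def G_def)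
  have "(\<lambda>N. of_real ((\<Delta> N)\<^sup>2) * edge_sum c (?N N) (Z (?N N)) (W (?N N))) \<longlonglongrightarrow> edge_pair_integral c z w"
    using nested(1) unfolding sum_eq edge_pair_integral_def by simp
  then show "(\<lambda>N. of_real ((2 / edge_scale N)\<^sup>2) * edge_sum c N (Z N) (W N)) \<longlonglongrightarrow> edge_pair_integral c z w"
    unfolding \<Delta>_def by (rule LIMSEQ_offset)
  show "integrable lborel (\<lambda>y. indicator {0..} y *\<^sub>R (edge_limit_integral c 1 y w *
     (\<integral>x. indicator {0..y} x *\<^sub>R edge_limit_integral c 1 x z \<partial>lborel)))"
    using nested(2) by simp
qed

text \<open>The substitution \<open>t = - x / (2 * c)\<close> maps the negative half line of the
  definition to the rescaled degrees. The minus sign comes from the reversed limits of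
  integration.\<close>

lemma edge_f_eq:
  assumes c: "c > 0" and y: "y \<ge> 0"
  shows "edge_f c z (- (y / (2 * c))) = - (\<integral>x. indicator {0..y} x *\<^sub>R edge_density c (z + of_real (x / (2 * c))) \<partial>lborel) / of_real (2 * c)"
proof -
  define h where "h t = exp (of_real (c ^ 3) * (z - of_real t) + of_real (c ^ 6 / 12)) *
        Airy_Ai (2 * of_real c * (z - of_real t) + of_real (c ^ 4 / 4))" for t
  have le: "- (y / (2 * c)) \<le> 0" using assms by simp
  have "edge_f c z (- (y / (2 * c))) = 2 * of_real c * (- (CLBINT t=- (y / (2 * c))..0. h t))"
    unfolding edge_f_def h_def by (subst interval_integral_endpoints_reverse) simp
  also have "(CLBINT t=- (y / (2 * c))..0. h t) = (\<integral>t. indicator {- (y / (2 * c))..0} t *\<^sub>R h t \<partial>lborel)"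
    using interval_integral_Icc[OF le, of h] by (simp add: set_lebesgue_integral_def zero_ereal_def)
  also have "\<dots> = (1 / (2 * c)) *\<^sub>R (\<integral>x. indicator {- (y / (2 * c))..0} (0 + - (1 / (2 * c)) * x) *\<^sub>R h (0 + - (1 / (2 * c)) * x) \<partial>lborel)"
    using c by (subst lborel_integral_real_affine[where c = "- (1 / (2 * c))" and t = 0]) simp_all
  also have "(\<lambda>x. indicator {- (y / (2 * c))..0} (0 + - (1 / (2 * c)) * x) *\<^sub>R h (0 + - (1 / (2 * c)) * x)) =
      (\<lambda>x. indicator {0..y} x *\<^sub>R h (- (x / (2 * c))))"
  proof
    fix x
    have "0 + - (1 / (2 * c)) * x \<in> {- (y / (2 * c))..0} \<longleftrightarrow> x \<in> {0..y}"
      using c by (auto simp: divide_le_cancel zero_le_divide_iff)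
    then show "indicator {- (y / (2 * c))..0} (0 + - (1 / (2 * c)) * x) *\<^sub>R h (0 + - (1 / (2 * c)) * x) =
      indicator {0..y} x *\<^sub>R h (- (x / (2 * c)))"
      by (simp add: indicator_def)
  qed
  finally have "edge_f c z (- (y / (2 * c))) = - (of_real (1 / (2 * c)) * (2 * of_real c * (\<integral>x. indicator {0..y} x *\<^sub>R h (- (x / (2 * c))) \<partial>lborel)))"
    by (simp add: scaleR_conv_of_real)
  also have "2 * of_real c * (\<integral>x. indicator {0..y} x *\<^sub>R h (- (x / (2 * c))) \<partial>lborel) =
      (\<integral>x. 2 * of_real c * (indicator {0..y} x *\<^sub>R h (- (x / (2 * c)))) \<partial>lborel)"
    by (rule integral_mult_right_zero[symmetric])
  also have "(\<lambda>x. 2 * of_real c * (indicator {0..y} x *\<^sub>R h (- (x / (2 * c))))) = (\<lambda>x. indicator {0..y} x *\<^sub>R edge_density c (z + of_real (x / (2 * c))))"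
    by (rule ext) (simp add: h_def edge_density_def scaleR_conv_of_real mult_ac)
  finally show ?thesis by simp
qed

lemma edge_f_has_vector_derivative:
  "(edge_f c z has_vector_derivative edge_density c (z - of_real u)) (at u)"
proof -
  define h where "h t = exp (of_real (c ^ 3) * (z - of_real t) + of_real (c ^ 6 / 12)) *
        Airy_Ai (2 * of_real c * (z - of_real t) + of_real (c ^ 4 / 4))" for t
  have cont: "continuous_on A h" for A
    unfolding h_def by (intro continuous_intros continuous_on_compose2[OF continuous_on_Airy_Ai[of UNIV]]) auto
  define a b where "a = min 0 u - 1" and "b = max 0 u + 1"
  have "((\<lambda>u. LBINT t=0..u. h t) has_vector_derivative h u) (at u within {a..b})"
    using interval_integral_FTC2[of a 0 b h u] cont[of "{a..b}"] by (simp add: a_def b_def zero_ereal_def)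
  then have "((\<lambda>u. LBINT t=0..u. h t) has_vector_derivative h u) (at u)"
    by (subst (asm) at_within_interior) (auto simp: a_def b_def)
  then have "((\<lambda>u. 2 * of_real c * (LBINT t=0..u. h t)) has_vector_derivative 2 * of_real c * h u) (at u)"
    by (intro has_vector_derivative_mult_right)
  then show ?thesis
    unfolding edge_f_def h_def edge_density_def by (simp only:)
qed

text \<open>Under \<open>u = - y / (2 * c)\<close> the two functions become minus their inner
  integrals over \<open>2 * c\<close>, and their derivatives become the outer integrands. The
  Wronskian is therefore the antisymmetrised integrand, with the sign reversed once. The constant
  rests on \<open>(pi / c)\<^sup>2 / (4 * pi * sqrt pi) = sqrt pi / (4 * c\<^sup>2)\<close>.\<close>

lemma edge_kappa_eq:
  assumes c: "c > 0"
  shows "edge_kappa c z w = (edge_pair_integral c z w - edge_pair_integral c w z) / of_real (4 * pi * sqrt pi)"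
proof -
  define A where "A z y = edge_density c (z + of_real (y / (2 * c)))" for z and y :: real
  define I where "I z y = (\<integral>x. indicator {0..y} x *\<^sub>R A z x \<partial>lborel)" for z y
  define k where "k = complex_of_real (pi / c)"
  have k: "k \<noteq> 0" using c by (simp add: k_def)
  have J: "edge_limit_integral c 1 x z = k * exp (z\<^sup>2) * A z x" for x z
    unfolding edge_limit_integral_eq_density[OF c zero_less_one] A_def k_def ..
  have inner: "(\<integral>x. indicator {0..y} x *\<^sub>R edge_limit_integral c 1 x z \<partial>lborel) = k * exp (z\<^sup>2) * I z y" for y z
    unfolding J I_def integral_mult_right_zero[symmetric] by (simp add: mult_ac scaleR_conv_of_real)
  have outer: "(\<lambda>y. indicator {0..} y *\<^sub>R (edge_limit_integral c 1 y w * (\<integral>x. indicator {0..y} x *\<^sub>R edge_limit_integral c 1 x z \<partial>lborel))) =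
    (\<lambda>y. (k\<^sup>2 * exp (z\<^sup>2 + w\<^sup>2)) * (indicator {0..} y *\<^sub>R (A w y * I z y)))" for z w
    unfolding inner unfolding J by (rule ext) (simp add: scaleR_conv_of_real exp_add power2_eq_square mult_ac)
  have P: "edge_pair_integral c z w = k\<^sup>2 * exp (z\<^sup>2 + w\<^sup>2) * (\<integral>y. indicator {0..} y *\<^sub>R (A w y * I z y) \<partial>lborel)" for z w
    unfolding edge_pair_integral_def outer by (rule integral_mult_right_zero)
  \<comment> \<open>Integrability is inherited from the Riemann sum limit, applied to constant
    sequences, after dividing out the nonzero exponential prefactor.\<close>
  have cancel: "integrable lborel h" if "integrable lborel (\<lambda>y. C * h y)" "C \<noteq> 0" for C :: complex and h :: "real \<Rightarrow> complex"
  proof -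
    have "integrable lborel (\<lambda>y. inverse C * (C * h y))" by (rule integrable_mult_right) (rule that(1))
    also have "(\<lambda>y. inverse C * (C * h y)) = h" using that(2) by (simp flip: mult.assoc)
    finally show ?thesis .
  qed
  have int: "integrable lborel (\<lambda>y. indicator {0..} y *\<^sub>R (A w y * I z y))" for z w
    by (rule cancel[OF edge_sum_tendsto(2)[OF c tendsto_const tendsto_const, of w z, unfolded outer]]) (simp add: k)
  define V where "V u = wronskian (edge_f c w) (edge_f c z) u" for u
  have V: "V (- (y / (2 * c))) = (A w y * I z y - A z y * I w y) / of_real (2 * c)" if "y \<ge> 0" for y
  proof -
    have "edge_density c (v - of_real (- (y / (2 * c)))) = A v y" for v by (simp add: A_def)
    then have d: "vector_derivative (edge_f c v) (at (- (y / (2 * c)))) = A v y" for v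
      using vector_derivative_at[OF edge_f_has_vector_derivative[of c v "- (y / (2 * c))"]] by simp
    have e: "edge_f c v (- (y / (2 * c))) = - I v y / of_real (2 * c)" for v
      using edge_f_eq[OF c that, of v] by (simp add: I_def A_def)
    show ?thesis unfolding V_def wronskian_def d e by (simp add: diff_divide_distrib mult.commute)
  qed
  have "(CLBINT u=-\<infinity>..0. V u) = (\<integral>u. indicator {..<0} u *\<^sub>R V u \<partial>lborel)"
    by (simp add: interval_lebesgue_integral_def set_lebesgue_integral_def einterval_eq zero_ereal_def)
  also have "\<dots> = (1 / (2 * c)) *\<^sub>R (\<integral>y. indicator {..<0} (0 + - (1 / (2 * c)) * y) *\<^sub>R V (0 + - (1 / (2 * c)) * y) \<partial>lborel)"
    using c by (subst lborel_integral_real_affine[where c = "- (1 / (2 * c))" and t = 0]) simp_all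
  also have "(\<integral>y. indicator {..<0} (0 + - (1 / (2 * c)) * y) *\<^sub>R V (0 + - (1 / (2 * c)) * y) \<partial>lborel) =
     (\<integral>y. (indicator {0..} y *\<^sub>R (A w y * I z y) - indicator {0..} y *\<^sub>R (A z y * I w y)) / of_real (2 * c) \<partial>lborel)"
  proof (rule integral_cong_AE)
    have meas: "(\<lambda>y. indicator {0..} y *\<^sub>R (A w y * I z y)) \<in> borel_measurable lborel" "(\<lambda>y. indicator {0..} y *\<^sub>R (A z y * I w y)) \<in> borel_measurable lborel"
      using int by auto
    then show m2: "(\<lambda>y. (indicator {0..} y *\<^sub>R (A w y * I z y) - indicator {0..} y *\<^sub>R (A z y * I w y)) / of_real (2 * c)) \<in> borel_measurable lborel"
      by measurable
    have eq: "indicator {..<0} (0 + - (1 / (2 * c)) * y) *\<^sub>R V (0 + - (1 / (2 * c)) * y) =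
      indicator {0<..} y *\<^sub>R ((indicator {0..} y *\<^sub>R (A w y * I z y) - indicator {0..} y *\<^sub>R (A z y * I w y)) / of_real (2 * c))" for y
      using c V[of y] by (cases "y > 0") (auto simp: indicator_def zero_less_divide_iff)
    show "(\<lambda>y. indicator {..<0} (0 + - (1 / (2 * c)) * y) *\<^sub>R V (0 + - (1 / (2 * c)) * y)) \<in> borel_measurable lborel"
      unfolding eq using m2 by (intro borel_measurable_scaleR borel_measurable_indicator) simp_all
    have "AE y in lborel. y \<noteq> (0::real)" by (rule AE_lborel_singleton)
    then show "AE y in lborel. indicator {..<0} (0 + - (1 / (2 * c)) * y) *\<^sub>R V (0 + - (1 / (2 * c)) * y) =
      (indicator {0..} y *\<^sub>R (A w y * I z y) - indicator {0..} y *\<^sub>R (A z y * I w y)) / of_real (2 * c)"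
      unfolding eq by eventually_elim (auto simp: indicator_def)
  qed
  also have "\<dots> = ((\<integral>y. indicator {0..} y *\<^sub>R (A w y * I z y) \<partial>lborel) - (\<integral>y. indicator {0..} y *\<^sub>R (A z y * I w y) \<partial>lborel)) / of_real (2 * c)"
    using int by simp
  finally have U: "(CLBINT u=-\<infinity>..0. V u) =
    ((\<integral>y. indicator {0..} y *\<^sub>R (A w y * I z y) \<partial>lborel) - (\<integral>y. indicator {0..} y *\<^sub>R (A z y * I w y) \<partial>lborel)) / of_real (4 * c\<^sup>2)"
    by (simp add: scaleR_conv_of_real power2_eq_square)
  define X Y where "X = (\<integral>y. indicator {0..} y *\<^sub>R (A w y * I z y) \<partial>lborel)" and "Y = (\<integral>y. indicator {0..} y *\<^sub>R (A z y * I w y) \<partial>lborel)"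
  have "edge_kappa c z w = of_real (sqrt pi / (4 * c\<^sup>2)) * (exp (z\<^sup>2 + w\<^sup>2) * (X - Y))"
    unfolding edge_kappa_def V_def[symmetric] U X_def[symmetric] Y_def[symmetric] by simp
  also have "sqrt pi / (4 * c\<^sup>2) = (pi / c)\<^sup>2 / (4 * pi * sqrt pi)"
  proof -
    have "sqrt pi * sqrt pi = pi" by simp
    then show ?thesis using c by (simp add: field_simps power2_eq_square)
  qed
  also have "of_real ((pi / c)\<^sup>2 / (4 * pi * sqrt pi)) * (exp (z\<^sup>2 + w\<^sup>2) * (X - Y)) =
    (k\<^sup>2 * exp (z\<^sup>2 + w\<^sup>2) * X - k\<^sup>2 * exp (w\<^sup>2 + z\<^sup>2) * Y) / of_real (4 * pi * sqrt pi)"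
    unfolding k_def add.commute[of "w\<^sup>2"] right_diff_distrib[symmetric] mult.assoc by simp
  finally show ?thesis unfolding P X_def Y_def .
qed

text \<open>The mesh factor in the constant goes to the two Riemann sums. By Stirling's formula and
  \<open>\<tau> \<longrightarrow> 1\<close> the rest tends to \<open>2 / (sqrt (2 * pi) * sqrt 2 * 4
  * pi) = 1 / (4 * pi * sqrt pi)\<close>, which is the normalisation of
  \<open>edge_kappa\<close>.\<close>

lemma edge_kernel_tendsto:
  assumes c: "c > 0" and Z: "Z \<longlonglongrightarrow> z" and W: "W \<longlonglongrightarrow> w"
  shows "(\<lambda>N. edge_kernel c N (Z N) (W N)) \<longlonglongrightarrow> edge_kappa c z w"
proof -
  define a where "a N = stirling_ratio (2 * N) * (1 + edge_tau c N) / (sqrt 2 * 4 * pi * edge_tau c N)" for N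
  have st: "(\<lambda>N. stirling_ratio (2 * N)) \<longlonglongrightarrow> 1 / sqrt (2 * pi)"
    using LIMSEQ_subseq_LIMSEQ[OF stirling_tendsto, of "\<lambda>N. 2 * N"]
    by (simp add: stirling_ratio_def comp_def strict_mono_def)
  have "a \<longlonglongrightarrow> 1 / sqrt (2 * pi) * (1 + 1) / (sqrt 2 * 4 * pi * 1)"
    unfolding a_def by (intro tendsto_intros st edge_tau_tendsto) simp
  also have "1 / sqrt (2 * pi) * (1 + 1) / (sqrt 2 * 4 * pi * 1) = 1 / (4 * pi * sqrt pi)"
  proof -
    have "sqrt (2 * pi) * sqrt 2 = 2 * sqrt pi" by (simp add: real_sqrt_mult)
    then have "1 / sqrt (2 * pi) * (1 + 1) / (sqrt 2 * 4 * pi * 1) = 2 / ((2 * sqrt pi) * 4 * pi)"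
      by (simp add: mult_ac)
    then show ?thesis by simp
  qed
  finally have a: "(\<lambda>N. complex_of_real (a N)) \<longlonglongrightarrow> of_real (1 / (4 * pi * sqrt pi))"
    by (rule tendsto_of_real)
  have "(\<lambda>N. of_real (a N) * (of_real ((2 / edge_scale N)\<^sup>2) * edge_sum c N (Z N) (W N) - of_real ((2 / edge_scale N)\<^sup>2) * edge_sum c N (W N) (Z N)))
    \<longlonglongrightarrow> of_real (1 / (4 * pi * sqrt pi)) * (edge_pair_integral c z w - edge_pair_integral c w z)"
    by (intro tendsto_mult tendsto_diff a edge_sum_tendsto(1)[OF c] Z W)
  moreover have "of_real (1 / (4 * pi * sqrt pi)) * (edge_pair_integral c z w - edge_pair_integral c w z) = edge_kappa c z w"
    unfolding edge_kappa_eq[OF c] by simp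
  moreover have "\<forall>\<^sub>F N in sequentially. of_real (a N) * (of_real ((2 / edge_scale N)\<^sup>2) * edge_sum c N (Z N) (W N) - of_real ((2 / edge_scale N)\<^sup>2) * edge_sum c N (W N) (Z N)) = edge_kernel c N (Z N) (W N)"
    using eventually_edge_regime[OF c]
  proof eventually_elim
    case (elim N)
    then interpret edge_regime c N "edge_tau c N" "edge_scale N" "edge_zoom c N" by simp_all
    have "complex_of_real kernel_const = of_real (a N) * of_real ((2 / edge_scale N)\<^sup>2)"
      unfolding kernel_const_def a_def by simp
    then show ?case unfolding edge_kernel_eq by (simp only: right_diff_distrib mult.assoc)
  qed
  ultimately show ?thesis by (simp only: Lim_transform_eventually)
qed


section \<open>Convergence of the correlation functions\<close>

lemma poly_scaled_hermite_minus: "poly (scaled_hermite a n) (- x) = (- 1) ^ n * poly (scaled_hermite a n) x"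
proof (induction n rule: induct_nat_012)
  case 1
  show ?case by (simp add: scaled_hermite.simps(2) pderiv_1)
qed (simp_all add: scaled_hermite_Suc_Suc algebra_simps)

lemma poly_skew_hermite_minus: "poly (skew_hermite a b n) (- x) = (- 1) ^ n * poly (skew_hermite a b n) x"
proof -
  have even: "poly (even_skew_hermite a b m) (- x) = poly (even_skew_hermite a b m) x" for m
    by (induction m) (simp_all add: poly_scaled_hermite_minus del: scaled_hermite.simps)
  show ?thesis by (auto simp: skew_hermite_def even poly_scaled_hermite_minus)
qed

text \<open>Every term multiplies an odd by an even polynomial, so reflecting both points costs one
  sign. This sign settles the edge with \<open>\<sigma> = -1\<close>.\<close>

lemma pair_kernel_minus:
  "pair_kernel N \<rho> (\<lambda>n. poly (skew_hermite a b n)) (- x) (- y) = - pair_kernel N \<rho> (\<lambda>n. poly (skew_hermite a b n)) x y"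
  unfolding pair_kernel_def sum_negf[symmetric] poly_skew_hermite_minus
  by (intro sum.cong refl) (simp add: minus_divide_left del: divide_minus_left)

lemma pfaffian_scale: "pfaffian k (\<lambda>a b. c * M a b) = c ^ k * pfaffian k M"
  unfolding pfaffian_def prod.distrib prod_constant
  by (simp add: sum_distrib_left mult_ac)

text \<open>Each summand of the Pfaffian uses every row index exactly once, so the row factors come
  out as a common product.\<close>

lemma pfaffian_scale_rows: "pfaffian k (\<lambda>a b. r a * r b * M a b) = (\<Prod>a<2 * k. r a) * pfaffian k M"
proof -
  have "(\<Prod>j<k. r (s (2 * j)) * r (s (2 * j + 1))) = (\<Prod>a<2 * k. r a)" if "s permutes {..<2 * k}" for s
    using prod_lessThan_double[of "\<lambda>a. r (s a)" k] prod.permute[OF that, of r] by (simp add: comp_def)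
  then have "(\<Sum>s | s permutes {..<2 * k}. of_int (sign s) * (\<Prod>j<k. r (s (2 * j)) * r (s (2 * j + 1)) * M (s (2 * j)) (s (2 * j + 1)))) =
     (\<Prod>a<2 * k. r a) * (\<Sum>s | s permutes {..<2 * k}. of_int (sign s) * (\<Prod>j<k. M (s (2 * j)) (s (2 * j + 1))))"
    unfolding sum_distrib_left by (intro sum.cong refl) (simp add: prod.distrib)
  then show ?thesis unfolding pfaffian_def by simp
qed

lemma elliptic_potential_minus: "elliptic_potential \<tau> (- z) = elliptic_potential \<tau> z"
  by (simp add: elliptic_potential_def)

context edge_regime
begin

text \<open>The term \<open>Re (x\<^sup>2)\<close> is already half the sum of a holomorphic and an
  antiholomorphic square. The only mixed term comes from the squared modulus of \<open>x\<close>,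
  and \<open>N * g\<^sup>2 / (1 - \<tau>\<^sup>2) = 2\<close> makes it the universal
  Gaussian.\<close>

lemma exp_elliptic_potential_edge_point:
  "complex_of_real (exp (- real N * elliptic_potential \<tau> (edge_point c N z))) =
     of_real (exp (- 2 * (cmod z)\<^sup>2)) * edge_factor c N z * edge_factor c N (cnj z)"
proof -
  define p where "p = sqrt 2 * (1 + \<tau>)"
  define D where "D = complex_of_real (real N / (1 - \<tau>\<^sup>2))"
  define P G T where "P = complex_of_real p" and "G = complex_of_real g" and "T = complex_of_real \<tau>"
  define x where "x = edge_point c N z"
  have x: "x = P + G * z" "edge_point c N (cnj z) = cnj x"
    by (simp_all add: x_def edge_point_def P_def p_def G_def \<tau>_def g_def)
  have "1 - \<tau>\<^sup>2 \<noteq> 0" using \<tau> by (simp add: power2_eq_1_iff)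
  then have "real N / (1 - \<tau>\<^sup>2) * g\<^sup>2 = 2" using g_square by (simp add: field_simps)
  then have D: "D * G\<^sup>2 = 2"
    unfolding D_def G_def of_real_power[symmetric] of_real_mult[symmetric] by simp
  have h: "edge_factor c N w = exp (- D * (P\<^sup>2 / 2 + P * G * w - T * (edge_point c N w)\<^sup>2 / 2))" for w
    unfolding edge_factor_def Let_def D_def P_def G_def T_def p_def \<tau>_def g_def by simp
  have re: "complex_of_real (Re (x\<^sup>2)) = (x\<^sup>2 + (cnj x)\<^sup>2) / 2"
    using complex_add_cnj[of "x\<^sup>2"] by simp
  have "complex_of_real (- real N * elliptic_potential \<tau> x) =
      of_real (real N / (1 - \<tau>\<^sup>2)) * (T * of_real (Re (x\<^sup>2)) - of_real ((cmod x)\<^sup>2))"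
    unfolding elliptic_potential_def T_def of_real_mult[symmetric] of_real_diff[symmetric] of_real_eq_iff
    by (simp add: field_simps)
  also have "\<dots> = D * (T * ((x\<^sup>2 + (cnj x)\<^sup>2) / 2) - x * cnj x)"
    unfolding D_def re complex_norm_square ..
  also have "x * cnj x = P\<^sup>2 + P * G * z + P * G * cnj z + G\<^sup>2 * (z * cnj z)"
    unfolding x by (simp add: P_def G_def algebra_simps power2_eq_square)
  also have "D * (T * ((x\<^sup>2 + (cnj x)\<^sup>2) / 2) - (P\<^sup>2 + P * G * z + P * G * cnj z + G\<^sup>2 * (z * cnj z))) =
     - (D * G\<^sup>2) * (z * cnj z) + - D * (P\<^sup>2 / 2 + P * G * z - T * x\<^sup>2 / 2) + - D * (P\<^sup>2 / 2 + P * G * cnj z - T * (cnj x)\<^sup>2 / 2)"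
    by (simp add: field_simps)
  also have "- (D * G\<^sup>2) * (z * cnj z) = of_real (- 2 * (cmod z)\<^sup>2)"
    unfolding D of_real_mult complex_norm_square by simp
  finally have "exp (complex_of_real (- real N * elliptic_potential \<tau> x)) =
     exp (of_real (- 2 * (cmod z)\<^sup>2)) * edge_factor c N z * edge_factor c N (cnj z)"
    unfolding h x(2) by (simp only: exp_add x_def[symmetric])
  then show ?thesis unfolding x_def by (simp only: exp_of_real)
qed

text \<open>Bookkeeping of prefactors. The weight of a particle supplies one scale factor, the sign,
  \<open>cnj z - z\<close>, and the row factors of the point and of its conjugate. The scale joins
  the two powers from the rescaling, the sign meets the parity sign of the kernel and disappears,
  and the row factors enter the matrix.\<close>

lemma rescaled_correlation_eq:
  assumes \<sigma>: "\<sigma> \<in> {1, -1}" and "k \<le> N"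
  shows "complex_of_real (rescaled_correlation (elliptic_potential \<tau>) (of_real (\<sigma> * sqrt 2 * (1 + \<tau>))) (of_real \<sigma>) g N k z) =
    (\<Prod>j<k. cnj (z j) - z j) *
     pfaffian k (\<lambda>a b. of_real (exp (- (cmod (z (a div 2)))\<^sup>2 - (cmod (z (b div 2)))\<^sup>2)) *
       edge_kernel c N (conj_pair z a) (conj_pair z b))"
proof -
  define u h where "u = edge_point c N" and "h = edge_factor c N"
  define q where "q = skew_hermite (of_real (\<tau> / real N)) (real N)"
  define \<rho> where "\<rho> i = complex_of_real ((1 - \<tau>) * sqrt (1 - \<tau>\<^sup>2) * fact (Suc (2 * i)) / real N ^ (2 * i + 2))" for i
  define K where "K = pair_kernel N \<rho> (\<lambda>n. poly (q n))"
  define S where "S = complex_of_real \<sigma>"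
  define G where "G = complex_of_real g"
  define e where "e x = complex_of_real (exp (- (cmod x)\<^sup>2))" for x :: complex
  define r where "r a = e (z (a div 2)) * h (conj_pair z a)" for a
  define M where "M a b = K (u (conj_pair z a)) (u (conj_pair z b))" for a b
  have S: "S = 1 \<or> S = -1" using \<sigma> by (auto simp: S_def)
  have cnj_u: "u (cnj x) = cnj (u x)" for x by (simp add: u_def edge_point_def)
  have point: "of_real (\<sigma> * sqrt 2 * (1 + \<tau>)) + of_real \<sigma> * complex_of_real g * z j = S * u (z j)" for j
    by (simp add: u_def edge_point_def S_def \<tau>_def g_def algebra_simps)
  have cp: "conj_pair (\<lambda>j. S * u (z j)) a = S * u (conj_pair z a)" for a
    by (simp add: conj_pair_def cnj_u S_def)
  have K: "K (S * x) (S * y) = S * K x y" for x y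
    using S by (auto simp: K_def q_def pair_kernel_minus)
  interpret E: elliptic_moments \<tau> N "(1 + \<tau>) / (2 * real N)" "(1 - \<tau>) / (2 * real N)" "of_real (\<tau> / real N)"
    using \<tau> N by unfold_locales simp_all
  have \<rho>: "(\<lambda>m. E.norm_const m / of_real pi) = \<rho>"
    by (rule ext) (simp only: E.norm_const_eq \<rho>_def)
  have deg: "degree (q n) = n" "lead_coeff (q n) = 1" for n
    unfolding q_def using degree_skew_hermite_lead_coeff by blast+
  have "\<bar>\<tau>\<bar> < 1" using \<tau> by simp
  then have "\<tau>\<^sup>2 < 1" by (simp only: abs_square_less_1)
  then have \<rho>0: "\<rho> i \<noteq> 0" for i
    unfolding \<rho>_def of_real_eq_0_iff using \<tau> N by (simp del: fact_Suc)
  have weight: "- pair_weight (elliptic_potential \<tau>) N (S * u x) =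
      S * G * (cnj x - x) * ((e x * h x) * (e x * h (cnj x)))" for x
  proof -
    have Q: "elliptic_potential \<tau> (S * u x) = elliptic_potential \<tau> (u x)"
      using S elliptic_potential_minus by auto
    have "of_real (exp (- 2 * (cmod x)\<^sup>2)) = e x * e x"
      unfolding e_def of_real_mult[symmetric] mult_exp_exp by simp
    then have W: "of_real (exp (- real N * elliptic_potential \<tau> (S * u x))) = e x * e x * h x * h (cnj x)"
      unfolding Q unfolding u_def exp_elliptic_potential_edge_point h_def by (simp only: mult_ac)
    have "cnj (u x) - u x = G * (cnj x - x)"
      by (simp add: u_def edge_point_def G_def g_def algebra_simps)
    moreover have "cnj S = S" by (simp add: S_def)
    moreover from this have "- (S * u x - cnj (S * u x)) = S * (cnj (u x) - u x)" by (simp add: algebra_simps)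
    ultimately have "- (S * u x - cnj (S * u x)) = S * (G * (cnj x - x))" by (simp only:)
    then show ?thesis unfolding pair_weight_def W minus_mult_left by (simp only: mult_ac)
  qed
  have "complex_of_real (correlation (elliptic_potential \<tau>) N k (\<lambda>j. S * u (z j))) =
      (\<Prod>j<k. - pair_weight (elliptic_potential \<tau>) N (S * u (z j))) *
      pfaffian k (\<lambda>a b. K (conj_pair (\<lambda>j. S * u (z j)) a) (conj_pair (\<lambda>j. S * u (z j)) b))"
    unfolding K_def
    by (rule correlation_eq_pfaffian[OF deg])
      (rule E.has_bochner_integral_skew_hermite[unfolded \<rho>, folded q_def] \<rho>0 \<open>k \<le> N\<close>)+
  also have "(\<Prod>j<k. - pair_weight (elliptic_potential \<tau>) N (S * u (z j))) =
      (S * G) ^ k * (\<Prod>j<k. cnj (z j) - z j) * (\<Prod>a<2 * k. r a)"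
    unfolding weight prod.distrib[where g = "\<lambda>j. e (z j) * h (z j) * (e (z j) * h (cnj (z j)))"] prod_lessThan_double
    by (simp add: prod.distrib r_def conj_pair_def)
  also have "pfaffian k (\<lambda>a b. K (conj_pair (\<lambda>j. S * u (z j)) a) (conj_pair (\<lambda>j. S * u (z j)) b)) = S ^ k * pfaffian k M"
    unfolding cp K pfaffian_scale M_def ..
  finally have cor: "complex_of_real (correlation (elliptic_potential \<tau>) N k (\<lambda>j. S * u (z j))) =
      (S * G) ^ k * (\<Prod>j<k. cnj (z j) - z j) * (\<Prod>a<2 * k. r a) * (S ^ k * pfaffian k M)" .
  have "complex_of_real (rescaled_correlation (elliptic_potential \<tau>) (of_real (\<sigma> * sqrt 2 * (1 + \<tau>))) (of_real \<sigma>) g N k z) =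
      G ^ (2 * k) * ((S * G) ^ k * (\<Prod>j<k. cnj (z j) - z j) * (\<Prod>a<2 * k. r a) * (S ^ k * pfaffian k M))"
    unfolding rescaled_correlation_def point of_real_mult[of "g ^ (2 * k)"] cor by (simp add: G_def)
  also have "\<dots> = (G ^ (2 * k) * G ^ k) * (S ^ k * S ^ k) * ((\<Prod>j<k. cnj (z j) - z j) * ((\<Prod>a<2 * k. r a) * pfaffian k M))"
    by (simp only: power_mult_distrib mult_ac)
  also have "S ^ k * S ^ k = 1" using S by (auto simp flip: power_mult_distrib)
  also have "G ^ (2 * k) * G ^ k = (G ^ 3) ^ k"
    by (simp flip: power_add power_mult)
  also have "(G ^ 3) ^ k * 1 * ((\<Prod>j<k. cnj (z j) - z j) * ((\<Prod>a<2 * k. r a) * pfaffian k M)) =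
      (\<Prod>j<k. cnj (z j) - z j) * pfaffian k (\<lambda>a b. G ^ 3 * (r a * r b * M a b))"
    unfolding pfaffian_scale pfaffian_scale_rows by (simp only: mult_ac mult_1_left mult_1_right)
  also have "(\<lambda>a b. G ^ 3 * (r a * r b * M a b)) = (\<lambda>a b. of_real (exp (- (cmod (z (a div 2)))\<^sup>2 - (cmod (z (b div 2)))\<^sup>2)) *
       edge_kernel c N (conj_pair z a) (conj_pair z b))"
  proof (intro ext)
    fix a b
    have "complex_of_real (exp (- (cmod (z (a div 2)))\<^sup>2 - (cmod (z (b div 2)))\<^sup>2)) = e (z (a div 2)) * e (z (b div 2))"
      unfolding e_def of_real_mult[symmetric] mult_exp_exp by simp
    moreover have "edge_kernel c N (conj_pair z a) (conj_pair z b) = G ^ 3 * h (conj_pair z a) * h (conj_pair z b) * M a b"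
      unfolding edge_kernel_def G_def h_def M_def K_def \<rho>_def q_def u_def \<tau>_def g_def of_real_power ..
    ultimately show "G ^ 3 * (r a * r b * M a b) = of_real (exp (- (cmod (z (a div 2)))\<^sup>2 - (cmod (z (b div 2)))\<^sup>2)) *
       edge_kernel c N (conj_pair z a) (conj_pair z b)"
      by (simp only: r_def mult_ac)
  qed
  finally show ?thesis .
qed

end


text \<open>The Pfaffian is a finite sum of finite products of kernel values, so the limit passes
  through it termwise. Only the coordinates with index below \<open>k\<close> occur, hence
  convergence is assumed for these alone.\<close>

lemma rescaled_correlation_tendsto:
  assumes c: "c > 0" and \<sigma>: "\<sigma> \<in> {1, -1}" and Z: "\<And>j. j < k \<Longrightarrow> (\<lambda>N. Z N j) \<longlonglongrightarrow> z j"
  shows "(\<lambda>N. complex_of_real (rescaled_correlation (elliptic_potential (edge_tau c N))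
      (of_real (\<sigma> * sqrt 2 * (1 + edge_tau c N))) (of_real \<sigma>) (edge_zoom c N) N k (Z N)))
    \<longlonglongrightarrow> edge_correlation c k z"
proof -
  have pair: "(\<lambda>N. conj_pair (Z N) a) \<longlonglongrightarrow> conj_pair z a" if "a < 2 * k" for a
    unfolding conj_pair_def using that by (auto intro!: tendsto_intros Z)
  have perm: "s (2 * j) < 2 * k" "s (2 * j + 1) < 2 * k" if "s permutes {..<2 * k}" "j < k" for s j
    using permutes_in_image[OF that(1), of "2 * j"] permutes_in_image[OF that(1), of "2 * j + 1"] that(2) by auto
  have "(\<lambda>N. (\<Prod>j<k. cnj (Z N j) - Z N j) *
     pfaffian k (\<lambda>a b. of_real (exp (- (cmod (Z N (a div 2)))\<^sup>2 - (cmod (Z N (b div 2)))\<^sup>2)) *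
       edge_kernel c N (conj_pair (Z N) a) (conj_pair (Z N) b))) \<longlonglongrightarrow> edge_correlation c k z"
    unfolding edge_correlation_def pfaffian_def
    by (intro tendsto_mult tendsto_const tendsto_sum tendsto_prod tendsto_diff tendsto_cnj tendsto_of_real
        tendsto_exp tendsto_minus tendsto_power tendsto_norm edge_kernel_tendsto[OF c] pair Z)
      (use perm in \<open>auto simp: less_mult_imp_div_less mult.commute\<close>)
  moreover have "\<forall>\<^sub>F N in sequentially. (\<Prod>j<k. cnj (Z N j) - Z N j) *
     pfaffian k (\<lambda>a b. of_real (exp (- (cmod (Z N (a div 2)))\<^sup>2 - (cmod (Z N (b div 2)))\<^sup>2)) *
       edge_kernel c N (conj_pair (Z N) a) (conj_pair (Z N) b)) =
     complex_of_real (rescaled_correlation (elliptic_potential (edge_tau c N))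
      (of_real (\<sigma> * sqrt 2 * (1 + edge_tau c N))) (of_real \<sigma>) (edge_zoom c N) N k (Z N))"
    using eventually_edge_regime[OF c] eventually_ge_at_top[of k]
  proof eventually_elim
    case (elim N)
    then interpret edge_regime c N "edge_tau c N" "edge_scale N" "edge_zoom c N" by simp_all
    show ?case by (rule rescaled_correlation_eq[OF \<sigma> elim(2), symmetric])
  qed
  ultimately show ?thesis by (rule Lim_transform_eventually)
qed

theorem theorem2p2:
  fixes c \<sigma> :: real and \<tau> p \<gamma> :: "nat \<Rightarrow> real" and k :: nat
  assumes "c > 0" and "\<sigma> \<in> {1, -1}"
    and "\<And>N. \<tau> N = 1 - c\<^sup>2 / (2 * real N) powr (1 / 3)"
    and "\<And>N. p N = \<sigma> * sqrt 2 * (1 + \<tau> N)"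
    and "\<And>N. \<gamma> N = sqrt (2 * (1 - (\<tau> N)\<^sup>2) / real N)"
    and "k \<ge> 1"
  shows "locally_uniform_limit (complex_space k)
    (\<lambda>N z. complex_of_real
       (rescaled_correlation (elliptic_potential (\<tau> N)) (of_real (p N)) (of_real \<sigma>) (\<gamma> N) N k z))
    (edge_correlation c k) sequentially"
proof -
  define f where "f N z = complex_of_real (rescaled_correlation (elliptic_potential (edge_tau c N))
      (of_real (\<sigma> * sqrt 2 * (1 + edge_tau c N))) (of_real \<sigma>) (edge_zoom c N) N k z)" for N z
  define g where "g N z = complex_of_real
       (rescaled_correlation (elliptic_potential (\<tau> N)) (of_real (p N)) (of_real \<sigma>) (\<gamma> N) N k z)" for N z
  have tau_eq: "\<tau> N = edge_tau c N" for N
    unfolding assms(3) edge_tau_def edge_scale_def ..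
  \<comment> \<open>The two forms of the scale are identified only in the regime where
    \<open>\<tau>\<close> is positive, that is, for all large \<open>N\<close>; this suffices for
    the limit.\<close>
  have eq: "\<forall>\<^sub>F N in sequentially. \<forall>z. f N z = g N z"
    using eventually_edge_regime[OF \<open>c > 0\<close>]
  proof (rule eventually_mono)
    fix N
    assume "edge_regime c N \<and> 1 / 2 \<le> edge_tau c N \<and> 1 \<le> edge_scale N"
    then have "edge_zoom c N = \<gamma> N"
      using edge_regime.zoom_eq[of c N] by (simp only: assms(5) tau_eq)
    then show "\<forall>z. f N z = g N z"
      by (simp only: f_def g_def assms(4) tau_eq simp_thms)
  qed
  have "\<exists>U. openin (complex_space k) U \<and> x \<in> U \<and> uniform_limit U g (edge_correlation c k) sequentially"
    if x: "x \<in> topspace (complex_space k)" for x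
  proof -
    define U where "U = (\<Pi>\<^sub>E i\<in>{..<k}. ball (x i) 1)"
    \<comment> \<open>The closed box is viewed inside the space of all functions on
      \<open>nat\<close>, whose product topology is metrizable; fixing the other coordinates at
      \<open>undefined\<close> keeps it compact and makes it contain the extensional functions of
      \<open>U\<close>.\<close>
    define K where "K = (\<Pi>\<^sub>E i\<in>UNIV. if i < k then cball (x i) 1 else {undefined})"
    have "openin (complex_space k) U"
      unfolding U_def by (simp add: openin_PiE_gen)
    moreover have "x \<in> U"
      using x by (auto simp: U_def PiE_iff)
    moreover have "uniform_limit U g (edge_correlation c k) sequentially"
    proof -
      have "compactin (product_topology (\<lambda>_. euclidean) (UNIV :: nat set)) K"
        unfolding K_def compactin_PiE by simp
      then have "compact K"
        by (simp add: euclidean_product_topology)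
      then have "uniform_limit K f (edge_correlation c k) sequentially"
      proof (intro continuous_convergence_imp_uniform_limit)
        fix X :: "nat \<Rightarrow> nat \<Rightarrow> complex" and y
        assume X: "X \<longlonglongrightarrow> y"
        have "(\<lambda>N. X N j) \<longlonglongrightarrow> y j" for j
          by (rule continuous_on_tendsto_compose[OF continuous_on_product_coordinates X]) simp_all
        then show "(\<lambda>N. f N (X N)) \<longlonglongrightarrow> edge_correlation c k y"
          unfolding f_def by (intro rescaled_correlation_tendsto assms)
      qed
      moreover have "U \<subseteq> K"
        by (force simp: U_def K_def PiE_iff extensional_def)
      ultimately have "uniform_limit U f (edge_correlation c k) sequentially"
        by (rule uniform_limit_on_subset)
      moreover have "uniform_limit U f (edge_correlation c k) sequentially \<longleftrightarrow>
          uniform_limit U g (edge_correlation c k) sequentially"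
        using eq by (intro uniform_limit_cong refl) (auto elim: eventually_mono)
      ultimately show ?thesis by (simp only:)
    qed
    ultimately show ?thesis by blast
  qed
  then show ?thesis
    unfolding locally_uniform_limit_def g_def by blast
qed

end
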